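(* Let $\Omega\subset\mathbb{R}^N$ ($N\ge 2$) be a bounded smooth domain, $0<s<1<p<\infty$, and let $\omega\in L^r(\Omega)\setminus\{0\}$ with $r>1$ and $\omega\ge0$. For $\alpha<1$ sufficiently close to $1$ (so that $r\ge r_\alpha$), let $u_\alpha\in W_0^{s,p}(\Omega)$ be the unique weak solution of $(-\Delta_p)^s u=\omega u^{-\alpha}$ in $\Omega$, $u>0$ in $\Omega$, $u=0$ on $\mathbb{R}^N\setminus\Omega$, and set $$U_\alpha:=\Big(\int_\Omega|u_\alpha|^{1-\alpha}\omega\,dx\Big)^{-\frac1{1-\alpha}}u_\alpha,\qquad V_\alpha:=\|\omega\|_1^{\frac1{1-\alpha}}U_\alpha,\qquad \lambda_\alpha:=\min\Big\{[v]_{s,p}^p: v\in W_0^{s,p}(\Omega),\int_\Omega|v|^{1-\alpha}\omega\,dx=1\Big\}.$$ Suppose that $\mu:=\lim_{\alpha\to1^-}\lambda_\alpha\|\omega\|_1^{\frac{p}{1-\alpha}}<\infty$, and let $$\mathcal{M}:=\Big\{v\in W_0^{s,p}(\Omega):\int_\Omega(\log|v|)\,\omega\,dx=0\Big\}.$$ Then $V_\alpha$ converges in $W_0^{s,p}(\Omega)$, as $\alpha\to1^-$, to a nonnegative function $V\in\mathcal{M}$ which minimizes the functional $v\mapsto[v]_{s,p}^p$ on $\mathcal{M}$. Moreover, the only minimizers of this functional on $\mathcal{M}$ are $-V$ and $V$. Consequently, the equality $$\mu\exp\left(\frac{p}{\|\omega\|_1}\int_\Omega(\log|v|)\,\omega\,dx\right)=[v]_{s,p}^p$$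 holds for some $v\in W_0^{s,p}(\Omega)$ if, and only if, $v=kV$ for some constant $k$.
   Context: Gagliardo semi-norm: $[u]_{s,p}:=\left(\iint_{\mathbb{R}^{2N}}\frac{|u(x)-u(y)|^p}{|x-y|^{N+sp}}\,dx\,dy\right)^{1/p}$. $W_0^{s,p}(\Omega)$ is the completion of $C_c^\infty(\Omega)$ with respect to $([u]_{s,p}^p+\|u\|_p^p)^{1/p}$; equivalently $W_0^{s,p}(\Omega)=\{u\in L^p(\mathbb{R}^N):[u]_{s,p}<\infty,\ u=0 \text{ in }\mathbb{R}^N\setminus\Omega\}$, normed by $[\cdot]_{s,p}$. $\|\cdot\|_1$ is the $L^1(\Omega)$ norm. Pairing: $\langle(-\Delta_p)^s u,v\rangle:=\iint_{\mathbb{R}^{2N}}\frac{|u(x)-u(y)|^{p-2}(u(x)-u(y))(v(x)-v(y))}{|x-y|^{N+sp}}\,dx\,dy$ for $u,v\in W_0^{s,p}(\Omega)$. Weak solution: $u\in W_0^{s,p}(\Omega)$ is a weak solution of the singular problem $(-\Delta_p)^s u=\omega u^{-\alpha}$ in $\Omega$, $u>0$ in $\Omega$, $u=0$ on $\mathbb{R}^N\setminus\Omega$, if (i) for each subdomain $\Omega'$ compactly contained in $\Omega$ there is a constant $C_{\Omega'}>0$ with $u\ge C_{\Omega'}$ a.e. in $\Omega'$; and (ii) $\langle(-\Delta_p)^s u,\varphi\rangle=\int_\Omega\frac{\omega\varphi}{u^\alpha}\,dx$ for all $\varphi\in C_c^\infty(\Omega)$. Exponents: $p_s^\star:=\frac{Np}{N-sp}$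 if $N>sp$ and $p_s^\star:=\infty$ if $N\le sp$; $t':=t/(t-1)$. For $0<\alpha<1$: $r_\alpha:=\left(\frac{p_s^\star}{1-\alpha}\right)'$ if $sp<N$, and $r_\alpha:=\alpha^{-1}$ if $sp\ge N$. If $r\ge r_\alpha$, then $u_\alpha$ exists and is unique and the minimum $\lambda_\alpha$ exists. Since $r>1$ and $r_\alpha\to1^+$ as $\alpha\to1^-$, there is $\alpha_0\in(0,1)$ with $r\ge r_\alpha$ for all $\alpha\in[\alpha_0,1)$; on $[\alpha_0,1)$ the map $\alpha\mapsto\lambda_\alpha\|\omega\|_1^{p/(1-\alpha)}$ is nondecreasing, so the limit $\mu$ exists in $(0,\infty]$. The integral $\int_\Omega(\log|v|)\omega\,dx$ takes values in $[-\infty,\infty)$ and $\exp(-\infty)=0$. *)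

theory Defs
  imports "HOL-Analysis.Analysis"
begin

section \<open>Smooth functions and smooth domains\<close>

primrec Ck :: "nat \<Rightarrow> ('a::euclidean_space \<Rightarrow> real) \<Rightarrow> bool" where
  "Ck 0 f \<longleftrightarrow> continuous_on UNIV f"
| "Ck (Suc k) f \<longleftrightarrow> (\<forall>x. f differentiable (at x)) \<and>
     (\<forall>v. Ck k (\<lambda>x. frechet_derivative f (at x) v))"

definition smooth :: "('a::euclidean_space \<Rightarrow> real) \<Rightarrow> bool" where
  "smooth f \<longleftrightarrow> (\<forall>k. Ck k f)"

text \<open>
  The boundary is locally the graph of a smooth function, with the domain on one side of it:
  in the direction of the unit vector \<open>e\<close>, the height \<open>x \<bullet> e\<close> is compared with
  a smooth function of the component of \<open>x\<close> orthogonal to \<open>e\<close>.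
\<close>

definition smooth_boundary :: "'a::euclidean_space set \<Rightarrow> bool" where
  "smooth_boundary \<Omega> \<longleftrightarrow>
     (\<forall>z\<in>frontier \<Omega>. \<exists>\<rho>>0. \<exists>e \<gamma>. norm e = 1 \<and> smooth \<gamma> \<and>
        \<Omega> \<inter> ball z \<rho> = {x \<in> ball z \<rho>. \<gamma> (x - (x \<bullet> e) *\<^sub>R e) < x \<bullet> e})"

definition bounded_smooth_domain :: "'a::euclidean_space set \<Rightarrow> bool" where
  "bounded_smooth_domain \<Omega> \<longleftrightarrow>
     open \<Omega> \<and> connected \<Omega> \<and> \<Omega> \<noteq> {} \<and> bounded \<Omega> \<and> smooth_boundary \<Omega>"

definition Cc_smooth :: "'a::euclidean_space set \<Rightarrow> ('a \<Rightarrow> real) set" where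
  "Cc_smooth \<Omega> = {\<phi>. smooth \<phi> \<and> compact (closure {x. \<phi> x \<noteq> 0}) \<and> closure {x. \<phi> x \<noteq> 0} \<subseteq> \<Omega>}"

section \<open>Fractional Sobolev spaces\<close>

text \<open>
  Elements of Lebesgue and Sobolev spaces are rendered by Borel measurable representatives;
  every class modulo null sets has one. The integrand below vanishes on the (null) diagonal,
  where Isabelle's division returns 0.
\<close>

definition gagliardo_energy :: "real \<Rightarrow> real \<Rightarrow> ('a::euclidean_space \<Rightarrow> real) \<Rightarrow> ennreal" where
  "gagliardo_energy s p u =
     (\<integral>\<^sup>+ (x, y). ennreal (\<bar>u x - u y\<bar> powr p / norm (x - y) powr (real DIM('a) + s * p))
        \<partial>(lborel \<Otimes>\<^sub>M lborel))"

text \<open>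
  The real-valued seminorm \<open>[u]\<^bsub>s,p\<^esub>\<close>; it is only meaningful if the energy is finite
  (\<open>enn2real \<infinity> = 0\<close>), as is the case for all members of the spaces below.
\<close>

definition gagliardo :: "real \<Rightarrow> real \<Rightarrow> ('a::euclidean_space \<Rightarrow> real) \<Rightarrow> real" where
  "gagliardo s p u = enn2real (gagliardo_energy s p u) powr (1 / p)"

definition Lp_energy :: "real \<Rightarrow> ('a::euclidean_space \<Rightarrow> real) \<Rightarrow> ennreal" where
  "Lp_energy p u = (\<integral>\<^sup>+ x. ennreal (\<bar>u x\<bar> powr p) \<partial>lborel)"

definition Wsp :: "real \<Rightarrow> real \<Rightarrow> ('a::euclidean_space \<Rightarrow> real) set" where
  "Wsp s p = {u \<in> borel_measurable lborel. Lp_energy p u < \<infinity> \<and> gagliardo_energy s p u < \<infinity>}"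

text \<open>
  The completion of the test functions with respect to the norm
  \<open>([u]\<^bsub>s,p\<^esub>\<^sup>p + \<parallel>u\<parallel>\<^sub>p\<^sup>p)\<^bsup>1/p\<^esup>\<close>, realised as
  their closure in the complete space \<open>Wsp\<close>.
\<close>

definition W0sp :: "'a::euclidean_space set \<Rightarrow> real \<Rightarrow> real \<Rightarrow> ('a \<Rightarrow> real) set" where
  "W0sp \<Omega> s p = {u \<in> Wsp s p. \<exists>\<phi>::nat \<Rightarrow> 'a \<Rightarrow> real. (\<forall>n. \<phi> n \<in> Cc_smooth \<Omega>) \<and>
     ((\<lambda>n. gagliardo_energy s p (\<lambda>x. u x - \<phi> n x) + Lp_energy p (\<lambda>x. u x - \<phi> n x)) \<longlonglongrightarrow> 0)}"

section \<open>The singular problem\<close>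

definition pairing :: "real \<Rightarrow> real \<Rightarrow> ('a::euclidean_space \<Rightarrow> real) \<Rightarrow> ('a \<Rightarrow> real) \<Rightarrow> real" where
  "pairing s p u v =
     (\<integral>(x, y). \<bar>u x - u y\<bar> powr (p - 2) * (u x - u y) * (v x - v y)
        / norm (x - y) powr (real DIM('a) + s * p) \<partial>(lborel \<Otimes>\<^sub>M lborel))"

text \<open>Compact containment of \<open>\<Omega>'\<close> is \<open>closure \<Omega>' \<subseteq> \<Omega>\<close> with compact closure.\<close>

definition weak_solution ::
    "'a::euclidean_space set \<Rightarrow> real \<Rightarrow> real \<Rightarrow> ('a \<Rightarrow> real) \<Rightarrow> real \<Rightarrow> ('a \<Rightarrow> real) \<Rightarrow> bool" where
  "weak_solution \<Omega> s p \<omega> \<alpha> u \<longleftrightarrow>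
     u \<in> W0sp \<Omega> s p \<and>
     (\<forall>\<Omega>'. open \<Omega>' \<and> connected \<Omega>' \<and> compact (closure \<Omega>') \<and> closure \<Omega>' \<subseteq> \<Omega> \<longrightarrow>
        (\<exists>C>0. AE x in lborel. x \<in> \<Omega>' \<longrightarrow> C \<le> u x)) \<and>
     (\<forall>\<phi>\<in>Cc_smooth \<Omega>.
        pairing s p u \<phi> = (LINT x:\<Omega>|lborel. \<omega> x * \<phi> x / u x powr \<alpha>))"

definition p_star :: "nat \<Rightarrow> real \<Rightarrow> real \<Rightarrow> ereal" where
  "p_star N s p = (if s * p < real N then ereal (real N * p / (real N - s * p)) else \<infinity>)"

definition conj_exp :: "real \<Rightarrow> real" where
  "conj_exp t = t / (t - 1)"

text \<open>In the first branch below \<open>p_star\<close> is finite.\<close>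

definition r_exp :: "nat \<Rightarrow> real \<Rightarrow> real \<Rightarrow> real \<Rightarrow> real" where
  "r_exp N s p \<alpha> =
     (if s * p < real N then conj_exp (real_of_ereal (p_star N s p) / (1 - \<alpha>)) else 1 / \<alpha>)"

definition L1_norm :: "'a::euclidean_space set \<Rightarrow> ('a \<Rightarrow> real) \<Rightarrow> real" where
  "L1_norm \<Omega> \<omega> = (LINT x:\<Omega>|lborel. \<bar>\<omega> x\<bar>)"

definition U_normalized ::
    "'a::euclidean_space set \<Rightarrow> ('a \<Rightarrow> real) \<Rightarrow> real \<Rightarrow> ('a \<Rightarrow> real) \<Rightarrow> 'a \<Rightarrow> real" where
  "U_normalized \<Omega> \<omega> \<alpha> u x =
     (LINT y:\<Omega>|lborel. \<bar>u y\<bar> powr (1 - \<alpha>) * \<omega> y) powr (- 1 / (1 - \<alpha>)) * u x"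

definition V_normalized ::
    "'a::euclidean_space set \<Rightarrow> ('a \<Rightarrow> real) \<Rightarrow> real \<Rightarrow> ('a \<Rightarrow> real) \<Rightarrow> 'a \<Rightarrow> real" where
  "V_normalized \<Omega> \<omega> \<alpha> u x = L1_norm \<Omega> \<omega> powr (1 / (1 - \<alpha>)) * U_normalized \<Omega> \<omega> \<alpha> u x"

text \<open>
  The minimum is attained for the exponents under consideration, so it equals the infimum.
  A non-integrable constraint integral has the value 0 and hence is excluded.
\<close>

definition lambda_min ::
    "'a::euclidean_space set \<Rightarrow> real \<Rightarrow> real \<Rightarrow> ('a \<Rightarrow> real) \<Rightarrow> real \<Rightarrow> real" where
  "lambda_min \<Omega> s p \<omega> \<alpha> =
     Inf {gagliardo s p v powr p | v. v \<in> W0sp \<Omega> s p \<and>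
            (LINT x:\<Omega>|lborel. \<bar>v x\<bar> powr (1 - \<alpha>) * \<omega> x) = 1}"

section \<open>Logarithmic integrals\<close>

definition ln_ext :: "real \<Rightarrow> ereal" where
  "ln_ext t = (if t = 0 then -\<infinity> else ereal (ln t))"

definition exp_ext :: "ereal \<Rightarrow> ereal" where
  "exp_ext t = (if t = -\<infinity> then 0 else if t = \<infinity> then \<infinity> else ereal (exp (real_of_ereal t)))"

text \<open>
  \<open>\<integral>\<^sub>\<Omega> (log|v|) \<omega> dx\<close> as the integral of the positive part minus the integral of the
  negative part; \<open>e2ennreal\<close> truncates negative values to 0, and \<open>-\<infinity> * 0 = 0\<close> in \<open>ereal\<close>.
\<close>

definition log_integral :: "'a::euclidean_space set \<Rightarrow> ('a \<Rightarrow> real) \<Rightarrow> ('a \<Rightarrow> real) \<Rightarrow> ereal" where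
  "log_integral \<Omega> \<omega> v =
     enn2ereal (\<integral>\<^sup>+ x\<in>\<Omega>. e2ennreal (ln_ext \<bar>v x\<bar> * ereal (\<omega> x)) \<partial>lborel) -
     enn2ereal (\<integral>\<^sup>+ x\<in>\<Omega>. e2ennreal (- (ln_ext \<bar>v x\<bar> * ereal (\<omega> x))) \<partial>lborel)"

definition log_manifold ::
    "'a::euclidean_space set \<Rightarrow> real \<Rightarrow> real \<Rightarrow> ('a \<Rightarrow> real) \<Rightarrow> ('a \<Rightarrow> real) set" where
  "log_manifold \<Omega> s p \<omega> = {v \<in> W0sp \<Omega> s p. log_integral \<Omega> \<omega> v = 0}"

definition log_minimizer ::
    "'a::euclidean_space set \<Rightarrow> real \<Rightarrow> real \<Rightarrow> ('a \<Rightarrow> real) \<Rightarrow> ('a \<Rightarrow> real) \<Rightarrow> bool" where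
  "log_minimizer \<Omega> s p \<omega> v \<longleftrightarrow>
     v \<in> log_manifold \<Omega> s p \<omega> \<and>
     (\<forall>w\<in>log_manifold \<Omega> s p \<omega>. gagliardo s p v powr p \<le> gagliardo s p w powr p)"

end

theory Submission
  imports Defs
begin

text \<open>
  Put \<open>q = 1 - \<alpha>\<close> and \<open>P = \<omega> dx / \<parallel>\<omega>\<parallel>\<^sub>1\<close>. Testing the equation with (smoothed) absolute values
  gives \<open>\<integral> \<omega> \<bar>v\<bar> u\<^bsup>-\<alpha>\<^esup> \<le> [u]\<^bsup>p-1\<^esup> [v]\<close> for all admissible \<open>v\<close>, with equality for \<open>v = u\<close>; by Hoelder's
  inequality \<open>V\<^sub>\<alpha>\<close> minimizes the energy among the functions whose \<open>L\<^sup>q(P)\<close> mean is at least 1.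
  These means decrease to the geometric mean as \<open>q\<close> tends to 0. For \<open>\<alpha> \<le> \<beta>\<close>, concavity of
  \<open>t\<^sup>q\<close> makes \<open>(V\<^sub>\<alpha> + V\<^sub>\<beta>) / 2\<close> a competitor of \<open>V\<^sub>\<alpha>\<close>, so its energy is at least that of \<open>V\<^sub>\<alpha>\<close>;
  since the energies converge to \<open>\<mu>\<close>, uniform convexity of \<open>L\<^sup>p\<close> makes \<open>V\<^sub>\<alpha>\<close> Cauchy, with no appeal
  to compact embeddings. The same midpoint argument with the geometric mean gives uniqueness.
\<close>

section \<open>Smooth compactly supported functions\<close>

text \<open>The equation may be tested only with smooth functions of compact support, while the
  estimates need \<open>\<bar>v\<bar>\<close> and the solution itself. Hence the soft absolute
  value: it keeps smoothness and support and, being 1-Lipschitz and zero at 0, does not raise the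
  seminorm. The energy of V_\<alpha> turns out to be exactly the quantity whose limit is \<mu>, so
  the hypothesis on \<mu> is a statement about the energies. The logarithmic constraint does not
  simply pass to the limit, because the logarithm is unbounded below. The q-means do: extremality at
  a fixed exponent bounds the q-moment of every function, differences included, by its seminorm.
  Letting q tend to 0 afterwards shows that the logarithmic integral of the limit is at least 0; the
  opposite inequality comes from the limiting logarithmic inequality applied to the limit itself,
  whose energy is \<mu>. The equality case reduces to uniqueness of minimizers by rescaling to
  logarithmic integral 0, and the sign of a minimizer is recovered from the equality of the
  seminorms of v and \<open>\<bar>v\<bar>\<close>.\<close>

lemma Ck_Suc_imp: "Ck (Suc k) f \<Longrightarrow> Ck k f"
proof (induction k arbitrary: f)
  case 0
  then show ?case
    by (auto intro!: differentiable_imp_continuous_on simp: differentiable_on_def differentiable_at_withinI)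
next
  case (Suc k)
  then show ?case by (metis Ck.simps(2))
qed

lemma Ck_SucI:
  assumes "\<And>x. (f has_derivative f' x) (at x)" "\<And>v. Ck k (\<lambda>x. f' x v)"
  shows "Ck (Suc k) f"
proof -
  have "frechet_derivative f (at x) = f' x" for x
    using frechet_derivative_at[OF assms(1)] by simp
  with assms show ?thesis by (auto simp: differentiable_def)
qed

lemma Ck_SucD:
  assumes "Ck (Suc k) f"
  shows "(f has_derivative frechet_derivative f (at x)) (at x)"
    and "Ck k (\<lambda>x. frechet_derivative f (at x) v)"
  using assms frechet_derivative_works by auto

lemma Ck_const: "Ck k (\<lambda>x. c)"
proof (induction k arbitrary: c)
  case (Suc k)
  show ?case by (rule Ck_SucI[where f' = "\<lambda>x v. 0"]) (auto simp: Suc)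
qed simp

lemma Ck_add: "Ck k f \<Longrightarrow> Ck k g \<Longrightarrow> Ck k (\<lambda>x. f x + g x)"
proof (induction k arbitrary: f g)
  case 0
  then show ?case by (auto intro: continuous_intros)
next
  case (Suc k)
  show ?case
    by (rule Ck_SucI[OF has_derivative_add[OF Ck_SucD(1)[OF Suc.prems(1)] Ck_SucD(1)[OF Suc.prems(2)]]])
       (intro Suc.IH Ck_SucD(2) Suc.prems)
qed

lemma Ck_mult: "Ck k f \<Longrightarrow> Ck k g \<Longrightarrow> Ck k (\<lambda>x. f x * g x)"
proof (induction k arbitrary: f g)
  case 0
  then show ?case by (auto intro: continuous_intros)
next
  case (Suc k)
  show ?case
    by (rule Ck_SucI[OF has_derivative_mult[OF Ck_SucD(1)[OF Suc.prems(1)] Ck_SucD(1)[OF Suc.prems(2)]]])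
       (intro Ck_add Suc.IH Ck_SucD(2) Suc.prems Ck_Suc_imp[OF Suc.prems(1)] Ck_Suc_imp[OF Suc.prems(2)])
qed

text \<open>The inverse root is treated instead of the root because its derivative,
  \<open>- t * h ^ 3\<close>, is a polynomial in the argument and the function itself. Sums and
  products then close the induction, without a composition rule for \<open>Ck\<close>.\<close>

lemma Ck_inverse_sqrt:
  assumes "\<epsilon> \<noteq> 0" "Ck k f"
  shows "Ck k (\<lambda>x. inverse (sqrt (\<epsilon>\<^sup>2 + (f x)\<^sup>2)))"
  using assms(2)
proof (induction k arbitrary: f)
  case 0
  have "\<epsilon>\<^sup>2 + (f x)\<^sup>2 > 0" for x using assms(1) by (simp add: add_pos_nonneg)
  then have "sqrt (\<epsilon>\<^sup>2 + (f x)\<^sup>2) \<noteq> 0" for x by (metis less_irrefl real_sqrt_eq_zero_cancel_iff)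
  with 0 show ?case by (auto intro!: continuous_intros)
next
  case (Suc k)
  define h where "h x = inverse (sqrt (\<epsilon>\<^sup>2 + (f x)\<^sup>2))" for x
  have pos: "\<epsilon>\<^sup>2 + (f x)\<^sup>2 > 0" for x using assms(1) by (simp add: add_pos_nonneg)
  have f: "(f has_derivative frechet_derivative f (at x)) (at x)" for x by (rule Ck_SucD[OF Suc.prems])
  have real: "((\<lambda>t. inverse (sqrt (\<epsilon>\<^sup>2 + t\<^sup>2))) has_field_derivative
      - t * inverse (sqrt (\<epsilon>\<^sup>2 + t\<^sup>2)) ^ 3) (at t)" for t
  proof -
    have "\<epsilon>\<^sup>2 + t\<^sup>2 > 0" using assms(1) by (simp add: add_pos_nonneg)
    then show ?thesis
      by (auto intro!: derivative_eq_intros simp: field_simps power3_eq_cube power2_eq_square real_sqrt_eq_zero_cancel_iff)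
  qed
  have "(h has_derivative (\<lambda>v. - f x * h x ^ 3 * frechet_derivative f (at x) v)) (at x)" for x
    unfolding h_def
    using has_derivative_compose[OF f[of x] real[of "f x", unfolded has_field_derivative_def]]
    by (simp add: mult_ac)
  then have "Ck (Suc k) h"
  proof (rule Ck_SucI)
    fix v
    have "Ck k h" unfolding h_def by (rule Suc.IH[OF Ck_Suc_imp[OF Suc.prems]])
    then have "Ck k (\<lambda>x. (-1) * f x * (h x * (h x * h x)) * frechet_derivative f (at x) v)"
      by (intro Ck_mult Ck_const Ck_Suc_imp[OF Suc.prems] Ck_SucD(2) Suc.prems)
    then show "Ck k (\<lambda>x. - f x * h x ^ 3 * frechet_derivative f (at x) v)"
      by (simp add: power3_eq_cube mult_ac)
  qed
  then show ?case unfolding h_def .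
qed

text \<open>A smooth substitute for the absolute value: the Euclidean norm of the pair (\<epsilon>,
  t), lowered by \<epsilon> so that it vanishes at 0 and hence does not enlarge supports.\<close>

definition soft_abs :: "real \<Rightarrow> real \<Rightarrow> real" where
  "soft_abs \<epsilon> t = sqrt (\<epsilon>\<^sup>2 + t\<^sup>2) - \<epsilon>"

lemma Ck_soft_abs:
  assumes "\<epsilon> \<noteq> 0" "Ck k f"
  shows "Ck k (\<lambda>x. soft_abs \<epsilon> (f x))"
proof -
  \<comment> \<open>A root is its radicand times the inverse root, which reduces the claim to the
    preceding lemma.\<close>
  have eq: "soft_abs \<epsilon> t = (\<epsilon>\<^sup>2 + t * t) * inverse (sqrt (\<epsilon>\<^sup>2 + t\<^sup>2)) + (- \<epsilon>)" for t
  proof -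
    have "\<epsilon>\<^sup>2 + t\<^sup>2 > 0" using assms(1) by (simp add: add_pos_nonneg)
    then show ?thesis
      using real_div_sqrt[of "\<epsilon>\<^sup>2 + t\<^sup>2"]
      by (simp add: soft_abs_def power2_eq_square divide_inverse)
  qed
  show ?thesis unfolding eq
    by (intro Ck_add Ck_mult Ck_const Ck_inverse_sqrt assms)
qed

lemma soft_abs_0: "0 < \<epsilon> \<Longrightarrow> soft_abs \<epsilon> 0 = 0"
  by (simp add: soft_abs_def)

lemma soft_abs_nonneg: "0 < \<epsilon> \<Longrightarrow> 0 \<le> soft_abs \<epsilon> t"
  by (simp add: soft_abs_def real_le_rsqrt)

lemma soft_abs_le: "0 < \<epsilon> \<Longrightarrow> soft_abs \<epsilon> t \<le> \<bar>t\<bar>"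
  using sqrt_add_le_add_sqrt[of "\<epsilon>\<^sup>2" "t\<^sup>2"] by (simp add: soft_abs_def)

text \<open>Reverse triangle inequality for the norm on pairs. This is the property that keeps the
  Gagliardo seminorm from growing.\<close>

lemma soft_abs_lipschitz:
  "\<bar>soft_abs \<epsilon> a - soft_abs \<epsilon> b\<bar> \<le> \<bar>a - b\<bar>"
proof -
  have "norm (\<epsilon>, a) = sqrt (\<epsilon>\<^sup>2 + a\<^sup>2)" "norm (\<epsilon>, b) = sqrt (\<epsilon>\<^sup>2 + b\<^sup>2)"
    by (simp_all add: norm_Pair)
  moreover have "\<bar>norm (\<epsilon>, a) - norm (\<epsilon>, b)\<bar> \<le> norm ((\<epsilon>, a) - (\<epsilon>, b))"
    by (rule norm_triangle_ineq3)
  ultimately show ?thesis by (simp add: soft_abs_def norm_Pair)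
qed

lemma soft_abs_tendsto:
  assumes "\<And>n. 0 < e n" "e \<longlonglongrightarrow> 0" "t \<longlonglongrightarrow> l"
  shows "(\<lambda>n. soft_abs (e n) (t n)) \<longlonglongrightarrow> \<bar>l\<bar>"
proof -
  have "(\<lambda>n. soft_abs (e n) (t n)) \<longlonglongrightarrow> sqrt (0\<^sup>2 + l\<^sup>2) - 0"
    unfolding soft_abs_def by (intro tendsto_intros assms)
  then show ?thesis by simp
qed

lemma Cc_smooth_closed_support:
  assumes "\<phi> \<in> Cc_smooth \<Omega>" "smooth \<psi>" "{x. \<psi> x \<noteq> 0} \<subseteq> closure {x. \<phi> x \<noteq> 0}"
  shows "\<psi> \<in> Cc_smooth \<Omega>"
proof -
  have "closure {x. \<psi> x \<noteq> 0} \<subseteq> closure {x. \<phi> x \<noteq> 0}"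
    using assms(3) by (simp add: closure_minimal)
  moreover from this have "compact (closure {x. \<psi> x \<noteq> 0})"
    using assms(1) compact_Int_closed[of "closure {x. \<phi> x \<noteq> 0}" "closure {x. \<psi> x \<noteq> 0}"]
    by (simp add: Cc_smooth_def Int_absorb1)
  ultimately show ?thesis
    using assms(1,2) unfolding Cc_smooth_def by blast
qed

lemma Cc_smooth_scale: "\<phi> \<in> Cc_smooth \<Omega> \<Longrightarrow> (\<lambda>x. c * \<phi> x) \<in> Cc_smooth \<Omega>"
proof (rule Cc_smooth_closed_support)
  assume "\<phi> \<in> Cc_smooth \<Omega>"
  then show "smooth (\<lambda>x. c * \<phi> x)"
    by (simp add: Cc_smooth_def smooth_def Ck_mult Ck_const)
  show "{x. c * \<phi> x \<noteq> 0} \<subseteq> closure {x. \<phi> x \<noteq> 0}"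
    by (rule order_trans[OF _ closure_subset]) auto
qed

lemma Cc_smooth_add:
  assumes "\<phi> \<in> Cc_smooth \<Omega>" "\<psi> \<in> Cc_smooth \<Omega>"
  shows "(\<lambda>x. \<phi> x + \<psi> x) \<in> Cc_smooth \<Omega>"
proof -
  have *: "closure {x. \<phi> x + \<psi> x \<noteq> 0} \<subseteq> closure {x. \<phi> x \<noteq> 0} \<union> closure {x. \<psi> x \<noteq> 0}"
    unfolding closure_Un[symmetric] by (rule closure_mono) auto
  have "compact (closure {x. \<phi> x \<noteq> 0} \<union> closure {x. \<psi> x \<noteq> 0})"
    using assms by (auto simp: Cc_smooth_def)
  then have "compact (closure {x. \<phi> x + \<psi> x \<noteq> 0})"
    using compact_Int_closed[of _ "closure {x. \<phi> x + \<psi> x \<noteq> 0}"] * by (metis Int_absorb1 closed_closure)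
  with * assms show ?thesis
    by (simp add: Cc_smooth_def smooth_def Ck_add) blast
qed

lemma Cc_smooth_soft_abs:
  assumes "\<phi> \<in> Cc_smooth \<Omega>" "0 < \<epsilon>"
  shows "(\<lambda>x. soft_abs \<epsilon> (\<phi> x)) \<in> Cc_smooth \<Omega>"
proof (rule Cc_smooth_closed_support[OF assms(1)])
  show "smooth (\<lambda>x. soft_abs \<epsilon> (\<phi> x))"
    using assms by (auto simp: Cc_smooth_def smooth_def intro!: Ck_soft_abs)
  show "{x. soft_abs \<epsilon> (\<phi> x) \<noteq> 0} \<subseteq> closure {x. \<phi> x \<noteq> 0}"
    by (rule order_trans[OF _ closure_subset]) (use soft_abs_0[OF assms(2)] in auto)
qed

lemma Cc_smooth_continuous:
  assumes "\<phi> \<in> Cc_smooth \<Omega>"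
  shows "continuous_on UNIV \<phi>"
proof -
  have "Ck 0 \<phi>" using assms unfolding Cc_smooth_def smooth_def by blast
  then show ?thesis by simp
qed

lemma Cc_smooth_outside: "\<phi> \<in> Cc_smooth \<Omega> \<Longrightarrow> x \<notin> \<Omega> \<Longrightarrow> \<phi> x = 0"
  using closure_subset[of "{x. \<phi> x \<noteq> 0}"] by (auto simp: Cc_smooth_def)

lemma Cc_smooth_bounded:
  assumes "\<phi> \<in> Cc_smooth \<Omega>"
  obtains B where "\<And>x. \<bar>\<phi> x\<bar> \<le> B"
proof -
  let ?K = "closure {x. \<phi> x \<noteq> 0}"
  have "compact (\<phi> ` ?K)"
    using assms Cc_smooth_continuous[OF assms]
    by (intro compact_continuous_image) (auto simp: Cc_smooth_def intro: continuous_on_subset)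
  then obtain B where B: "\<And>y. y \<in> \<phi> ` ?K \<Longrightarrow> norm y \<le> B"
    using compact_imp_bounded bounded_iff by metis
  have "\<bar>\<phi> x\<bar> \<le> max B 0" for x
    using B[of "\<phi> x"] subsetD[OF closure_subset, of x "{x. \<phi> x \<noteq> 0}"] by (cases "\<phi> x = 0") auto
  then show thesis by (rule that)
qed

section \<open>Lebesgue spaces\<close>

lemma powr_Bernoulli_strict:
  fixes t p :: real
  assumes p: "1 < p" and t: "0 \<le> t" "t \<noteq> 1"
  shows "1 + p * (t - 1) < t powr p"
proof -
  \<comment> \<open>Strictness is gained by squaring. Young's inequality gives the weak form at s,
    and the square of \<open>1 + p * (s - 1)\<close> exceeds \<open>1 + p * (t - 1)\<close> by the
    positive remainder \<open>p * (p - 1) * (s - 1)\<^sup>2\<close>. If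
    \<open>1 + p * (s - 1)\<close> is negative, then t \<le> s and the left-hand side is itself
    negative.\<close>
  define s where "s = sqrt t"
  have s: "0 \<le> s" "s \<noteq> 1" "t = s\<^sup>2" using t by (auto simp: s_def)
  have weak: "1 + p * (s - 1) \<le> s powr p"
  proof (cases "s = 0")
    case False
    then have "(s powr p) powr (1 / p) * 1 powr (1 - 1 / p) \<le> (1 / p) * s powr p + (1 - 1 / p) * 1"
      using p s by (intro Youngs_inequality_0) auto
    then have "s \<le> (1 / p) * s powr p + (1 - 1 / p)" using p s False by (simp add: powr_powr)
    then have "p * s \<le> p * ((1 / p) * s powr p + (1 - 1 / p))" using p by (intro mult_left_mono) auto
    then show ?thesis using p by (simp add: algebra_simps)
  qed (use p in simp)
  have sq: "t powr p = (s powr p)\<^sup>2"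
    using s p by (cases "s = 0") (simp_all add: power2_eq_square powr_mult)
  show ?thesis
  proof (cases "0 \<le> 1 + p * (s - 1)")
    case True
    have "1 + p * (t - 1) + p * (p - 1) * (s - 1)\<^sup>2 = (1 + p * (s - 1))\<^sup>2"
      using s(3) by (simp add: power2_eq_square algebra_simps)
    moreover have "0 < p * (p - 1) * (s - 1)\<^sup>2" using p s by simp
    moreover have "(1 + p * (s - 1))\<^sup>2 \<le> (s powr p)\<^sup>2" using True weak by (simp add: power_mono)
    ultimately show ?thesis using sq by linarith
  next
    case False
    then have "p * (s - 1) < 0" by simp
    then have "s < 1" using p by (simp add: mult_less_0_iff)
    then have "t \<le> s" using s by (simp add: power2_eq_square mult_left_le)
    then have "p * (t - 1) \<le> p * (s - 1)" using p by simp
    then have "1 + p * (t - 1) < 0" using False by linarith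
    then show ?thesis by (smt (verit) powr_ge_zero)
  qed
qed

lemma powr_Bernoulli:
  fixes t p :: real
  assumes "1 \<le> p" "0 \<le> t"
  shows "1 + p * (t - 1) \<le> t powr p"
  using assms powr_Bernoulli_strict[of p t] by (cases "t = 1"; cases "p = 1") force+

lemma powr_tangent:
  fixes x m p :: real
  assumes "1 \<le> p" "0 \<le> x" "0 < m"
  shows "m powr p + p * m powr (p - 1) * (x - m) \<le> x powr p"
proof -
  have "m powr p * (1 + p * (x / m - 1)) \<le> m powr p * (x / m) powr p"
    using assms by (intro mult_left_mono powr_Bernoulli) auto
  also have "\<dots> = x powr p" using assms by (simp add: powr_divide)
  finally show ?thesis using assms by (simp add: powr_diff field_simps)
qed

lemma abs_powr_convex:
  fixes a b s t p :: real
  assumes p: "1 \<le> p" and st: "0 \<le> s" "0 \<le> t" "s + t = 1"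
  shows "\<bar>s * a + t * b\<bar> powr p \<le> s * \<bar>a\<bar> powr p + t * \<bar>b\<bar> powr p"
proof -
  define m where "m = s * \<bar>a\<bar> + t * \<bar>b\<bar>"
  have m0: "0 \<le> m" using st by (simp add: m_def)
  have "\<bar>s * a + t * b\<bar> \<le> m"
    using st abs_triangle_ineq[of "s * a" "t * b"] by (simp add: m_def abs_mult)
  then have "\<bar>s * a + t * b\<bar> powr p \<le> m powr p" using p by (intro powr_mono2) auto
  also have "m powr p \<le> s * \<bar>a\<bar> powr p + t * \<bar>b\<bar> powr p"
  proof (cases "m = 0")
    case False
    then have m: "0 < m" using m0 by simp
    \<comment> \<open>Both values are compared with the tangent at m; since m is their weighted
      mean, the linear terms cancel.\<close>
    have "s * (m powr p + p * m powr (p - 1) * (\<bar>a\<bar> - m)) + t * (m powr p + p * m powr (p - 1) * (\<bar>b\<bar> - m))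
       \<le> s * \<bar>a\<bar> powr p + t * \<bar>b\<bar> powr p"
      using st by (intro add_mono mult_left_mono powr_tangent p m) auto
    moreover have "s * (m powr p + p * m powr (p - 1) * (\<bar>a\<bar> - m)) + t * (m powr p + p * m powr (p - 1) * (\<bar>b\<bar> - m))
       = (s + t) * m powr p + p * m powr (p - 1) * ((s * \<bar>a\<bar> + t * \<bar>b\<bar>) - (s + t) * m)"
      by (simp add: algebra_simps)
    ultimately show ?thesis by (simp add: st m_def[symmetric])
  qed (use st in auto)
  finally show ?thesis .
qed

lemma abs_powr_midpoint_strict:
  fixes a b p :: real
  assumes p: "1 < p" and ab: "a \<noteq> b"
  shows "\<bar>(a + b) / 2\<bar> powr p < (\<bar>a\<bar> powr p + \<bar>b\<bar> powr p) / 2"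
proof (cases "\<bar>a\<bar> = \<bar>b\<bar>")
  case True
  with ab have "a = - b" "b \<noteq> 0" by auto
  then show ?thesis using p by simp
next
  case False
  define m where "m = (\<bar>a\<bar> + \<bar>b\<bar>) / 2"
  have m: "0 < m" using False by (auto simp: m_def)
  have "\<bar>(a + b) / 2\<bar> \<le> m" by (simp add: m_def)
  then have "\<bar>(a + b) / 2\<bar> powr p \<le> m powr p" using p by (intro powr_mono2) auto
  moreover have "1 + p * (\<bar>a\<bar> / m - 1) < (\<bar>a\<bar> / m) powr p"
    using False m p by (intro powr_Bernoulli_strict) (auto simp: m_def)
  moreover have "1 + p * (\<bar>b\<bar> / m - 1) < (\<bar>b\<bar> / m) powr p"
    using False m p by (intro powr_Bernoulli_strict) (auto simp: m_def)
  moreover have "\<bar>a\<bar> / m + \<bar>b\<bar> / m = 2" using m by (simp add: m_def add_divide_distrib[symmetric] divide_eq_eq)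
  then have "p * (\<bar>a\<bar> / m - 1) + p * (\<bar>b\<bar> / m - 1) = 0"
    by (simp add: distrib_left[symmetric])
  ultimately have "2 < (\<bar>a\<bar> / m) powr p + (\<bar>b\<bar> / m) powr p" by linarith
  then have "2 * m powr p < \<bar>a\<bar> powr p + \<bar>b\<bar> powr p"
    using m by (simp add: powr_divide field_simps)
  with \<open>_ \<le> m powr p\<close> show ?thesis by simp
qed

lemma abs_powr_add_le:
  fixes a b p :: real
  assumes "0 \<le> p"
  shows "\<bar>a + b\<bar> powr p \<le> 2 powr p * (\<bar>a\<bar> powr p + \<bar>b\<bar> powr p)"
proof -
  have "\<bar>a + b\<bar> powr p \<le> (2 * max \<bar>a\<bar> \<bar>b\<bar>) powr p"
    using assms by (intro powr_mono2) auto
  also have "\<dots> = 2 powr p * max \<bar>a\<bar> \<bar>b\<bar> powr p" by (simp add: powr_mult)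
  also have "\<dots> \<le> 2 powr p * (\<bar>a\<bar> powr p + \<bar>b\<bar> powr p)"
    by (intro mult_left_mono) (auto simp: max_def)
  finally show ?thesis .
qed

text \<open>
  Since both sides are homogeneous of degree \<open>p\<close>, compactness of the unit circle turns
  strict convexity into this quantitative form, from which uniform convexity of
  \<open>L\<^sup>p\<close> follows by integration.
\<close>

lemma abs_powr_uniformly_convex:
  fixes p \<epsilon> :: real
  assumes p: "1 < p" and \<epsilon>: "0 < \<epsilon>"
  obtains C where "0 \<le> C" "\<And>a b. \<bar>a - b\<bar> powr p \<le> \<epsilon> * (\<bar>a\<bar> powr p + \<bar>b\<bar> powr p) +
     C * ((\<bar>a\<bar> powr p + \<bar>b\<bar> powr p) / 2 - \<bar>(a + b) / 2\<bar> powr p)"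
proof -
  define gap where "gap z = (\<bar>fst z\<bar> powr p + \<bar>snd z\<bar> powr p) / 2 - \<bar>(fst z + snd z) / 2\<bar> powr p"
    for z :: "real \<times> real"
  \<comment> \<open>The unit vectors at which the \<epsilon>-term alone does not suffice. They stay
    off the diagonal, where the difference vanishes, so the convexity gap has a positive minimum on
    this compact set.\<close>
  define S where "S = sphere (0::real \<times> real) 1 \<inter>
    {z. \<epsilon> * (\<bar>fst z\<bar> powr p + \<bar>snd z\<bar> powr p) \<le> \<bar>fst z - snd z\<bar> powr p}"
  have gap_nonneg: "0 \<le> gap z" for z
    using abs_powr_midpoint_strict[OF p, of "fst z" "snd z"] by (cases "fst z = snd z") (auto simp: gap_def)
  have cont: "continuous_on UNIV (\<lambda>z. \<bar>h z\<bar> powr p)"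
    if "continuous_on UNIV h" for h :: "real \<times> real \<Rightarrow> real"
    using that p by (intro continuous_on_powr') (auto intro: continuous_intros)
  have cgap: "continuous_on UNIV gap"
    unfolding gap_def by (intro continuous_intros cont) auto
  have "closed {z. \<epsilon> * (\<bar>fst z\<bar> powr p + \<bar>snd z\<bar> powr p) \<le> \<bar>fst z - snd z\<bar> powr p}"
    by (intro closed_Collect_le continuous_intros cont)
  then have S: "compact S" unfolding S_def by (intro compact_Int_closed) auto
  have pos: "0 < gap z" if "z \<in> S" for z
  proof -
    have "z \<noteq> 0" using that by (auto simp: S_def)
    then have "0 < \<bar>fst z\<bar> powr p + \<bar>snd z\<bar> powr p"
      by (cases z) (auto simp: zero_prod_def add_pos_nonneg add_nonneg_pos)
    then have "fst z \<noteq> snd z" using that \<epsilon> p by (auto simp: S_def mult_le_0_iff)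
    then show ?thesis using abs_powr_midpoint_strict[OF p] by (simp add: gap_def)
  qed
  obtain \<delta> where \<delta>: "0 < \<delta>" "\<And>z. z \<in> S \<Longrightarrow> \<delta> \<le> gap z"
  proof (cases "S = {}")
    case False
    then obtain z0 where "z0 \<in> S" "\<And>z. z \<in> S \<Longrightarrow> gap z0 \<le> gap z"
      using continuous_attains_inf[OF S _ continuous_on_subset[OF cgap]] by auto
    with pos that show ?thesis by blast
  qed (use that[of 1] in auto)
  \<comment> \<open>On the unit circle both coordinates are at most 1 in modulus, so the difference
    is at most 2; with gap at least \<delta> on S, this C makes the gap term dominate.\<close>
  define C where "C = 2 powr p / \<delta>"
  have C: "0 \<le> C" using \<delta> by (simp add: C_def)
  have unit: "\<bar>fst z - snd z\<bar> powr p \<le> \<epsilon> * (\<bar>fst z\<bar> powr p + \<bar>snd z\<bar> powr p) + C * gap z"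
    if z: "norm z = 1" for z
  proof (cases "z \<in> S")
    case True
    have "\<bar>fst z\<bar> \<le> 1" "\<bar>snd z\<bar> \<le> 1" using z norm_fst_le[of "fst z" "snd z"] norm_snd_le[of "snd z" "fst z"] by auto
    then have "\<bar>fst z - snd z\<bar> powr p \<le> 2 powr p" using p by (intro powr_mono2) auto
    also have "\<dots> = C * \<delta>" using \<delta> by (simp add: C_def)
    also have "\<dots> \<le> C * gap z" using \<delta> True C by (intro mult_left_mono) auto
    finally show ?thesis using \<epsilon> by (smt (verit) mult_nonneg_nonneg powr_ge_zero)
  next
    case False
    then have "\<bar>fst z - snd z\<bar> powr p \<le> \<epsilon> * (\<bar>fst z\<bar> powr p + \<bar>snd z\<bar> powr p)"
      using z by (auto simp: S_def)
    then show ?thesis using gap_nonneg[of z] C by (smt (verit) mult_nonneg_nonneg)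
  qed
  show thesis
  proof (rule that[OF C])
    fix a b :: real
    show "\<bar>a - b\<bar> powr p \<le> \<epsilon> * (\<bar>a\<bar> powr p + \<bar>b\<bar> powr p) +
       C * ((\<bar>a\<bar> powr p + \<bar>b\<bar> powr p) / 2 - \<bar>(a + b) / 2\<bar> powr p)"
    proof (cases "(a, b) = 0")
      case False
      define r where "r = norm (a, b)"
      have r: "0 < r" using False by (simp add: r_def)
      define x y where "x = a / r" and "y = b / r"
      have xy: "a = r * x" "b = r * y" using r by (simp_all add: x_def y_def)
      have "norm (x, y) = norm ((1 / r) *\<^sub>R (a, b))" by (simp add: x_def y_def)
      also have "\<dots> = (1 / r) * r" unfolding norm_scaleR using r by (simp add: r_def[symmetric])
      finally have "norm (x, y) = 1" using r by simp
      from unit[OF this] have "r powr p * \<bar>x - y\<bar> powr p \<le> r powr p * (\<epsilon> * (\<bar>x\<bar> powr p + \<bar>y\<bar> powr p) +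
          C * ((\<bar>x\<bar> powr p + \<bar>y\<bar> powr p) / 2 - \<bar>(x + y) / 2\<bar> powr p))"
        by (intro mult_left_mono) (auto simp: gap_def)
      moreover have "\<bar>r * t\<bar> powr p = r powr p * \<bar>t\<bar> powr p" for t
        using r by (simp add: abs_mult powr_mult)
      ultimately show ?thesis
        unfolding xy by (simp add: right_diff_distrib[symmetric] distrib_left[symmetric] times_divide_eq_right[symmetric]
            del: times_divide_eq_right) (simp add: algebra_simps)
    qed (use p in \<open>auto simp: zero_prod_def\<close>)
  qed
qed

section \<open>Minkowski, Hoelder and uniform convexity for p-integrable functions\<close>

abbreviation powr_integral :: "real \<Rightarrow> 'a measure \<Rightarrow> ('a \<Rightarrow> real) \<Rightarrow> real" where
  "powr_integral p M f \<equiv> \<integral>x. \<bar>f x\<bar> powr p \<partial>M"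

definition in_Lp :: "real \<Rightarrow> 'a measure \<Rightarrow> ('a \<Rightarrow> real) \<Rightarrow> bool" where
  "in_Lp p M f \<longleftrightarrow> f \<in> borel_measurable M \<and> integrable M (\<lambda>x. \<bar>f x\<bar> powr p)"

text \<open>A Bochner integral that does not exist has the value 0, so this number is meaningful
  only together with \<open>in_Lp\<close>.\<close>

definition Lp_norm :: "real \<Rightarrow> 'a measure \<Rightarrow> ('a \<Rightarrow> real) \<Rightarrow> real" where
  "Lp_norm p M f = powr_integral p M f powr (1 / p)"

lemma in_Lp_measurable: "in_Lp p M f \<Longrightarrow> f \<in> borel_measurable M"
  by (simp add: in_Lp_def)

lemma in_Lp_integrable: "in_Lp p M f \<Longrightarrow> integrable M (\<lambda>x. \<bar>f x\<bar> powr p)"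
  by (simp add: in_Lp_def)

lemma Lp_norm_nonneg: "0 \<le> Lp_norm p M f"
  by (simp add: Lp_norm_def)

lemma Lp_norm_powr: "p \<noteq> 0 \<Longrightarrow> Lp_norm p M f powr p = powr_integral p M f"
  by (simp add: Lp_norm_def powr_powr)

lemma in_Lp_cmult: "in_Lp p M f \<Longrightarrow> in_Lp p M (\<lambda>x. c * f x)"
  by (auto simp: in_Lp_def abs_mult powr_mult)

lemma Lp_norm_cmult: "p \<noteq> 0 \<Longrightarrow> Lp_norm p M (\<lambda>x. c * f x) = \<bar>c\<bar> * Lp_norm p M f"
  by (simp add: Lp_norm_def abs_mult powr_mult powr_powr)

lemma in_Lp_add:
  assumes "0 \<le> p" "in_Lp p M f" "in_Lp p M g"
  shows "in_Lp p M (\<lambda>x. f x + g x)"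
proof -
  have [measurable]: "f \<in> borel_measurable M" "g \<in> borel_measurable M"
    using assms by (auto simp: in_Lp_def)
  have "integrable M (\<lambda>x. \<bar>f x + g x\<bar> powr p)"
    by (rule Bochner_Integration.integrable_bound[of M "\<lambda>x. 2 powr p * (\<bar>f x\<bar> powr p + \<bar>g x\<bar> powr p)"])
       (use assms abs_powr_add_le in \<open>auto simp: in_Lp_def\<close>)
  then show ?thesis by (simp add: in_Lp_def)
qed

lemma in_Lp_diff: "0 \<le> p \<Longrightarrow> in_Lp p M f \<Longrightarrow> in_Lp p M g \<Longrightarrow> in_Lp p M (\<lambda>x. f x - g x)"
  using in_Lp_add[of p M f "\<lambda>x. (-1) * g x"] in_Lp_cmult[of p M g "-1"] by simp

lemma Lp_norm_minus_commute: "Lp_norm p M (\<lambda>x. f x - g x) = Lp_norm p M (\<lambda>x. g x - f x)"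
  by (simp add: Lp_norm_def abs_minus_commute)

lemma Lp_norm_cong_AE:
  assumes "AE x in M. \<bar>f x\<bar> = \<bar>g x\<bar>" "f \<in> borel_measurable M" "g \<in> borel_measurable M"
  shows "Lp_norm p M f = Lp_norm p M g"
proof -
  have "powr_integral p M f = powr_integral p M g"
    by (rule integral_cong_AE) (use assms in auto)
  then show ?thesis by (simp add: Lp_norm_def)
qed

lemma in_Lp_bound:
  assumes "in_Lp p M g" "f \<in> borel_measurable M" "AE x in M. \<bar>f x\<bar> \<le> \<bar>g x\<bar>" "0 \<le> p"
  shows "in_Lp p M f" "Lp_norm p M f \<le> Lp_norm p M g"
proof -
  have AE: "AE x in M. \<bar>f x\<bar> powr p \<le> \<bar>g x\<bar> powr p"
    using assms(3) by eventually_elim (use assms(4) in \<open>auto intro: powr_mono2\<close>)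
  have [measurable]: "f \<in> borel_measurable M" by fact
  have i: "integrable M (\<lambda>x. \<bar>f x\<bar> powr p)"
    by (rule Bochner_Integration.integrable_bound[OF in_Lp_integrable[OF assms(1)]]) (use AE in auto)
  then show "in_Lp p M f" using assms by (simp add: in_Lp_def)
  show "Lp_norm p M f \<le> Lp_norm p M g"
    unfolding Lp_norm_def using assms i AE
    by (intro powr_mono2 integral_mono_AE) (auto simp: in_Lp_def)
qed

text \<open>With A and B the two norms, (f + g) / (A + B) is a convex combination of f / A and g /
  B, so pointwise convexity of the p-th power integrates to the claim. The norms are first enlarged
  by e, because they may be zero.\<close>

lemma Lp_norm_triangle:
  assumes p: "1 \<le> p" and f: "in_Lp p M f" and g: "in_Lp p M g"
  shows "Lp_norm p M (\<lambda>x. f x + g x) \<le> Lp_norm p M f + Lp_norm p M g"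
proof -
  define A B where "A = Lp_norm p M f" and "B = Lp_norm p M g"
  have AB: "0 \<le> A" "0 \<le> B" by (simp_all add: A_def B_def Lp_norm_nonneg)
  have "Lp_norm p M (\<lambda>x. f x + g x) \<le> (A + e) + (B + e)" if e: "0 < e" for e
  proof -
    define A' B' where "A' = A + e" and "B' = B + e"
    have pos: "0 < A'" "0 < B'" using AB e by (auto simp: A'_def B'_def)
    have pw: "\<bar>f x + g x\<bar> powr p \<le> (A' + B') powr p *
        (A' / (A' + B') * (\<bar>f x\<bar> powr p / A' powr p) + B' / (A' + B') * (\<bar>g x\<bar> powr p / B' powr p))" for x
    proof -
      have "\<bar>A' / (A' + B') * (f x / A') + B' / (A' + B') * (g x / B')\<bar> powr p \<le>
         A' / (A' + B') * \<bar>f x / A'\<bar> powr p + B' / (A' + B') * \<bar>g x / B'\<bar> powr p"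
        using p pos by (intro abs_powr_convex) (auto simp: add_divide_distrib[symmetric])
      moreover have "A' / (A' + B') * (f x / A') + B' / (A' + B') * (g x / B') = (f x + g x) / (A' + B')"
        using pos by (simp add: add_divide_distrib)
      ultimately have "\<bar>f x + g x\<bar> powr p / (A' + B') powr p \<le>
         A' / (A' + B') * (\<bar>f x\<bar> powr p / A' powr p) + B' / (A' + B') * (\<bar>g x\<bar> powr p / B' powr p)"
        using pos by (simp add: powr_divide)
      then show ?thesis using pos by (simp add: field_simps)
    qed
    have leA: "powr_integral p M f \<le> A' powr p"
      using p e AB by (auto simp: A'_def A_def Lp_norm_powr[symmetric] intro!: powr_mono2)
    have leB: "powr_integral p M g \<le> B' powr p"
      using p e AB by (auto simp: B'_def B_def Lp_norm_powr[symmetric] intro!: powr_mono2)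
    have "powr_integral p M (\<lambda>x. f x + g x) \<le> (\<integral>x. (A' + B') powr p *
        (A' / (A' + B') * (\<bar>f x\<bar> powr p / A' powr p) + B' / (A' + B') * (\<bar>g x\<bar> powr p / B' powr p)) \<partial>M)"
      using f g p pw by (intro integral_mono in_Lp_integrable in_Lp_add) (auto simp: in_Lp_def)
    also have "\<dots> = (A' + B') powr p *
        (A' / (A' + B') * (powr_integral p M f / A' powr p) + B' / (A' + B') * (powr_integral p M g / B' powr p))"
      using f g by (simp add: in_Lp_def)
    also have "\<dots> \<le> (A' + B') powr p * (A' / (A' + B') * 1 + B' / (A' + B') * 1)"
      using pos leA leB by (intro mult_left_mono add_mono) auto
    also have "\<dots> = (A' + B') powr p" using pos by (simp add: add_divide_distrib[symmetric])
    finally have "Lp_norm p M (\<lambda>x. f x + g x) \<le> ((A' + B') powr p) powr (1 / p)"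
      unfolding Lp_norm_def using p by (intro powr_mono2) auto
    then show ?thesis using pos p by (simp add: powr_powr A'_def B'_def)
  qed
  note half = this
  have "Lp_norm p M (\<lambda>x. f x + g x) \<le> A + B + e" if "0 < e" for e
    using half[of "e / 2"] that by simp
  then show ?thesis unfolding A_def B_def by (rule field_le_epsilon)
qed

lemma Lp_norm_triangle_diff:
  assumes "1 \<le> p" "in_Lp p M f" "in_Lp p M g"
  shows "\<bar>Lp_norm p M f - Lp_norm p M g\<bar> \<le> Lp_norm p M (\<lambda>x. f x - g x)"
  using Lp_norm_triangle[OF assms(1) in_Lp_diff[OF _ assms(2,3)] assms(3)]
    Lp_norm_triangle[OF assms(1) in_Lp_diff[OF _ assms(3,2)] assms(2)] assms(1)
    Lp_norm_minus_commute[of p M f g]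
  by simp

text \<open>Young's inequality is applied to f and g divided by their integrals; e > 0 guards
  against vanishing integrals and is sent to 0 at the end. The form with weights \<theta> and 1 -
  \<theta> serves both the pairing, with \<theta> = 1 - 1/p, and the sublinear moments, with
  \<theta> = 1 - \<alpha>.\<close>

lemma Holder_geometric:
  fixes f g :: "'a \<Rightarrow> real"
  assumes \<theta>: "0 < \<theta>" "\<theta> < 1" and f: "integrable M f" "\<And>x. 0 \<le> f x" and g: "integrable M g" "\<And>x. 0 \<le> g x"
  shows "integrable M (\<lambda>x. f x powr \<theta> * g x powr (1 - \<theta>))"
    and "(\<integral>x. f x powr \<theta> * g x powr (1 - \<theta>) \<partial>M) \<le> (\<integral>x. f x \<partial>M) powr \<theta> * (\<integral>x. g x \<partial>M) powr (1 - \<theta>)"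
proof -
  have [measurable]: "f \<in> borel_measurable M" "g \<in> borel_measurable M" using f g by auto
  have young: "a powr \<theta> * b powr (1 - \<theta>) \<le> \<theta> * a + (1 - \<theta>) * b" if "0 \<le> a" "0 \<le> b" for a b
    using Youngs_inequality_0[of \<theta> "1 - \<theta>" a b] that \<theta> by (cases "a = 0 \<or> b = 0") auto
  show int: "integrable M (\<lambda>x. f x powr \<theta> * g x powr (1 - \<theta>))"
    by (rule Bochner_Integration.integrable_bound[of M "\<lambda>x. \<theta> * f x + (1 - \<theta>) * g x"])
       (use f g \<theta> young in \<open>auto simp: abs_mult\<close>)
  define F G where "F = (\<integral>x. f x \<partial>M)" and "G = (\<integral>x. g x \<partial>M)"
  have FG: "0 \<le> F" "0 \<le> G" using f g by (auto simp: F_def G_def)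
  have le: "(\<integral>x. f x powr \<theta> * g x powr (1 - \<theta>) \<partial>M) \<le> (F + e) powr \<theta> * (G + e) powr (1 - \<theta>)" if "0 < e" for e
  proof -
    have pos: "0 < F + e" "0 < G + e" using FG that by auto
    have "f x powr \<theta> * g x powr (1 - \<theta>) \<le>
       ((F + e) powr \<theta> * (G + e) powr (1 - \<theta>)) * (\<theta> * (f x / (F + e)) + (1 - \<theta>) * (g x / (G + e)))" for x
      using young[of "f x / (F + e)" "g x / (G + e)"] pos f g by (simp add: powr_divide field_simps)
    then have "(\<integral>x. f x powr \<theta> * g x powr (1 - \<theta>) \<partial>M) \<le>
       (\<integral>x. ((F + e) powr \<theta> * (G + e) powr (1 - \<theta>)) * (\<theta> * (f x / (F + e)) + (1 - \<theta>) * (g x / (G + e))) \<partial>M)"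
      using f g by (intro integral_mono int) auto
    also have "\<dots> = ((F + e) powr \<theta> * (G + e) powr (1 - \<theta>)) * (\<theta> * (F / (F + e)) + (1 - \<theta>) * (G / (G + e)))"
      using f g by (simp add: F_def G_def)
    also have "\<dots> \<le> ((F + e) powr \<theta> * (G + e) powr (1 - \<theta>)) * (\<theta> * 1 + (1 - \<theta>) * 1)"
      using pos \<theta> that by (intro mult_left_mono add_mono) auto
    finally show ?thesis by simp
  qed
  have "((\<lambda>e. (F + e) powr \<theta> * (G + e) powr (1 - \<theta>)) \<longlongrightarrow> (F + 0) powr \<theta> * (G + 0) powr (1 - \<theta>)) (at_right 0)"
    using FG \<theta> by (intro tendsto_mult tendsto_powr' tendsto_intros)
       (auto simp: eventually_at_filter)
  from tendsto_lowerbound[OF this, of "\<integral>x. f x powr \<theta> * g x powr (1 - \<theta>) \<partial>M"] le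
  show "(\<integral>x. f x powr \<theta> * g x powr (1 - \<theta>) \<partial>M) \<le> (\<integral>x. f x \<partial>M) powr \<theta> * (\<integral>x. g x \<partial>M) powr (1 - \<theta>)"
    by (auto simp: F_def G_def eventually_at_filter)
qed

text \<open>The exponent \<open>p - 2\<close> may be negative, but together with the factor f the
  modulus is the (p - 1)-st power of \<open>\<bar>f\<bar>\<close>, so Hoelder's inequality applies
  with \<theta> = 1 - 1/p.\<close>

lemma Lp_pairing:
  assumes p: "1 < p" and f: "in_Lp p M f" and g: "in_Lp p M g"
  shows "integrable M (\<lambda>x. \<bar>f x\<bar> powr (p - 2) * f x * g x)"
    and "\<bar>\<integral>x. \<bar>f x\<bar> powr (p - 2) * f x * g x \<partial>M\<bar> \<le> Lp_norm p M f powr (p - 1) * Lp_norm p M g"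
proof -
  have [measurable]: "f \<in> borel_measurable M" "g \<in> borel_measurable M" using f g by (auto simp: in_Lp_def)
  have eq: "norm (\<bar>f x\<bar> powr (p - 2) * f x * g x) =
      (\<bar>f x\<bar> powr p) powr (1 - 1 / p) * (\<bar>g x\<bar> powr p) powr (1 - (1 - 1 / p))" for x
  proof -
    have "\<bar>f x\<bar> powr (p - 2) * \<bar>f x\<bar> = \<bar>f x\<bar> powr (p - 1)"
      using p by (cases "f x = 0") (auto simp: powr_mult_base mult.commute)
    moreover have "p * (1 - 1 / p) = p - 1" using p by (simp add: field_simps)
    ultimately show ?thesis using p by (simp add: powr_powr abs_mult)
  qed
  have \<theta>: "0 < 1 - 1 / p" "1 - 1 / p < 1" using p by auto
  note H = Holder_geometric[OF \<theta> in_Lp_integrable[OF f] _ in_Lp_integrable[OF g], simplified eq[symmetric] powr_ge_zero, OF TrueI TrueI]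
  show int: "integrable M (\<lambda>x. \<bar>f x\<bar> powr (p - 2) * f x * g x)"
    using H(1) by (subst integrable_norm_iff[symmetric]) auto
  have "\<bar>\<integral>x. \<bar>f x\<bar> powr (p - 2) * f x * g x \<partial>M\<bar> \<le> (\<integral>x. norm (\<bar>f x\<bar> powr (p - 2) * f x * g x) \<partial>M)"
    using integral_norm_bound[of M "\<lambda>x. \<bar>f x\<bar> powr (p - 2) * f x * g x"] by simp
  also note H(2)
  finally show "\<bar>\<integral>x. \<bar>f x\<bar> powr (p - 2) * f x * g x \<partial>M\<bar> \<le> Lp_norm p M f powr (p - 1) * Lp_norm p M g"
    using p by (simp add: Lp_norm_def powr_powr diff_divide_distrib)
qed

text \<open>Stated for pairs indexed along an arbitrary filter: a product filter on pairs of
  exponents yields the Cauchy property, and a constant pair yields uniqueness.\<close>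

lemma Lp_uniformly_convex:
  assumes p: "1 < p" and f: "\<And>i. in_Lp p M (f i)" "\<And>i. in_Lp p M (g i)"
    and A: "\<And>i. powr_integral p M (f i) \<le> A" "\<And>i. powr_integral p M (g i) \<le> A"
    and mid: "\<And>e. 0 < e \<Longrightarrow> eventually (\<lambda>i. A - e \<le> powr_integral p M (\<lambda>x. (f i x + g i x) / 2)) F"
  shows "((\<lambda>i. Lp_norm p M (\<lambda>x. f i x - g i x)) \<longlongrightarrow> 0) F"
proof -
  have lim: "((\<lambda>i. \<integral>x. \<bar>f i x - g i x\<bar> powr p \<partial>M) \<longlongrightarrow> 0) F"
  proof (rule order_tendstoI)
    fix e :: real assume e: "0 < e"
    have A0: "0 \<le> A" by (rule order_trans[OF _ A(1)]) simp
    \<comment> \<open>The \<epsilon>-term is at most 2A\<epsilon>, hence below e/2; the midpoint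
      deficit \<open>e / (2 * (C + 1))\<close> keeps the C-term below e/2 as well. The summands 1
      avoid division by zero.\<close>
    define \<epsilon> where "\<epsilon> = e / (4 * (A + 1))"
    have \<epsilon>: "0 < \<epsilon>" using e A0 by (simp add: \<epsilon>_def)
    obtain C where C: "0 \<le> C" "\<And>a b. \<bar>a - b\<bar> powr p \<le> \<epsilon> * (\<bar>a\<bar> powr p + \<bar>b\<bar> powr p) +
       C * ((\<bar>a\<bar> powr p + \<bar>b\<bar> powr p) / 2 - \<bar>(a + b) / 2\<bar> powr p)"
      using abs_powr_uniformly_convex[OF p \<epsilon>] by metis
    have "0 < e / (2 * (C + 1))" using e C by simp
    from mid[OF this] show "eventually (\<lambda>i. powr_integral p M (\<lambda>x. f i x - g i x) < e) F"
    proof eventually_elim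
      case (elim i)
      have mi: "in_Lp p M (\<lambda>x. (f i x + g i x) / 2)"
        using in_Lp_cmult[OF in_Lp_add[OF _ f(1)[of i] f(2)[of i]], of "1 / 2"] p by simp
      have "powr_integral p M (\<lambda>x. f i x - g i x) \<le> (\<integral>x. \<epsilon> * (\<bar>f i x\<bar> powr p + \<bar>g i x\<bar> powr p) +
         C * ((\<bar>f i x\<bar> powr p + \<bar>g i x\<bar> powr p) / 2 - \<bar>(f i x + g i x) / 2\<bar> powr p) \<partial>M)"
        using p by (intro integral_mono C in_Lp_integrable in_Lp_diff f Bochner_Integration.integrable_add
            Bochner_Integration.integrable_diff integrable_mult_right integrable_divide mi) auto
      also have "\<dots> = \<epsilon> * (powr_integral p M (f i) + powr_integral p M (g i)) +
         C * ((powr_integral p M (f i) + powr_integral p M (g i)) / 2 - powr_integral p M (\<lambda>x. (f i x + g i x) / 2))"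
        using f[of i, THEN in_Lp_integrable] in_Lp_integrable[OF mi] by simp
      also have "\<dots> \<le> \<epsilon> * (A + A) + C * ((A + A) / 2 - (A - e / (2 * (C + 1))))"
        using \<epsilon> C A[of i] elim by (intro add_mono mult_left_mono diff_mono divide_right_mono) auto
      also have "\<dots> = e / 2 * (A / (A + 1)) + e / 2 * (C / (C + 1))"
      proof -
        have "\<epsilon> * (A + A) = e / 2 * (A / (A + 1))" using A0 by (simp add: \<epsilon>_def divide_simps)
        moreover have "C * ((A + A) / 2 - (A - e / (2 * (C + 1)))) = e / 2 * (C / (C + 1))" by simp
        ultimately show ?thesis by simp
      qed
      also have "\<dots> < e / 2 * 1 + e / 2 * 1"
        using A0 C e by (intro add_strict_mono mult_strict_left_mono) auto
      finally show ?case by simp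
    qed
  qed (rule always_eventually, rule allI, erule order.strict_trans2, simp)
  have "((\<lambda>i. powr_integral p M (\<lambda>x. f i x - g i x) powr (1 / p)) \<longlongrightarrow> 0 powr (1 / p)) F"
    using p by (intro tendsto_powr' lim tendsto_intros) auto
  then show ?thesis by (simp add: Lp_norm_def)
qed

section \<open>Convergence almost everywhere and Fatou's lemma\<close>

lemma summable_integral_AE:
  fixes f :: "nat \<Rightarrow> 'a \<Rightarrow> real"
  assumes f: "\<And>n. integrable M (f n)" "\<And>n x. 0 \<le> f n x" and s: "summable (\<lambda>n. \<integral>x. f n x \<partial>M)"
  shows "AE x in M. summable (\<lambda>n. f n x)" "integrable M (\<lambda>x. \<Sum>n. f n x)"
proof -
  have [measurable]: "f n \<in> borel_measurable M" for n using f(1)[of n] by simp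
  have "(\<integral>\<^sup>+x. (\<Sum>n. ennreal (f n x)) \<partial>M) = (\<Sum>n. \<integral>\<^sup>+x. ennreal (f n x) \<partial>M)"
    by (rule nn_integral_suminf) simp
  also have "\<dots> = (\<Sum>n. ennreal (\<integral>x. f n x \<partial>M))"
    using f by (simp add: nn_integral_eq_integral)
  also have "\<dots> = ennreal (\<Sum>n. \<integral>x. f n x \<partial>M)"
    using f s by (intro suminf_ennreal2) auto
  finally have "AE x in M. (\<Sum>n. ennreal (f n x)) \<noteq> \<infinity>"
    by (intro nn_integral_PInf_AE) auto
  then show "AE x in M. summable (\<lambda>n. f n x)"
    by eventually_elim (rule summable_suminf_not_top, use f in auto)
  then show "integrable M (\<lambda>x. \<Sum>n. f n x)"
    using f s by (intro integrable_suminf) auto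
qed

text \<open>The integrals of the p-th powers are dominated by a geometric series of ratio (1/2)^p.
  The integrable sum of these powers later serves as a majorant for dominated convergence.\<close>

lemma Lp_fast_AE:
  assumes p: "1 < p" and f: "\<And>n. in_Lp p M (f n)" and le: "\<And>n. Lp_norm p M (f n) \<le> (1 / 2) ^ n"
  shows "AE x in M. summable (\<lambda>n. \<bar>f n x\<bar> powr p)" "integrable M (\<lambda>x. \<Sum>n. \<bar>f n x\<bar> powr p)"
    "AE x in M. (\<lambda>n. f n x) \<longlonglongrightarrow> 0"
proof -
  have "powr_integral p M (f n) \<le> ((1 / 2) powr p) ^ n" for n
  proof -
    have "powr_integral p M (f n) = Lp_norm p M (f n) powr p" using p by (simp add: Lp_norm_powr)
    also have "\<dots> \<le> ((1 / 2) ^ n) powr p" using p le by (intro powr_mono2) (auto simp: Lp_norm_nonneg)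
    finally show ?thesis by (simp add: powr_power powr_realpow[symmetric] powr_powr mult.commute)
  qed
  moreover have p1: "(1 / 2) powr p < 1" using p powr_less_mono'[of "1/2" 0 p] by simp
  ultimately have "summable (\<lambda>n. \<integral>x. \<bar>f n x\<bar> powr p \<partial>M)"
    using p by (intro summable_comparison_test'[OF summable_geometric[of "(1 / 2) powr p"]])
      (auto simp: p1)
  from summable_integral_AE[OF in_Lp_integrable[OF f] _ this]
  show AE: "AE x in M. summable (\<lambda>n. \<bar>f n x\<bar> powr p)" and "integrable M (\<lambda>x. \<Sum>n. \<bar>f n x\<bar> powr p)" by auto
  from AE show "AE x in M. (\<lambda>n. f n x) \<longlonglongrightarrow> 0"
  proof eventually_elim
    case (elim x)
    then have "(\<lambda>n. \<bar>f n x\<bar> powr p) \<longlonglongrightarrow> 0" by (rule summable_LIMSEQ_zero)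
    then have "(\<lambda>n. (\<bar>f n x\<bar> powr p) powr (1 / p)) \<longlonglongrightarrow> 0 powr (1 / p)"
      using p by (intro tendsto_powr' tendsto_intros) auto
    then have "(\<lambda>n. \<bar>f n x\<bar>) \<longlonglongrightarrow> 0" using p by (simp add: powr_powr)
    then show ?case by (simp add: tendsto_rabs_zero_iff)
  qed
qed

lemma Lp_fast_Cauchy_AE:
  assumes p: "1 < p" and f: "\<And>n. in_Lp p M (f n)"
    and le: "\<And>n. Lp_norm p M (\<lambda>x. f (Suc n) x - f n x) \<le> (1 / 4) ^ n"
  shows "AE x in M. convergent (\<lambda>n. f n x)"
proof -
  \<comment> \<open>The rate 1/4 leaves a factor 2^n to spend: the rescaled increments still decay
    like (1/2)^n in norm, so they are bounded at almost every point, and the increments themselves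
    are dominated there by a geometric series.\<close>
  define g where "g n x = 2 ^ n * (f (Suc n) x - f n x)" for n x
  have "in_Lp p M (g n)" for n
    unfolding g_def using p by (intro in_Lp_cmult in_Lp_diff f) auto
  moreover have "Lp_norm p M (g n) \<le> (1 / 2) ^ n" for n
  proof -
    have "Lp_norm p M (g n) = 2 ^ n * Lp_norm p M (\<lambda>x. f (Suc n) x - f n x)"
      unfolding g_def using p by (simp add: Lp_norm_cmult)
    also have "\<dots> \<le> 2 ^ n * (1 / 4) ^ n" by (intro mult_left_mono le) auto
    also have "\<dots> = (1 / 2 :: real) ^ n" by (simp add: power_mult_distrib[symmetric])
    finally show ?thesis .
  qed
  ultimately have "AE x in M. (\<lambda>n. g n x) \<longlonglongrightarrow> 0"
    using Lp_fast_AE(3)[OF p] by blast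
  then show ?thesis
  proof eventually_elim
    case (elim x)
    then have "Bseq (\<lambda>n. g n x)" using convergentI convergent_imp_Bseq by blast
    then obtain B where B: "\<And>n. norm (g n x) \<le> B" by (auto simp: Bseq_def)
    have "summable (\<lambda>n. f (Suc n) x - f n x)"
    proof (rule summable_comparison_test')
      show "summable (\<lambda>n. B * (1 / 2) ^ n)" by (intro summable_mult summable_geometric) simp
      fix n
      have "\<bar>f (Suc n) x - f n x\<bar> * 2 ^ n \<le> B" using B[of n] by (simp add: g_def abs_mult mult.commute)
      then show "norm (f (Suc n) x - f n x) \<le> B * (1 / 2) ^ n" by (simp add: power_one_over field_simps)
    qed
    then have "convergent (\<lambda>n. \<Sum>i<n. f (Suc i) x - f i x)" by (simp add: summable_iff_convergent)
    then have "convergent (\<lambda>n. f n x - f 0 x)" by (simp only: sum_lessThan_telescope[of "\<lambda>i. f i x"])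
    then have "convergent (\<lambda>n. (f n x - f 0 x) + f 0 x)" by (intro convergent_add convergent_const)
    then show ?case by simp
  qed
qed

lemma nn_integral_Fatou_le:
  fixes f :: "nat \<Rightarrow> 'a \<Rightarrow> ennreal"
  assumes meas: "\<And>n. f n \<in> borel_measurable M" and lim: "AE x in M. (\<lambda>n. f n x) \<longlonglongrightarrow> g x"
    and le: "eventually (\<lambda>n. (\<integral>\<^sup>+x. f n x \<partial>M) \<le> B n) sequentially" and B: "B \<longlonglongrightarrow> b"
  shows "(\<integral>\<^sup>+x. g x \<partial>M) \<le> b"
proof -
  have "(\<integral>\<^sup>+x. g x \<partial>M) \<le> (\<integral>\<^sup>+x. liminf (\<lambda>n. f n x) \<partial>M)"
    by (rule nn_integral_mono_AE) (use lim in eventually_elim, simp add: lim_imp_Liminf)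
  also have "\<dots> \<le> liminf (\<lambda>n. \<integral>\<^sup>+x. f n x \<partial>M)" by (rule nn_integral_liminf[OF meas])
  also have "\<dots> \<le> liminf B" by (rule Liminf_mono[OF le])
  also have "\<dots> = b" by (rule lim_imp_Liminf[OF sequentially_bot B])
  finally show ?thesis .
qed

lemma Lp_Fatou:
  assumes p: "1 < p" and f: "\<And>n. in_Lp p M (f n)" and g: "g \<in> borel_measurable M"
    and le: "eventually (\<lambda>n. Lp_norm p M (f n) \<le> B) sequentially"
    and lim: "AE x in M. (\<lambda>n. f n x) \<longlonglongrightarrow> g x"
  shows "in_Lp p M g" "Lp_norm p M g \<le> B"
proof -
  have [measurable]: "f n \<in> borel_measurable M" "g \<in> borel_measurable M" for n
    using f g by (auto simp: in_Lp_def)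
  from le obtain n where "Lp_norm p M (f n) \<le> B" by (auto simp: eventually_sequentially)
  then have B: "0 \<le> B" by (rule order_trans[OF Lp_norm_nonneg])
  have *: "(\<integral>\<^sup>+x. ennreal (\<bar>g x\<bar> powr p) \<partial>M) \<le> ennreal (B powr p)"
  proof (rule nn_integral_Fatou_le[OF _ _ _ tendsto_const])
    show "AE x in M. (\<lambda>n. ennreal (\<bar>f n x\<bar> powr p)) \<longlonglongrightarrow> ennreal (\<bar>g x\<bar> powr p)"
      using lim by eventually_elim (use p in \<open>intro tendsto_ennrealI tendsto_powr' tendsto_intros, auto\<close>)
    show "eventually (\<lambda>n. (\<integral>\<^sup>+x. ennreal (\<bar>f n x\<bar> powr p) \<partial>M) \<le> ennreal (B powr p)) sequentially"
      using le
    proof eventually_elim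
      case (elim n)
      have "(\<integral>\<^sup>+x. ennreal (\<bar>f n x\<bar> powr p) \<partial>M) = ennreal (Lp_norm p M (f n) powr p)"
        using p in_Lp_integrable[OF f] by (simp add: nn_integral_eq_integral Lp_norm_powr)
      also have "\<dots> \<le> ennreal (B powr p)"
        using elim p by (intro ennreal_leI powr_mono2) (auto simp: Lp_norm_nonneg)
      finally show ?case .
    qed
  qed simp
  then have int: "integrable M (\<lambda>x. \<bar>g x\<bar> powr p)"
    by (intro integrableI_bounded) (auto intro: le_less_trans)
  then show "in_Lp p M g" by (simp add: in_Lp_def)
  have "powr_integral p M g \<le> B powr p"
    using * int by (simp add: nn_integral_eq_integral)
  then have "Lp_norm p M g \<le> (B powr p) powr (1 / p)"
    unfolding Lp_norm_def using p by (intro powr_mono2) auto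
  then show "Lp_norm p M g \<le> B" using p B by (simp add: powr_powr)
qed

section \<open>The fractional Sobolev space\<close>

abbreviation lborel2 :: "('a::euclidean_space \<times> 'a) measure" where
  "lborel2 \<equiv> lborel \<Otimes>\<^sub>M lborel"

lemma AE_lborel_pair:
  fixes P :: "'a::euclidean_space \<Rightarrow> bool"
  assumes "AE x in lborel. P x"
  shows "AE z in lborel2. P (fst z) \<and> P (snd z)"
proof -
  from AE_E3[OF assms] obtain N where N: "N \<in> null_sets lborel" "\<And>x. x \<notin> N \<Longrightarrow> P x"
    by auto
  have "N \<times> UNIV \<in> null_sets (lborel2 :: ('a \<times> 'a) measure)"
    using lborel.times_in_null_sets1[OF N(1), of UNIV] by simp
  moreover have "UNIV \<times> N \<in> null_sets (lborel2 :: ('a \<times> 'a) measure)"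
    using lborel.times_in_null_sets2[of UNIV lborel N] N(1) by simp
  ultimately have "N \<times> UNIV \<union> UNIV \<times> N \<in> null_sets (lborel2 :: ('a \<times> 'a) measure)"
    by (rule null_sets.Un)
  then show ?thesis by (rule AE_I') (use N(2) in force)
qed

text \<open>The kernel exponent is divided by p so that the p-th power of this quotient is the
  Gagliardo integrand. The seminorm becomes an L^p norm on the product space and the map from u to
  its quotient is linear, so the results on L^p transfer.\<close>

definition diff_quot :: "real \<Rightarrow> real \<Rightarrow> ('a::euclidean_space \<Rightarrow> real) \<Rightarrow> 'a \<times> 'a \<Rightarrow> real" where
  "diff_quot s p u z =
     (u (fst z) - u (snd z)) / norm (fst z - snd z) powr ((real DIM('a) + s * p) / p)"

lemma diff_quot_measurable_lborel:
  assumes "u \<in> borel_measurable lborel"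
  shows "diff_quot s p u \<in> borel_measurable lborel2"
proof -
  have "fst \<in> borel_measurable (lborel2 :: ('a \<times> 'a) measure)" "snd \<in> borel_measurable (lborel2 :: ('a \<times> 'a) measure)"
    using measurable_fst[of lborel "lborel :: 'a measure"] measurable_snd[of "lborel :: 'a measure" lborel] by auto
  moreover have "(\<lambda>z. u (fst z)) \<in> borel_measurable (lborel2 :: ('a \<times> 'a) measure)"
    "(\<lambda>z. u (snd z)) \<in> borel_measurable (lborel2 :: ('a \<times> 'a) measure)"
    using measurable_compose[OF measurable_fst assms] measurable_compose[OF measurable_snd assms] by auto
  ultimately show ?thesis
    unfolding diff_quot_def
    by (intro borel_measurable_divide borel_measurable_diff powr_real_measurable borel_measurable_norm) auto
qed

lemma diff_quot_powr:
  fixes u :: "'a::euclidean_space \<Rightarrow> real"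
  assumes "p \<noteq> 0"
  shows "\<bar>diff_quot s p u (x, y)\<bar> powr p = \<bar>u x - u y\<bar> powr p / norm (x - y) powr (real DIM('a) + s * p)"
  using assms by (simp add: diff_quot_def powr_divide powr_powr)

lemma diff_quot_add: "diff_quot s p (\<lambda>x. u x + v x) = (\<lambda>z. diff_quot s p u z + diff_quot s p v z)"
  by (simp add: diff_quot_def fun_eq_iff add_divide_distrib[symmetric] algebra_simps)

lemma diff_quot_diff: "diff_quot s p (\<lambda>x. u x - v x) = (\<lambda>z. diff_quot s p u z - diff_quot s p v z)"
  by (simp add: diff_quot_def fun_eq_iff diff_divide_distrib[symmetric] algebra_simps)

lemma diff_quot_cmult: "diff_quot s p (\<lambda>x. c * u x) = (\<lambda>z. c * diff_quot s p u z)"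
  by (simp add: diff_quot_def fun_eq_iff right_diff_distrib)

lemma diff_quot_contraction:
  assumes "\<And>a b. \<bar>h a - h b\<bar> \<le> \<bar>a - b\<bar>"
  shows "\<bar>diff_quot s p (\<lambda>x. h (u x)) z\<bar> \<le> \<bar>diff_quot s p u z\<bar>"
  using assms by (simp add: diff_quot_def divide_right_mono)

lemma gagliardo_energy_eq:
  "p \<noteq> 0 \<Longrightarrow> gagliardo_energy s p u = (\<integral>\<^sup>+z. ennreal (\<bar>diff_quot s p u z\<bar> powr p) \<partial>lborel2)"
  unfolding gagliardo_energy_def
  by (rule nn_integral_cong) (auto simp: diff_quot_powr split: prod.split)

lemma gagliardo_eq:
  assumes "p \<noteq> 0" "u \<in> borel_measurable lborel"
  shows "gagliardo s p u = Lp_norm p lborel2 (diff_quot s p u)"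
proof -
  have [measurable]: "diff_quot s p u \<in> borel_measurable lborel2"
    using assms by (rule_tac diff_quot_measurable_lborel)
  have "powr_integral p lborel2 (diff_quot s p u) = enn2real (gagliardo_energy s p u)"
    using assms by (simp add: gagliardo_energy_eq integral_eq_nn_integral)
  then show ?thesis by (simp add: gagliardo_def Lp_norm_def)
qed

lemma in_Lp_iff_nn:
  assumes "f \<in> borel_measurable M"
  shows "in_Lp p M f \<longleftrightarrow> (\<integral>\<^sup>+x. ennreal (\<bar>f x\<bar> powr p) \<partial>M) < \<infinity>"
  using assms by (simp add: in_Lp_def integrable_iff_bounded)

lemma nn_integral_Lp:
  assumes "in_Lp p M f" "p \<noteq> 0"
  shows "(\<integral>\<^sup>+x. ennreal (\<bar>f x\<bar> powr p) \<partial>M) = ennreal (Lp_norm p M f powr p)"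
  using assms by (simp add: in_Lp_def nn_integral_eq_integral Lp_norm_powr)

lemma Wsp_iff:
  assumes "p \<noteq> 0"
  shows "u \<in> Wsp s p \<longleftrightarrow> in_Lp p lborel u \<and> in_Lp p lborel2 (diff_quot s p u)"
proof (cases "u \<in> borel_measurable lborel")
  case True
  then show ?thesis
    using in_Lp_iff_nn[OF True, of p] in_Lp_iff_nn[OF diff_quot_measurable_lborel[OF True], of p s p] assms
    by (simp add: Wsp_def Lp_energy_def gagliardo_energy_eq)
qed (auto simp: Wsp_def in_Lp_def)

lemma W0sp_imp_Wsp: "u \<in> W0sp \<Omega> s p \<Longrightarrow> u \<in> Wsp s p"
  by (simp add: W0sp_def)

lemma Wsp_measurable: "u \<in> Wsp s p \<Longrightarrow> u \<in> borel_measurable lborel"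
  by (simp add: Wsp_def)

lemma gagliardo_nonneg: "0 \<le> gagliardo s p u"
  by (simp add: gagliardo_def)

section \<open>The closure of the test functions and its stability under linear operations and
  absolute values\<close>

context
  fixes s p :: real
  assumes p: "1 < p"
begin

abbreviation close_in_Wsp :: "real \<Rightarrow> ('a::euclidean_space \<Rightarrow> real) \<Rightarrow> ('a \<Rightarrow> real) \<Rightarrow> bool" where
  "close_in_Wsp \<epsilon> u v \<equiv> gagliardo s p (\<lambda>x. u x - v x) < \<epsilon> \<and> Lp_norm p lborel (\<lambda>x. u x - v x) < \<epsilon>"

abbreviation approximable :: "'a::euclidean_space set \<Rightarrow> real \<Rightarrow> ('a \<Rightarrow> real) \<Rightarrow> bool" where
  "approximable \<Omega> \<epsilon> u \<equiv> \<exists>\<phi>\<in>Cc_smooth \<Omega> \<inter> Wsp s p. close_in_Wsp \<epsilon> u \<phi>"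

lemma Wsp_Lp: "u \<in> Wsp s p \<Longrightarrow> in_Lp p lborel u"
  and Wsp_diff_quot: "u \<in> Wsp s p \<Longrightarrow> in_Lp p lborel2 (diff_quot s p u)"
  using p by (simp_all add: Wsp_iff)

lemma Wsp_gagliardo: "u \<in> Wsp s p \<Longrightarrow> gagliardo s p u = Lp_norm p lborel2 (diff_quot s p u)"
  by (rule gagliardo_eq[OF _ Wsp_measurable]) (use p in auto)

lemma gagliardo_powr:
  "u \<in> Wsp s p \<Longrightarrow> gagliardo s p u powr p = powr_integral p lborel2 (diff_quot s p u)"
  using p by (simp add: Wsp_gagliardo Lp_norm_powr)

lemma Wsp_add: "u \<in> Wsp s p \<Longrightarrow> v \<in> Wsp s p \<Longrightarrow> (\<lambda>x. u x + v x) \<in> Wsp s p"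
  using p by (simp add: Wsp_iff diff_quot_add in_Lp_add)

lemma Wsp_diff: "u \<in> Wsp s p \<Longrightarrow> v \<in> Wsp s p \<Longrightarrow> (\<lambda>x. u x - v x) \<in> Wsp s p"
  using p by (simp add: Wsp_iff diff_quot_diff in_Lp_diff)

lemma Wsp_cmult: "u \<in> Wsp s p \<Longrightarrow> (\<lambda>x. c * u x) \<in> Wsp s p"
  using p by (simp add: Wsp_iff diff_quot_cmult in_Lp_cmult)

lemma Wsp_contraction:
  assumes "\<And>a b. \<bar>h a - h b\<bar> \<le> \<bar>a - b\<bar>" "h 0 = 0" "h \<in> borel_measurable borel" "u \<in> Wsp s p"
  shows "(\<lambda>x. h (u x)) \<in> Wsp s p" "gagliardo s p (\<lambda>x. h (u x)) \<le> gagliardo s p u"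
proof -
  have m: "(\<lambda>x. h (u x)) \<in> borel_measurable lborel"
    using measurable_compose[OF Wsp_measurable[OF assms(4)] assms(3)] .
  have "in_Lp p lborel (\<lambda>x. h (u x))"
    by (rule in_Lp_bound[OF Wsp_Lp[OF assms(4)] m]) (use assms(1)[of _ 0] assms(2) p in auto)
  moreover note B = in_Lp_bound[OF Wsp_diff_quot[OF assms(4)] diff_quot_measurable_lborel[OF m]
      AE_I2[OF diff_quot_contraction[OF assms(1)]]]
  ultimately show W: "(\<lambda>x. h (u x)) \<in> Wsp s p" using p B(1) by (simp add: Wsp_iff)
  show "gagliardo s p (\<lambda>x. h (u x)) \<le> gagliardo s p u"
    using p B(2) by (simp add: Wsp_gagliardo W assms(4))
qed

lemma gagliardo_triangle:
  "u \<in> Wsp s p \<Longrightarrow> v \<in> Wsp s p \<Longrightarrow> gagliardo s p (\<lambda>x. u x + v x) \<le> gagliardo s p u + gagliardo s p v"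
  using p Lp_norm_triangle[of p _ "diff_quot s p u" "diff_quot s p v"]
  by (simp add: Wsp_gagliardo Wsp_add diff_quot_add Wsp_diff_quot)

lemma gagliardo_cmult: "u \<in> Wsp s p \<Longrightarrow> gagliardo s p (\<lambda>x. c * u x) = \<bar>c\<bar> * gagliardo s p u"
  using p by (simp add: Wsp_gagliardo Wsp_cmult diff_quot_cmult Lp_norm_cmult)

lemma gagliardo_minus_commute: "gagliardo s p (\<lambda>x. u x - v x) = gagliardo s p (\<lambda>x. v x - u x)"
proof -
  have "\<bar>(u x - v x) - (u y - v y)\<bar> = \<bar>(v x - u x) - (v y - u y)\<bar>" for x y by simp
  then show ?thesis unfolding gagliardo_def gagliardo_energy_def by simp
qed

lemma gagliardo_triangle_diff:
  "u \<in> Wsp s p \<Longrightarrow> v \<in> Wsp s p \<Longrightarrow> \<bar>gagliardo s p u - gagliardo s p v\<bar> \<le> gagliardo s p (\<lambda>x. u x - v x)"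
  using p Lp_norm_triangle_diff[of p _ "diff_quot s p u" "diff_quot s p v"]
  by (simp add: Wsp_gagliardo Wsp_diff diff_quot_diff Wsp_diff_quot)

lemma gagliardo_cong_AE:
  assumes "AE x in lborel. u x = v x" "u \<in> Wsp s p" "v \<in> Wsp s p"
  shows "gagliardo s p u = gagliardo s p v"
proof -
  have "AE z in lborel2. \<bar>diff_quot s p u z\<bar> = \<bar>diff_quot s p v z\<bar>"
    using AE_lborel_pair[OF assms(1)] by eventually_elim (simp add: diff_quot_def)
  then show ?thesis
    using Lp_norm_cong_AE[OF _ Wsp_diff_quot[OF assms(2), THEN in_Lp_measurable]
        Wsp_diff_quot[OF assms(3), THEN in_Lp_measurable]] assms(2,3)
    by (simp add: Wsp_gagliardo)
qed

lemma Cc_smooth_measurable: "\<phi> \<in> Cc_smooth \<Omega> \<Longrightarrow> \<phi> \<in> borel_measurable lborel"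
  using borel_measurable_continuous_onI[OF Cc_smooth_continuous] by simp

text \<open>Replaces the sequence and the extended-valued energies of the definition by
  \<epsilon>-approximation in real seminorms. A test function \<phi> close to u has finite energy
  because \<phi> = u - (u - \<phi>), so no energy estimate for smooth functions is required.\<close>

lemma W0sp_iff:
  "u \<in> W0sp \<Omega> s p \<longleftrightarrow> u \<in> Wsp s p \<and> (\<forall>\<epsilon>>0. approximable \<Omega> \<epsilon> u)"
proof (intro iffI conjI allI impI)
  assume u: "u \<in> W0sp \<Omega> s p"
  then show W: "u \<in> Wsp s p" by (rule W0sp_imp_Wsp)
  from u obtain \<phi> where \<phi>: "\<And>n. \<phi> n \<in> Cc_smooth \<Omega>" and
    lim: "(\<lambda>n. gagliardo_energy s p (\<lambda>x. u x - \<phi> n x) + Lp_energy p (\<lambda>x. u x - \<phi> n x)) \<longlonglongrightarrow> 0"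
    by (auto simp: W0sp_def)
  fix \<epsilon> :: real assume \<epsilon>: "0 < \<epsilon>"
  then have "(0::ennreal) < ennreal (\<epsilon> powr p)" by simp
  from order_tendstoD(2)[OF lim this] obtain n where
    n: "gagliardo_energy s p (\<lambda>x. u x - \<phi> n x) + Lp_energy p (\<lambda>x. u x - \<phi> n x) < ennreal (\<epsilon> powr p)"
    by (auto simp: eventually_sequentially)
  have g: "gagliardo_energy s p (\<lambda>x. u x - \<phi> n x) < ennreal (\<epsilon> powr p)"
    by (rule order.strict_trans1[OF _ n]) simp
  have l: "Lp_energy p (\<lambda>x. u x - \<phi> n x) < ennreal (\<epsilon> powr p)"
    by (rule order.strict_trans1[OF _ n]) simp
  have W1: "(\<lambda>x. u x - \<phi> n x) \<in> Wsp s p"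
    using g l Wsp_measurable[OF W] Cc_smooth_measurable[OF \<phi>]
    by (auto simp: Wsp_def intro: less_trans[OF _ ennreal_less_top])
  have "(\<lambda>x. u x - (u x - \<phi> n x)) \<in> Wsp s p" by (rule Wsp_diff[OF W W1])
  then have W2: "\<phi> n \<in> Wsp s p" by simp
  have root: "a < \<epsilon>" if "0 \<le> a" "ennreal (a powr p) < ennreal (\<epsilon> powr p)" for a
  proof (rule ccontr)
    assume "\<not> a < \<epsilon>"
    then have "\<epsilon> powr p \<le> a powr p" using \<epsilon> p by (intro powr_mono2) auto
    with that(2) show False by (simp add: ennreal_leI leD)
  qed
  have "gagliardo s p (\<lambda>x. u x - \<phi> n x) < \<epsilon>"
    using g p nn_integral_Lp[OF Wsp_diff_quot[OF W1]]
    by (intro root) (auto simp: Wsp_gagliardo[OF W1] Lp_norm_nonneg gagliardo_energy_eq)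
  moreover have "Lp_norm p lborel (\<lambda>x. u x - \<phi> n x) < \<epsilon>"
    using l p nn_integral_Lp[OF Wsp_Lp[OF W1]]
    by (intro root) (auto simp: Lp_norm_nonneg Lp_energy_def)
  ultimately show "approximable \<Omega> \<epsilon> u"
    using \<phi>[of n] W2 by blast
next
  assume *: "u \<in> Wsp s p \<and> (\<forall>\<epsilon>>0. approximable \<Omega> \<epsilon> u)"
  have "\<forall>n. \<exists>\<phi>. \<phi> \<in> Cc_smooth \<Omega> \<inter> Wsp s p \<and> close_in_Wsp (inverse (real (Suc n))) u \<phi>"
  proof
    fix n
    have "0 < inverse (real (Suc n))" by simp
    with * show "\<exists>\<phi>. \<phi> \<in> Cc_smooth \<Omega> \<inter> Wsp s p \<and> close_in_Wsp (inverse (real (Suc n))) u \<phi>"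
      by blast
  qed
  from choice[OF this] obtain \<phi> where \<phi>: "\<And>n. \<phi> n \<in> Cc_smooth \<Omega>" "\<And>n. \<phi> n \<in> Wsp s p"
     "\<And>n. gagliardo s p (\<lambda>x. u x - \<phi> n x) < inverse (real (Suc n))"
     "\<And>n. Lp_norm p lborel (\<lambda>x. u x - \<phi> n x) < inverse (real (Suc n))"
    by blast
  have W1: "(\<lambda>x. u x - \<phi> n x) \<in> Wsp s p" for n using * \<phi> by (intro Wsp_diff) auto
  have 1: "gagliardo_energy s p (\<lambda>x. u x - \<phi> n x) = ennreal (gagliardo s p (\<lambda>x. u x - \<phi> n x) powr p)" for n
    using p nn_integral_Lp[OF Wsp_diff_quot[OF W1]] by (simp add: Wsp_gagliardo[OF W1] gagliardo_energy_eq)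
  have 2: "Lp_energy p (\<lambda>x. u x - \<phi> n x) = ennreal (Lp_norm p lborel (\<lambda>x. u x - \<phi> n x) powr p)" for n
    using p nn_integral_Lp[OF Wsp_Lp[OF W1]] by (simp add: Lp_energy_def)
  have lim: "(\<lambda>n. ennreal (a n powr p)) \<longlonglongrightarrow> ennreal 0"
    if "\<And>n. 0 \<le> a n" "\<And>n. a n < inverse (real (Suc n))" for a
  proof -
    have "a \<longlonglongrightarrow> 0"
      by (rule real_tendsto_sandwich[OF _ _ tendsto_const LIMSEQ_inverse_real_of_nat])
        (auto intro!: always_eventually less_imp_le that simp del: of_nat_Suc)
    then have "(\<lambda>n. a n powr p) \<longlonglongrightarrow> 0 powr p"
      using p that by (intro tendsto_powr' tendsto_intros) auto
    then show ?thesis by (intro tendsto_ennrealI) simp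
  qed
  have "(\<lambda>n. gagliardo_energy s p (\<lambda>x. u x - \<phi> n x) + Lp_energy p (\<lambda>x. u x - \<phi> n x)) \<longlonglongrightarrow> ennreal 0 + ennreal 0"
    unfolding 1 2 by (intro tendsto_add lim \<phi> gagliardo_nonneg Lp_norm_nonneg)
  then show "u \<in> W0sp \<Omega> s p"
    using * \<phi>(1) by (auto simp: W0sp_def)
qed

lemma W0sp_closed:
  assumes "u \<in> Wsp s p"
    and "\<And>\<epsilon>. 0 < \<epsilon> \<Longrightarrow> \<exists>v\<in>W0sp \<Omega> s p. close_in_Wsp \<epsilon> u v"
  shows "u \<in> W0sp \<Omega> s p"
  unfolding W0sp_iff
proof (intro conjI allI impI assms(1))
  fix \<epsilon> :: real assume \<epsilon>: "0 < \<epsilon>"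
  then obtain v where v: "v \<in> W0sp \<Omega> s p" "gagliardo s p (\<lambda>x. u x - v x) < \<epsilon> / 2"
    "Lp_norm p lborel (\<lambda>x. u x - v x) < \<epsilon> / 2"
    using assms(2)[of "\<epsilon> / 2"] by auto
  then obtain \<phi> where \<phi>: "\<phi> \<in> Cc_smooth \<Omega> \<inter> Wsp s p" "gagliardo s p (\<lambda>x. v x - \<phi> x) < \<epsilon> / 2"
    "Lp_norm p lborel (\<lambda>x. v x - \<phi> x) < \<epsilon> / 2"
    using \<epsilon> unfolding W0sp_iff by (meson half_gt_zero)
  have W: "(\<lambda>x. u x - v x) \<in> Wsp s p" "(\<lambda>x. v x - \<phi> x) \<in> Wsp s p"
    using v \<phi> assms(1) by (auto intro: Wsp_diff W0sp_imp_Wsp)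
  have "gagliardo s p (\<lambda>x. u x - \<phi> x) < \<epsilon>"
    using gagliardo_triangle[OF W] v \<phi> by simp
  moreover have "Lp_norm p lborel (\<lambda>x. u x - \<phi> x) < \<epsilon>"
    using Lp_norm_triangle[OF _ W[THEN Wsp_Lp]] v \<phi> p by simp
  ultimately show "approximable \<Omega> \<epsilon> u"
    using \<phi>(1) by blast
qed

lemma Cc_smooth_W0sp: "\<phi> \<in> Cc_smooth \<Omega> \<Longrightarrow> \<phi> \<in> Wsp s p \<Longrightarrow> \<phi> \<in> W0sp \<Omega> s p"
  unfolding W0sp_iff using p Wsp_gagliardo[OF Wsp_cmult, of \<phi> 0] gagliardo_cmult[of \<phi> 0]
  by (auto intro!: bexI[of _ \<phi>] simp: Lp_norm_def)

lemma W0sp_lincomb: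
  assumes u: "u \<in> W0sp \<Omega> s p" and v: "v \<in> W0sp \<Omega> s p"
  shows "(\<lambda>x. u x + c * v x) \<in> W0sp \<Omega> s p"
  unfolding W0sp_iff
proof (intro conjI allI impI)
  show "(\<lambda>x. u x + c * v x) \<in> Wsp s p" using assms by (intro Wsp_add Wsp_cmult W0sp_imp_Wsp)
  fix \<epsilon> :: real assume \<epsilon>: "0 < \<epsilon>"
  define \<delta> where "\<delta> = \<epsilon> / (1 + \<bar>c\<bar>)"
  have \<delta>: "0 < \<delta>" using \<epsilon> by (simp add: \<delta>_def add_pos_nonneg)
  have "(1 + \<bar>c\<bar>) * \<delta> = \<epsilon>" by (simp add: \<delta>_def)
  then have sum: "a + \<bar>c\<bar> * b < \<epsilon>" if "a < \<delta>" "b < \<delta>" for a b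
    using that mult_left_mono[of b \<delta> "\<bar>c\<bar>"] by (simp add: distrib_right)
  obtain \<phi> where \<phi>: "\<phi> \<in> Cc_smooth \<Omega> \<inter> Wsp s p" "close_in_Wsp \<delta> u \<phi>"
    using u \<delta> unfolding W0sp_iff by meson
  obtain \<psi> where \<psi>: "\<psi> \<in> Cc_smooth \<Omega> \<inter> Wsp s p" "close_in_Wsp \<delta> v \<psi>"
    using v \<delta> unfolding W0sp_iff by meson
  have W: "(\<lambda>x. u x - \<phi> x) \<in> Wsp s p" "(\<lambda>x. v x - \<psi> x) \<in> Wsp s p"
    using \<psi> \<phi> assms by (auto intro: Wsp_diff W0sp_imp_Wsp)
  have eq: "(\<lambda>x. u x - \<phi> x + c * (v x - \<psi> x)) = (\<lambda>x. u x + c * v x - (\<phi> x + c * \<psi> x))"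
    by (auto simp: algebra_simps)
  have "close_in_Wsp \<epsilon> (\<lambda>x. u x + c * v x) (\<lambda>x. \<phi> x + c * \<psi> x)"
    using gagliardo_triangle[OF W(1) Wsp_cmult[OF W(2)], of c] gagliardo_cmult[OF W(2), of c]
      Lp_norm_triangle[OF _ W(1)[THEN Wsp_Lp] Wsp_cmult[OF W(2), THEN Wsp_Lp], of c]
      Lp_norm_cmult[of p lborel c "\<lambda>x. v x - \<psi> x"] sum \<phi>(2) \<psi>(2) p unfolding eq
    by (smt (verit, best))
  moreover have "(\<lambda>x. \<phi> x + c * \<psi> x) \<in> Cc_smooth \<Omega> \<inter> Wsp s p"
    using \<phi>(1) \<psi>(1) by (auto intro: Cc_smooth_add Cc_smooth_scale Wsp_add Wsp_cmult)
  ultimately show "approximable \<Omega> \<epsilon> (\<lambda>x. u x + c * v x)" by (rule bexI)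
qed

lemma W0sp_add: "u \<in> W0sp \<Omega> s p \<Longrightarrow> v \<in> W0sp \<Omega> s p \<Longrightarrow> (\<lambda>x. u x + v x) \<in> W0sp \<Omega> s p"
  using W0sp_lincomb[of u \<Omega> v 1] by simp

lemma W0sp_diff: "u \<in> W0sp \<Omega> s p \<Longrightarrow> v \<in> W0sp \<Omega> s p \<Longrightarrow> (\<lambda>x. u x - v x) \<in> W0sp \<Omega> s p"
  using W0sp_lincomb[of u \<Omega> v "-1"] by simp

lemma W0sp_cmult: "u \<in> W0sp \<Omega> s p \<Longrightarrow> (\<lambda>x. c * u x) \<in> W0sp \<Omega> s p"
  using W0sp_lincomb[of u \<Omega> u "c - 1"] by (simp add: algebra_simps)

text \<open>The geometric rate makes the whole sequence converge almost everywhere, and the p-th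
  powers of the errors summable.\<close>

lemma W0sp_fast_approximation:
  assumes "u \<in> W0sp \<Omega> s p"
  obtains \<phi> where "\<And>n. \<phi> n \<in> Cc_smooth \<Omega>" "\<And>n. \<phi> n \<in> Wsp s p"
    "\<And>n. gagliardo s p (\<lambda>x. u x - \<phi> n x) \<le> (1 / 2) ^ n"
    "\<And>n. Lp_norm p lborel (\<lambda>x. u x - \<phi> n x) \<le> (1 / 2) ^ n"
    "AE x in lborel. (\<lambda>n. \<phi> n x) \<longlonglongrightarrow> u x"
proof -
  have "\<forall>n. \<exists>\<phi>. \<phi> \<in> Cc_smooth \<Omega> \<inter> Wsp s p \<and> close_in_Wsp ((1 / 2) ^ n) u \<phi>"
  proof
    fix n :: nat
    have "(0::real) < (1 / 2) ^ n" by simp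
    then show "\<exists>\<phi>. \<phi> \<in> Cc_smooth \<Omega> \<inter> Wsp s p \<and> close_in_Wsp ((1 / 2) ^ n) u \<phi>"
      using assms unfolding W0sp_iff by blast
  qed
  from choice[OF this] obtain \<phi> where \<phi>: "\<And>n. \<phi> n \<in> Cc_smooth \<Omega>" "\<And>n. \<phi> n \<in> Wsp s p"
    "\<And>n. gagliardo s p (\<lambda>x. u x - \<phi> n x) \<le> (1 / 2) ^ n"
    "\<And>n. Lp_norm p lborel (\<lambda>x. u x - \<phi> n x) \<le> (1 / 2) ^ n"
    by (auto intro: less_imp_le)
  have "AE x in lborel. (\<lambda>n. u x - \<phi> n x) \<longlonglongrightarrow> 0"
    by (intro Lp_fast_AE(3)[OF p] Wsp_Lp Wsp_diff W0sp_imp_Wsp[OF assms] \<phi>)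
  then have "AE x in lborel. (\<lambda>n. \<phi> n x) \<longlonglongrightarrow> u x"
  proof eventually_elim
    case (elim x)
    from tendsto_diff[OF tendsto_const[of "u x"] elim] show ?case by simp
  qed
  with \<phi> show thesis by (rule that)
qed

lemma W0sp_outside:
  assumes "u \<in> W0sp \<Omega> s p"
  shows "AE x in lborel. x \<notin> \<Omega> \<longrightarrow> u x = 0"
proof -
  obtain \<phi> where \<phi>: "\<And>n. \<phi> n \<in> Cc_smooth \<Omega>" "AE x in lborel. (\<lambda>n. \<phi> n x) \<longlonglongrightarrow> u x"
    using W0sp_fast_approximation[OF assms] by metis
  from \<phi>(2) show ?thesis
  proof eventually_elim
    case (elim x)
    show ?case
    proof
      assume "x \<notin> \<Omega>"
      then have "\<phi> n x = 0" for n using \<phi>(1) Cc_smooth_outside by blast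
      with elim show "u x = 0" by (simp add: LIMSEQ_const_iff)
    qed
  qed
qed

text \<open>Made for nonlinear images: \<open>G' n\<close> is not compared with G in norm, but is
  dominated by \<open>F' n\<close>, which converges fast to F. The sum over n of the p-th powers of
  \<open>F - F' n\<close> is integrable and yields a majorant independent of n.\<close>

lemma Lp_dominated_convergence:
  assumes F: "in_Lp p M F" "\<And>n. in_Lp p M (F' n)" "\<And>n. Lp_norm p M (\<lambda>x. F x - F' n x) \<le> (1 / 2) ^ n"
    and G: "G \<in> borel_measurable M" "\<And>n. G' n \<in> borel_measurable M"
      "\<And>x. \<bar>G x\<bar> \<le> \<bar>F x\<bar>" "\<And>n x. \<bar>G' n x\<bar> \<le> \<bar>F' n x\<bar>"
    and lim: "AE x in M. (\<lambda>n. G' n x) \<longlonglongrightarrow> G x"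
  shows "(\<lambda>n. Lp_norm p M (\<lambda>x. G x - G' n x)) \<longlonglongrightarrow> 0"
proof -
  have D: "in_Lp p M (\<lambda>x. F x - F' n x)" for n using F p by (intro in_Lp_diff) auto
  note fast = Lp_fast_AE[OF p D F(3)]
  define H where "H x = 2 powr p * (\<bar>F x\<bar> powr p + 2 powr p * (\<bar>F x\<bar> powr p + (\<Sum>n. \<bar>F x - F' n x\<bar> powr p)))" for x
  have "(\<lambda>n. \<integral>x. \<bar>G x - G' n x\<bar> powr p \<partial>M) \<longlonglongrightarrow> (\<integral>x. 0 \<partial>M)"
  proof (rule integral_dominated_convergence[where w = H])
    show "integrable M H" unfolding H_def
      using fast(2) in_Lp_integrable[OF F(1)] by (intro integrable_mult_right Bochner_Integration.integrable_add) auto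
    show "AE x in M. (\<lambda>n. \<bar>G x - G' n x\<bar> powr p) \<longlonglongrightarrow> 0"
      using lim
    proof eventually_elim
      case (elim x)
      have "(\<lambda>n. \<bar>G x - G' n x\<bar> powr p) \<longlonglongrightarrow> \<bar>G x - G x\<bar> powr p"
        using p by (intro tendsto_powr' tendsto_intros elim) auto
      then show ?case by simp
    qed
    show "AE x in M. norm (\<bar>G x - G' n x\<bar> powr p) \<le> H x" for n
      using fast(1)
    proof eventually_elim
      case (elim x)
      have "\<bar>F' n x\<bar> powr p \<le> 2 powr p * (\<bar>F x\<bar> powr p + \<bar>F x - F' n x\<bar> powr p)"
        using abs_powr_add_le[of p "F x" "F' n x - F x"] p by (simp add: abs_minus_commute)
      also have "\<bar>F x - F' n x\<bar> powr p \<le> (\<Sum>n. \<bar>F x - F' n x\<bar> powr p)"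
        using sum_le_suminf[OF elim, of "{n}"] by simp
      finally have 1: "\<bar>F' n x\<bar> powr p \<le> 2 powr p * (\<bar>F x\<bar> powr p + (\<Sum>n. \<bar>F x - F' n x\<bar> powr p))"
        by simp
      have "\<bar>G x - G' n x\<bar> powr p \<le> 2 powr p * (\<bar>G x\<bar> powr p + \<bar>G' n x\<bar> powr p)"
        using abs_powr_add_le[of p "G x" "- G' n x"] p by simp
      also have "\<dots> \<le> 2 powr p * (\<bar>F x\<bar> powr p + \<bar>F' n x\<bar> powr p)"
        using G p by (intro mult_left_mono add_mono powr_mono2) auto
      also have "\<dots> \<le> H x" unfolding H_def using 1 by simp
      finally show ?case by simp
    qed
  qed (use G in auto)
  then have "(\<lambda>n. powr_integral p M (\<lambda>x. G x - G' n x) powr (1 / p)) \<longlonglongrightarrow> 0 powr (1 / p)"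
    using p by (intro tendsto_powr' tendsto_intros) auto
  then show ?thesis by (simp add: Lp_norm_def)
qed

text \<open>The approximants are \<psi> = \<open>soft_abs\<close> of \<phi> with parameter 1/(n+1).
  Nonnegativity, the bound on their seminorm and the limit feed Fatou's lemma in the singular bound;
  the comparisons with \<phi> provide the majorants for the absolute value.\<close>

lemma W0sp_soft_abs_approximation:
  assumes u: "u \<in> W0sp \<Omega> s p"
  obtains \<phi> \<psi> where "\<And>n. \<phi> n \<in> Wsp s p"
    "\<And>n. gagliardo s p (\<lambda>x. u x - \<phi> n x) \<le> (1 / 2) ^ n"
    "\<And>n. Lp_norm p lborel (\<lambda>x. u x - \<phi> n x) \<le> (1 / 2) ^ n"
    "\<And>n. \<psi> n \<in> Cc_smooth \<Omega>" "\<And>n. \<psi> n \<in> Wsp s p"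
    "\<And>n x. 0 \<le> \<psi> n x" "\<And>n x. \<psi> n x \<le> \<bar>\<phi> n x\<bar>"
    "\<And>n x y. \<bar>\<psi> n x - \<psi> n y\<bar> \<le> \<bar>\<phi> n x - \<phi> n y\<bar>"
    "\<And>n. gagliardo s p (\<psi> n) \<le> gagliardo s p u + (1 / 2) ^ n"
    "AE x in lborel. (\<lambda>n. \<psi> n x) \<longlonglongrightarrow> \<bar>u x\<bar>"
proof -
  obtain \<phi> where \<phi>: "\<And>n. \<phi> n \<in> Cc_smooth \<Omega>" "\<And>n. \<phi> n \<in> Wsp s p"
    "\<And>n. gagliardo s p (\<lambda>x. u x - \<phi> n x) \<le> (1 / 2) ^ n"
    "\<And>n. Lp_norm p lborel (\<lambda>x. u x - \<phi> n x) \<le> (1 / 2) ^ n"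
    "AE x in lborel. (\<lambda>n. \<phi> n x) \<longlonglongrightarrow> u x"
    by (rule W0sp_fast_approximation[OF u]) (rule that; assumption)
  define \<delta> where "\<delta> n = inverse (real (Suc n))" for n
  have \<delta>: "0 < \<delta> n" for n by (simp add: \<delta>_def)
  have \<delta>0: "\<delta> \<longlonglongrightarrow> 0" unfolding \<delta>_def by (rule LIMSEQ_inverse_real_of_nat)
  define \<psi> where "\<psi> n = (\<lambda>x. soft_abs (\<delta> n) (\<phi> n x))" for n
  have soft_meas: "soft_abs e \<in> borel_measurable borel" for e
    unfolding soft_abs_def by measurable
  note W = Wsp_contraction[OF soft_abs_lipschitz soft_abs_0[OF \<delta>] soft_meas \<phi>(2)]
  show thesis
  proof (rule that[OF \<phi>(2-4), of \<psi>])
    show "gagliardo s p (\<psi> n) \<le> gagliardo s p u + (1 / 2) ^ n" for n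
      using W(2)[of n n] gagliardo_triangle_diff[OF W0sp_imp_Wsp[OF u] \<phi>(2)[of n]] \<phi>(3)[of n]
      unfolding \<psi>_def by simp
    show "AE x in lborel. (\<lambda>n. \<psi> n x) \<longlonglongrightarrow> \<bar>u x\<bar>"
      using \<phi>(5) unfolding \<psi>_def by eventually_elim (rule soft_abs_tendsto[OF \<delta> \<delta>0])
  qed (auto simp: \<psi>_def W(1) soft_abs_nonneg[OF \<delta>] soft_abs_le[OF \<delta>]
      soft_abs_lipschitz intro: Cc_smooth_soft_abs[OF \<phi>(1) \<delta>])
qed

text \<open>A contraction of the real line bounds the seminorm of the composed function but not that
  of a difference of two composed functions. Convergence to \<open>\<bar>u\<bar>\<close> is
  therefore obtained by dominated convergence, once for the functions and once for their difference
  quotients.\<close>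

lemma W0sp_abs:
  assumes u: "u \<in> W0sp \<Omega> s p"
  shows "(\<lambda>x. \<bar>u x\<bar>) \<in> W0sp \<Omega> s p"
proof -
  obtain \<phi> \<psi> where \<phi>: "\<And>n. \<phi> n \<in> Wsp s p"
    "\<And>n. gagliardo s p (\<lambda>x. u x - \<phi> n x) \<le> (1 / 2) ^ n"
    "\<And>n. Lp_norm p lborel (\<lambda>x. u x - \<phi> n x) \<le> (1 / 2) ^ n"
    and \<psi>C: "\<And>n. \<psi> n \<in> Cc_smooth \<Omega>" and \<psi>W: "\<And>n. \<psi> n \<in> Wsp s p"
    and \<psi>: "\<And>n x. 0 \<le> \<psi> n x" "\<And>n x. \<psi> n x \<le> \<bar>\<phi> n x\<bar>"
      "\<And>n x y. \<bar>\<psi> n x - \<psi> n y\<bar> \<le> \<bar>\<phi> n x - \<phi> n y\<bar>"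
    and lim: "AE x in lborel. (\<lambda>n. \<psi> n x) \<longlonglongrightarrow> \<bar>u x\<bar>"
    by (rule W0sp_soft_abs_approximation[OF u]) (rule that; assumption)
  have uW: "u \<in> Wsp s p" using u by (rule W0sp_imp_Wsp)
  have absW: "(\<lambda>x. \<bar>u x\<bar>) \<in> Wsp s p"
    by (rule Wsp_contraction[OF _ _ _ uW]) auto
  have 1: "(\<lambda>n. Lp_norm p lborel (\<lambda>x. \<bar>u x\<bar> - \<psi> n x)) \<longlonglongrightarrow> 0"
  proof (rule Lp_dominated_convergence[OF Wsp_Lp[OF uW] Wsp_Lp[OF \<phi>(1)] \<phi>(3) _ _ _ _ lim])
    show "\<bar>\<psi> n x\<bar> \<le> \<bar>\<phi> n x\<bar>" for n x
      using \<psi>(1,2) by (simp add: abs_of_nonneg)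
  qed (use absW \<psi>W Wsp_measurable in auto)
  have "(\<lambda>n. Lp_norm p lborel2 (\<lambda>z. diff_quot s p (\<lambda>x. \<bar>u x\<bar>) z - diff_quot s p (\<psi> n) z)) \<longlonglongrightarrow> 0"
  proof (rule Lp_dominated_convergence[OF Wsp_diff_quot[OF uW] Wsp_diff_quot[OF \<phi>(1)]])
    show "Lp_norm p lborel2 (\<lambda>z. diff_quot s p u z - diff_quot s p (\<phi> n) z) \<le> (1 / 2) ^ n" for n
      using \<phi>(2)[of n] by (simp add: Wsp_gagliardo[OF Wsp_diff[OF uW \<phi>(1)]] diff_quot_diff)
    show "\<bar>diff_quot s p (\<psi> n) z\<bar> \<le> \<bar>diff_quot s p (\<phi> n) z\<bar>" for n z
      using \<psi>(3) by (simp add: diff_quot_def divide_right_mono)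
    show "\<bar>diff_quot s p (\<lambda>x. \<bar>u x\<bar>) z\<bar> \<le> \<bar>diff_quot s p u z\<bar>" for z
      by (rule diff_quot_contraction[OF abs_triangle_ineq3])
    show "AE z in lborel2. (\<lambda>n. diff_quot s p (\<psi> n) z) \<longlonglongrightarrow> diff_quot s p (\<lambda>x. \<bar>u x\<bar>) z"
      using AE_lborel_pair[OF lim] unfolding diff_quot_def
      by eventually_elim (auto simp: divide_inverse intro!: tendsto_mult_right tendsto_diff)
  qed (use absW \<psi>W Wsp_diff_quot in_Lp_measurable in blast)+
  then have 2: "(\<lambda>n. gagliardo s p (\<lambda>x. \<bar>u x\<bar> - \<psi> n x)) \<longlonglongrightarrow> 0"
    by (simp add: Wsp_gagliardo[OF Wsp_diff[OF absW \<psi>W]] diff_quot_diff)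
  show ?thesis
  proof (rule W0sp_closed[OF absW])
    fix \<epsilon> :: real assume "0 < \<epsilon>"
    from eventually_conj[OF order_tendstoD(2)[OF 2 this] order_tendstoD(2)[OF 1 this]]
    obtain n where "gagliardo s p (\<lambda>x. \<bar>u x\<bar> - \<psi> n x) < \<epsilon>" "Lp_norm p lborel (\<lambda>x. \<bar>u x\<bar> - \<psi> n x) < \<epsilon>"
      by (auto simp: eventually_sequentially)
    then show "\<exists>v\<in>W0sp \<Omega> s p. gagliardo s p (\<lambda>x. \<bar>u x\<bar> - v x) < \<epsilon> \<and> Lp_norm p lborel (\<lambda>x. \<bar>u x\<bar> - v x) < \<epsilon>"
      using Cc_smooth_W0sp[OF \<psi>C \<psi>W] by blast
  qed
qed

lemma gagliardo_abs_le: "u \<in> Wsp s p \<Longrightarrow> gagliardo s p (\<lambda>x. \<bar>u x\<bar>) \<le> gagliardo s p u"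
  by (rule Wsp_contraction(2)) auto

text \<open>Equal integrals of ordered integrands force equality almost everywhere, but the
  integrands differ strictly on the product of {u > 0} and {u < 0}. This product is thus a null set,
  and so is one of its factors.\<close>

lemma gagliardo_abs_eq_imp_sign:
  assumes u: "u \<in> Wsp s p" and eq: "gagliardo s p (\<lambda>x. \<bar>u x\<bar>) = gagliardo s p u"
  shows "(AE x in lborel. 0 \<le> u x) \<or> (AE x in lborel. u x \<le> 0)"
proof -
  have absW: "(\<lambda>x. \<bar>u x\<bar>) \<in> Wsp s p" by (rule Wsp_contraction[OF _ _ _ u]) auto
  let ?P = "lborel2 :: ('a \<times> 'a) measure"
  have [measurable]: "u \<in> borel_measurable lborel" using u by (rule Wsp_measurable)
  have i: "integrable ?P (\<lambda>z. \<bar>diff_quot s p u z\<bar> powr p)"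
     "integrable ?P (\<lambda>z. \<bar>diff_quot s p (\<lambda>x. \<bar>u x\<bar>) z\<bar> powr p)"
    using u absW by (auto intro: in_Lp_integrable Wsp_diff_quot)
  have le: "\<bar>diff_quot s p (\<lambda>x. \<bar>u x\<bar>) z\<bar> \<le> \<bar>diff_quot s p u z\<bar>" for z
    by (rule diff_quot_contraction[OF abs_triangle_ineq3])
  have "(\<integral>z. \<bar>diff_quot s p u z\<bar> powr p - \<bar>diff_quot s p (\<lambda>x. \<bar>u x\<bar>) z\<bar> powr p \<partial>?P) = 0"
    using i eq gagliardo_powr[OF u] gagliardo_powr[OF absW] by simp
  then have "AE z in ?P. \<bar>diff_quot s p u z\<bar> powr p - \<bar>diff_quot s p (\<lambda>x. \<bar>u x\<bar>) z\<bar> powr p = 0"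
    using i le p by (subst (asm) integral_nonneg_eq_0_iff_AE) (auto intro!: powr_mono2)
  then have "AE z in ?P. z \<notin> {x. 0 < u x} \<times> {x. u x < 0}"
  proof eventually_elim
    case (elim z)
    show ?case
    proof
      assume z: "z \<in> {x. 0 < u x} \<times> {x. u x < 0}"
      then obtain x y where xy: "z = (x, y)" "0 < u x" "u y < 0" by auto
      then have "x \<noteq> y" by auto
      then have "\<bar>diff_quot s p (\<lambda>x. \<bar>u x\<bar>) z\<bar> < \<bar>diff_quot s p u z\<bar>"
        using xy by (auto simp: diff_quot_def intro!: divide_strict_right_mono)
      then have "\<bar>diff_quot s p (\<lambda>x. \<bar>u x\<bar>) z\<bar> powr p < \<bar>diff_quot s p u z\<bar> powr p"
        using p by (intro powr_less_mono2) auto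
      with elim show False by simp
    qed
  qed
  then have "emeasure ?P ({x. 0 < u x} \<times> {x. u x < 0}) = 0"
    by (subst (asm) AE_iff_measurable[OF _ refl]) (auto simp: space_pair_measure)
  then have "emeasure lborel {x. 0 < u x} * emeasure lborel {x. u x < 0} = 0"
    by (subst (asm) lborel.emeasure_pair_measure_Times) auto
  then consider "emeasure lborel {x. 0 < u x} = 0" | "emeasure lborel {x. u x < 0} = 0" by auto
  then show ?thesis
  proof cases
    case 1
    then have "AE x in lborel. u x \<le> 0" by (subst AE_iff_measurable[OF _ refl]) (auto simp: not_le)
    then show ?thesis ..
  next
    case 2
    then have "AE x in lborel. 0 \<le> u x" by (subst AE_iff_measurable[OF _ refl]) (auto simp: not_le)
    then show ?thesis ..
  qed
qed

end

section \<open>Poincare inequality and completeness\<close>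

text \<open>For x in \<Omega>, keep in the inner integral only the y from a unit ball A disjoint
  from \<Omega>. There u y = 0 and the distance to x is at most L, so the inner integral is at least
  \<kappa> times the p-th power of \<open>\<bar>u x\<bar>\<close>.\<close>

lemma Wsp_Poincare:
  fixes \<Omega> :: "'a::euclidean_space set"
  assumes p: "1 < p" and s: "0 < s" and \<Omega>: "bounded \<Omega>"
  obtains C where "0 \<le> C"
    "\<And>u. u \<in> Wsp s p \<Longrightarrow> (AE x in lborel. x \<notin> \<Omega> \<longrightarrow> u x = 0) \<Longrightarrow> Lp_norm p lborel u \<le> C * gagliardo s p u"
proof -
  from \<Omega> obtain R where R: "0 < R" "\<And>x. x \<in> \<Omega> \<Longrightarrow> norm x \<le> R"
    by (auto simp: bounded_pos)
  obtain e :: 'a where e: "e \<in> Basis" using nonempty_Basis by blast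
  \<comment> \<open>The unit ball about c misses the ball of radius R containing \<Omega>. Its
    points have norm below R + 3, so they lie within R + (R + 3) = L of each point of
    \<Omega>.\<close>
  define c where "c = (R + 2) *\<^sub>R e"
  have c: "norm c = R + 2" using R e by (simp add: c_def)
  define A where "A = ball c 1"
  define L where "L = 2 * R + 3"
  define q where "q = real DIM('a) + s * p"
  have q: "0 < q" using s p by (simp add: q_def add_pos_pos)
  have L: "0 < L" using R by (simp add: L_def)
  have A: "y \<notin> \<Omega>" "norm (x - y) \<le> L" "x \<noteq> y" if "y \<in> A" "x \<in> \<Omega>" for x y
  proof -
    have 1: "norm (c - y) < 1" using that by (simp add: A_def dist_norm)
    have 2: "norm c \<le> norm (c - y) + norm y" using norm_triangle_ineq[of "c - y" y] by simp
    have 3: "norm y \<le> norm (c - y) + norm c" using norm_triangle_ineq[of "y - c" c] by (simp add: norm_minus_commute)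
    show y: "y \<notin> \<Omega>" using 1 2 c R(2)[of y] by auto
    then show "x \<noteq> y" using that by auto
    show "norm (x - y) \<le> L" using 1 3 c R(2)[OF that(2)] norm_triangle_ineq4[of x y] by (simp add: L_def)
  qed
  define \<kappa> where "\<kappa> = measure lborel A / L powr q"
  have \<kappa>: "0 < \<kappa>" using L by (auto simp: \<kappa>_def A_def content_ball_pos)
  have emA: "emeasure lborel A = ennreal (measure lborel A)"
    unfolding A_def by (rule emeasure_eq_ennreal_measure) (use emeasure_lborel_ball_finite[of c 1] in auto)
  have bound: "\<kappa> * Lp_norm p lborel u powr p \<le> gagliardo s p u powr p"
    if u: "u \<in> Wsp s p" and out: "AE x in lborel. x \<notin> \<Omega> \<longrightarrow> u x = 0" for u :: "'a \<Rightarrow> real"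
  proof -
    have [measurable]: "u \<in> borel_measurable lborel" using u by (rule Wsp_measurable)
    have [measurable]: "diff_quot s p u \<in> borel_measurable lborel2"
      by (rule diff_quot_measurable_lborel) simp
    have "ennreal \<kappa> * ennreal (Lp_norm p lborel u powr p) = (\<integral>\<^sup>+x. ennreal \<kappa> * ennreal (\<bar>u x\<bar> powr p) \<partial>lborel)"
      using nn_integral_Lp[OF Wsp_Lp[OF p u]] p by (simp add: nn_integral_cmult)
    also have "\<dots> \<le> (\<integral>\<^sup>+x. \<integral>\<^sup>+y. ennreal (\<bar>diff_quot s p u (x, y)\<bar> powr p) \<partial>lborel \<partial>lborel)"
    proof (rule nn_integral_mono_AE)
      show "AE x in lborel. ennreal \<kappa> * ennreal (\<bar>u x\<bar> powr p) \<le> (\<integral>\<^sup>+y. ennreal (\<bar>diff_quot s p u (x, y)\<bar> powr p) \<partial>lborel)"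
        using out
      proof eventually_elim
        case (elim x)
        show ?case
        proof (cases "x \<in> \<Omega>")
          case True
          have "ennreal \<kappa> * ennreal (\<bar>u x\<bar> powr p) = ennreal (\<bar>u x\<bar> powr p / L powr q) * emeasure lborel A"
            unfolding emA by (simp add: \<kappa>_def ennreal_mult[symmetric])
          also have "\<dots> = (\<integral>\<^sup>+y. ennreal (\<bar>u x\<bar> powr p / L powr q) * indicator A y \<partial>lborel)"
            by (simp add: nn_integral_cmult_indicator A_def)
          also have "\<dots> \<le> (\<integral>\<^sup>+y. ennreal (\<bar>diff_quot s p u (x, y)\<bar> powr p) \<partial>lborel)"
          proof (rule nn_integral_mono_AE)
            show "AE y in lborel. ennreal (\<bar>u x\<bar> powr p / L powr q) * indicator A y \<le> ennreal (\<bar>diff_quot s p u (x, y)\<bar> powr p)"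
              using out
            proof eventually_elim
              case (elim y)
              show ?case
              proof (cases "y \<in> A")
                case yA: True
                then have "u y = 0" using elim A(1) True by blast
                moreover have "norm (x - y) powr q \<le> L powr q" "0 < L powr q * norm (x - y) powr q"
                  using A[OF yA True] q L by (auto intro: powr_mono2)
                ultimately show ?thesis
                  using yA p by (auto simp: diff_quot_powr q_def[symmetric] intro!: ennreal_leI divide_left_mono simp del: zero_less_mult_iff)
              qed simp
            qed
          qed
          finally show ?thesis .
        next
          case False
          then have "u x = 0" using elim by simp
          then show ?thesis using p by simp
        qed
      qed
    qed
    also have "\<dots> = (\<integral>\<^sup>+z. ennreal (\<bar>diff_quot s p u z\<bar> powr p) \<partial>lborel2)"
      by (rule lborel.nn_integral_fst) measurable
    also have "\<dots> = ennreal (gagliardo s p u powr p)"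
      using nn_integral_Lp[OF Wsp_diff_quot[OF p u]] p by (simp add: Wsp_gagliardo[OF p u])
    finally show ?thesis using \<kappa> by (simp add: ennreal_mult[symmetric] del: ennreal_mult'')
  qed
  show thesis
  proof (rule that[of "(1 / \<kappa>) powr (1 / p)"])
    fix u :: "'a \<Rightarrow> real"
    assume u: "u \<in> Wsp s p" "AE x in lborel. x \<notin> \<Omega> \<longrightarrow> u x = 0"
    have "Lp_norm p lborel u powr p \<le> (1 / \<kappa>) * gagliardo s p u powr p"
      using bound[OF u] \<kappa> by (simp add: field_simps)
    then have "(Lp_norm p lborel u powr p) powr (1 / p) \<le> ((1 / \<kappa>) * gagliardo s p u powr p) powr (1 / p)"
      using p by (intro powr_mono2) auto
    then show "Lp_norm p lborel u \<le> (1 / \<kappa>) powr (1 / p) * gagliardo s p u"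
      using p \<kappa> by (simp add: powr_mult powr_divide powr_powr Lp_norm_nonneg gagliardo_nonneg)
  qed simp
qed

lemma W0sp_gagliardo_eq_0:
  assumes p: "1 < p" and s: "0 < s" and \<Omega>: "bounded \<Omega>" and u: "u \<in> W0sp \<Omega> s p" and 0: "gagliardo s p u = 0"
  shows "AE x in lborel. u x = 0"
proof -
  obtain C where C: "0 \<le> C" "\<And>u. u \<in> Wsp s p \<Longrightarrow> (AE x in lborel. x \<notin> \<Omega> \<longrightarrow> u x = 0) \<Longrightarrow> Lp_norm p lborel u \<le> C * gagliardo s p u"
    by (rule Wsp_Poincare[OF p s \<Omega>]) (rule that; assumption)
  have W: "u \<in> Wsp s p" using u by (rule W0sp_imp_Wsp)
  have "Lp_norm p lborel u = 0"
    using C(2)[OF W W0sp_outside[OF p u]] 0 Lp_norm_nonneg[of p lborel u] by simp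
  then have "powr_integral p lborel u = 0" by (simp add: Lp_norm_def)
  then have "AE x in lborel. \<bar>u x\<bar> powr p = 0"
    using in_Lp_integrable[OF Wsp_Lp[OF p W]] by (subst (asm) integral_nonneg_eq_0_iff_AE) auto
  then show ?thesis by eventually_elim simp
qed

text \<open>The Poincare inequality upgrades the Cauchy property to L^p, where a fast subsequence
  has a limit almost everywhere. Fatou's lemma for \<open>v m - v (r n)\<close> with m fixed then
  controls the distance to the limit. The subsequence is part of the conclusion because signs pass
  to the limit only pointwise.\<close>

lemma W0sp_complete:
  fixes v :: "nat \<Rightarrow> 'a::euclidean_space \<Rightarrow> real"
  assumes p: "1 < p" and s: "0 < s" and \<Omega>: "bounded \<Omega>" and v: "\<And>n. v n \<in> W0sp \<Omega> s p"
    and Cauchy: "\<And>e. 0 < e \<Longrightarrow> \<exists>N. \<forall>m\<ge>N. \<forall>n\<ge>N. gagliardo s p (\<lambda>x. v m x - v n x) \<le> e"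
  obtains V r where "V \<in> W0sp \<Omega> s p" "strict_mono r" "AE x in lborel. (\<lambda>n. v (r n) x) \<longlonglongrightarrow> V x"
    "(\<lambda>n. gagliardo s p (\<lambda>x. v n x - V x)) \<longlonglongrightarrow> 0"
proof -
  obtain C where C: "0 \<le> C" "\<And>u. u \<in> Wsp s p \<Longrightarrow> (AE x in lborel. x \<notin> \<Omega> \<longrightarrow> u x = 0) \<Longrightarrow> Lp_norm p lborel u \<le> C * gagliardo s p u"
    by (rule Wsp_Poincare[OF p s \<Omega>]) (rule that; assumption)
  note vW = W0sp_imp_Wsp[OF v]
  have dW: "(\<lambda>x. v m x - v n x) \<in> Wsp s p" for m n using p vW by (intro Wsp_diff)
  have LC: "Lp_norm p lborel (\<lambda>x. v m x - v n x) \<le> C * gagliardo s p (\<lambda>x. v m x - v n x)" for m n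
    by (intro C(2) dW W0sp_outside[where s = s, OF p] W0sp_diff[OF p] v)
  \<comment> \<open>The factor 1/(C + 1) absorbs the Poincare constant, leaving increments of at
    most (1/4)^k in L^p.\<close>
  have "\<forall>k. \<exists>N. \<forall>m\<ge>N. \<forall>n\<ge>N. gagliardo s p (\<lambda>x. v m x - v n x) \<le> (1 / 4) ^ k / (C + 1)"
    using C by (intro allI Cauchy) simp
  from choice[OF this] obtain N where
    N: "\<And>k m n. N k \<le> m \<Longrightarrow> N k \<le> n \<Longrightarrow> gagliardo s p (\<lambda>x. v m x - v n x) \<le> (1 / 4) ^ k / (C + 1)"
    by metis
  \<comment> \<open>The partial sums dominate each N k, and the summand k makes r strictly
    increasing with k \<le> r k.\<close>
  define r where "r k = (\<Sum>j\<le>k. N j) + k" for k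
  have r: "strict_mono r" unfolding r_def by (rule strict_monoI_Suc) simp
  have rN: "N k \<le> r k" for k unfolding r_def
    using member_le_sum[of k "{..k}" N] by (simp add: trans_le_add1)
  have rk: "k \<le> r k" for k by (simp add: r_def)
  have fast: "Lp_norm p lborel (\<lambda>x. v (r (Suc k)) x - v (r k) x) \<le> (1 / 4) ^ k" for k
  proof -
    have "r k \<le> r (Suc k)" using r by (simp add: strict_mono_less_eq)
    then have "gagliardo s p (\<lambda>x. v (r (Suc k)) x - v (r k) x) \<le> (1 / 4) ^ k / (C + 1)"
      using rN[of k] by (intro N) auto
    then have "Lp_norm p lborel (\<lambda>x. v (r (Suc k)) x - v (r k) x) \<le> C * ((1 / 4) ^ k / (C + 1))"
      using LC[of "r (Suc k)" "r k"] C mult_left_mono by fastforce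
    also have "\<dots> = (1 / 4) ^ k * (C / (C + 1))" by simp
    also have "\<dots> \<le> (1 / 4) ^ k * 1" using C by (intro mult_left_mono) auto
    finally show ?thesis by simp
  qed
  have conv: "AE x in lborel. convergent (\<lambda>n. v (r n) x)"
    by (rule Lp_fast_Cauchy_AE[OF p Wsp_Lp[OF p vW] fast])
  define V where "V x = lim (\<lambda>n. v (r n) x)" for x
  have lim: "AE x in lborel. (\<lambda>n. v (r n) x) \<longlonglongrightarrow> V x"
    using conv by eventually_elim (simp add: V_def convergent_LIMSEQ_iff)
  have Vm: "V \<in> borel_measurable lborel"
    unfolding V_def by (rule borel_measurable_lim_metric) (rule Wsp_measurable[OF vW])
  have limd: "AE x in lborel. (\<lambda>n. v m x - v (r n) x) \<longlonglongrightarrow> v m x - V x" for m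
    using lim by eventually_elim (intro tendsto_intros)
  have Dm: "(\<lambda>x. v m x - V x) \<in> borel_measurable lborel" for m
    using Vm Wsp_measurable[OF vW[of m]] by simp
  have main: "(\<lambda>x. v m x - V x) \<in> Wsp s p \<and> gagliardo s p (\<lambda>x. v m x - V x) \<le> e \<and>
      Lp_norm p lborel (\<lambda>x. v m x - V x) \<le> C * e"
    if e: "\<And>n. M \<le> n \<Longrightarrow> gagliardo s p (\<lambda>x. v m x - v n x) \<le> e" for m M e
  proof -
    have ev: "eventually (\<lambda>n. gagliardo s p (\<lambda>x. v m x - v (r n) x) \<le> e) sequentially"
      unfolding eventually_sequentially using e rk order_trans by blast
    have 1: "in_Lp p lborel (\<lambda>x. v m x - V x)" "Lp_norm p lborel (\<lambda>x. v m x - V x) \<le> C * e"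
    proof -
      have "eventually (\<lambda>n. Lp_norm p lborel (\<lambda>x. v m x - v (r n) x) \<le> C * e) sequentially"
        using ev by eventually_elim (use LC C order_trans mult_left_mono in blast)
      from Lp_Fatou[OF p Wsp_Lp[OF p dW] Dm this limd]
      show "in_Lp p lborel (\<lambda>x. v m x - V x)" "Lp_norm p lborel (\<lambda>x. v m x - V x) \<le> C * e" .
    qed
    have ev': "eventually (\<lambda>n. Lp_norm p lborel2 (diff_quot s p (\<lambda>x. v m x - v (r n) x)) \<le> e) sequentially"
      using ev by (simp add: Wsp_gagliardo[OF p dW])
    have "AE z in lborel2. (\<lambda>n. diff_quot s p (\<lambda>x. v m x - v (r n) x) z) \<longlonglongrightarrow> diff_quot s p (\<lambda>x. v m x - V x) z"
      using AE_lborel_pair[OF limd[of m]] unfolding diff_quot_def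
      by eventually_elim (auto simp: divide_inverse intro!: tendsto_mult_right tendsto_diff)
    from Lp_Fatou[OF p Wsp_diff_quot[OF p dW] diff_quot_measurable_lborel[OF Dm] ev' this]
    show ?thesis using 1 p by (simp add: Wsp_iff gagliardo_eq[OF _ Dm])
  qed
  obtain M0 where M0: "\<And>n. M0 \<le> n \<Longrightarrow> gagliardo s p (\<lambda>x. v M0 x - v n x) \<le> 1"
    using Cauchy[of 1] by auto
  have "(\<lambda>x. v M0 x - (v M0 x - V x)) \<in> Wsp s p"
    using Wsp_diff[OF p vW[of M0] conjunct1[OF main[of M0 M0 1, OF M0]]] by simp
  then have VW: "V \<in> Wsp s p" by simp
  have close: "\<exists>N. \<forall>n\<ge>N. gagliardo s p (\<lambda>x. v n x - V x) \<le> e \<and> Lp_norm p lborel (\<lambda>x. v n x - V x) \<le> C * e"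
    if "0 < e" for e
  proof -
    from Cauchy[OF that] obtain N where N: "\<And>m n. N \<le> m \<Longrightarrow> N \<le> n \<Longrightarrow> gagliardo s p (\<lambda>x. v m x - v n x) \<le> e"
      by blast
    show ?thesis using main[OF N] by blast
  qed
  have "V \<in> W0sp \<Omega> s p"
  proof (rule W0sp_closed[OF p VW])
    fix \<epsilon> :: real assume \<epsilon>: "0 < \<epsilon>"
    define e where "e = \<epsilon> / (2 * (C + 1))"
    have e: "0 < e" using \<epsilon> C by (simp add: e_def)
    have "2 * (C + 1) * e = \<epsilon>" using C by (simp add: e_def)
    then have eq: "C * e = \<epsilon> / 2 - e" by (simp add: algebra_simps)
    have "0 \<le> C * e" using e C by simp
    then have e: "0 < e" "e < \<epsilon>" "C * e < \<epsilon>" using e \<epsilon> unfolding eq by auto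
    from close[OF e(1)] obtain n where "gagliardo s p (\<lambda>x. v n x - V x) \<le> e" "Lp_norm p lborel (\<lambda>x. v n x - V x) \<le> C * e"
      by blast
    then show "\<exists>v\<in>W0sp \<Omega> s p. gagliardo s p (\<lambda>x. V x - v x) < \<epsilon> \<and> Lp_norm p lborel (\<lambda>x. V x - v x) < \<epsilon>"
      using e v[of n] gagliardo_minus_commute[OF p, of s "v n" V] Lp_norm_minus_commute[of p lborel "v n" V]
      by (intro bexI[of _ "v n"]) auto
  qed
  moreover have "(\<lambda>n. gagliardo s p (\<lambda>x. v n x - V x)) \<longlonglongrightarrow> 0"
  proof (rule LIMSEQ_I)
    fix e :: real assume "0 < e"
    then obtain N where N: "\<And>n. N \<le> n \<Longrightarrow> gagliardo s p (\<lambda>x. v n x - V x) \<le> e / 2"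
      using close[of "e / 2"] by auto
    have "norm (gagliardo s p (\<lambda>x. v n x - V x) - 0) < e" if "N \<le> n" for n
      using N[OF that] \<open>0 < e\<close> gagliardo_nonneg[of s p "\<lambda>x. v n x - V x"] by simp
    then show "\<exists>N. \<forall>n\<ge>N. norm (gagliardo s p (\<lambda>x. v n x - V x) - 0) < e" by blast
  qed
  ultimately show thesis using that r lim by blast
qed

section \<open>Energy estimates for the singular problem\<close>

text \<open>The weight is taken as a Borel function on the whole space that is nonnegative
  everywhere and vanishes off \<Omega>, so that integrals over \<Omega> become plain Lebesgue
  integrals.\<close>

locale weighted_problem =
  fixes \<Omega> :: "'a::euclidean_space set" and s p :: real and w :: "'a \<Rightarrow> real"
  assumes \<Omega>_open: "open \<Omega>" and \<Omega>_bounded: "bounded \<Omega>" and s: "0 < s" and p: "1 < p"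
    and w_meas [measurable]: "w \<in> borel_measurable borel" and w_nonneg: "0 \<le> w x"
    and w_int: "integrable lborel w" and w_outside: "x \<notin> \<Omega> \<Longrightarrow> w x = 0"
    and w_nonzero: "\<not> (AE x in lborel. w x = 0)"
begin

abbreviation W0 :: "('a \<Rightarrow> real) set" where "W0 \<equiv> W0sp \<Omega> s p"
abbreviation snorm :: "('a \<Rightarrow> real) \<Rightarrow> real" where "snorm \<equiv> gagliardo s p"
abbreviation moment :: "real \<Rightarrow> ('a \<Rightarrow> real) \<Rightarrow> real" where
  "moment q v \<equiv> \<integral>x. w x * \<bar>v x\<bar> powr q \<partial>lborel"
abbreviation moment_finite :: "real \<Rightarrow> ('a \<Rightarrow> real) \<Rightarrow> bool" where
  "moment_finite q v \<equiv> integrable lborel (\<lambda>x. w x * \<bar>v x\<bar> powr q)"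

definition mass :: real where "mass = (\<integral>x. w x \<partial>lborel)"

lemma mass_pos: "0 < mass"
proof -
  have "mass \<noteq> 0"
    unfolding mass_def using w_int w_nonneg w_nonzero by (subst integral_nonneg_eq_0_iff_AE) auto
  moreover have "0 \<le> mass" unfolding mass_def using w_nonneg by simp
  ultimately show ?thesis by simp
qed

end

locale singular_solution = weighted_problem +
  fixes \<alpha> :: real and u :: "'a \<Rightarrow> real"
  assumes \<alpha>: "0 < \<alpha>" "\<alpha> < 1" and u: "u \<in> W0"
    and lower: "\<And>\<Omega>'. open \<Omega>' \<Longrightarrow> connected \<Omega>' \<Longrightarrow> compact (closure \<Omega>') \<Longrightarrow> closure \<Omega>' \<subseteq> \<Omega> \<Longrightarrow>
      \<exists>C>0. AE x in lborel. x \<in> \<Omega>' \<longrightarrow> C \<le> u x"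
    and weak_eq: "\<And>\<phi>. \<phi> \<in> Cc_smooth \<Omega> \<Longrightarrow> pairing s p u \<phi> = (\<integral>x. w x * \<phi> x / u x powr \<alpha> \<partial>lborel)"
begin

lemma uW: "u \<in> Wsp s p"
  using u by (rule W0sp_imp_Wsp)

lemma u_meas [measurable]: "u \<in> borel_measurable borel"
  using Wsp_measurable[OF uW] by simp

lemma lower_ball: "0 < r \<Longrightarrow> cball x r \<subseteq> \<Omega> \<Longrightarrow> \<exists>C>0. AE y in lborel. y \<in> ball x r \<longrightarrow> C \<le> u y"
  by (rule lower) auto

text \<open>The definition of a solution bounds u from below only on connected open sets. Balls are
  connected, finitely many of them cover K, and the least of their constants works.\<close>

lemma lower_compact:
  assumes K: "compact K" "K \<subseteq> \<Omega>"
  shows "\<exists>C>0. AE x in lborel. x \<in> K \<longrightarrow> C \<le> u x"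
proof -
  define F where "F = {ball x r | x r. 0 < r \<and> cball x r \<subseteq> \<Omega>}"
  have cover: "K \<subseteq> \<Union>F"
  proof
    fix x assume "x \<in> K"
    with K obtain r where "0 < r" "cball x r \<subseteq> \<Omega>" using \<Omega>_open open_contains_cball by blast
    then show "x \<in> \<Union>F" unfolding F_def by (auto intro!: exI[of _ "ball x r"])
  qed
  have "open S" if "S \<in> F" for S using that by (auto simp: F_def)
  from compactE[OF K(1) cover this] obtain F' where F': "F' \<subseteq> F" "finite F'" "K \<subseteq> \<Union>F'"
    by blast
  have "\<forall>S\<in>F'. \<exists>C>0. AE x in lborel. x \<in> S \<longrightarrow> C \<le> u x"
  proof
    fix S assume "S \<in> F'"
    then obtain y r where S: "S = ball y r" "0 < r" "cball y r \<subseteq> \<Omega>" using F'(1) by (auto simp: F_def)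
    show "\<exists>C>0. AE x in lborel. x \<in> S \<longrightarrow> C \<le> u x" unfolding S(1) by (rule lower_ball[OF S(2,3)])
  qed
  then obtain C where C: "\<And>S. S \<in> F' \<Longrightarrow> 0 < C S" "\<And>S. S \<in> F' \<Longrightarrow> AE x in lborel. x \<in> S \<longrightarrow> C S \<le> u x"
    by metis
  define c where "c = Min (insert 1 (C ` F'))"
  have c: "0 < c" "\<And>S. S \<in> F' \<Longrightarrow> c \<le> C S"
    using F'(2) C(1) by (auto simp: c_def)
  have "AE x in lborel. \<forall>S\<in>F'. x \<in> S \<longrightarrow> C S \<le> u x"
    unfolding AE_ball_countable[OF countable_finite[OF F'(2)]] using C(2) by blast
  then have "AE x in lborel. x \<in> K \<longrightarrow> c \<le> u x"
  proof eventually_elim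
    case (elim x)
    then show ?case using F'(3) c(2) by (meson UnionE order_trans subsetD)
  qed
  with c(1) show ?thesis by blast
qed

lemma u_pos: "AE x in lborel. x \<in> \<Omega> \<longrightarrow> 0 < u x"
proof -
  obtain K :: "nat \<Rightarrow> 'a set" where K: "\<And>n. compact (K n)" "\<And>n. K n \<subseteq> \<Omega>" "\<Union>(range K) = \<Omega>"
    using open_Union_compact_subsets[OF \<Omega>_open] by metis
  have "AE x in lborel. \<forall>n. x \<in> K n \<longrightarrow> 0 < u x"
    unfolding AE_all_countable
  proof
    fix n
    obtain C where "0 < C" "AE x in lborel. x \<in> K n \<longrightarrow> C \<le> u x" using lower_compact[OF K(1,2)] by blast
    then show "AE x in lborel. x \<in> K n \<longrightarrow> 0 < u x" by (auto elim!: eventually_mono)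
  qed
  then show ?thesis by eventually_elim (use K(3) in blast)
qed

text \<open>On the compact support of \<phi> the solution is bounded away from 0, and off the
  support the integrand vanishes, so a multiple of w is a majorant.\<close>

lemma test_integrable:
  assumes \<phi>: "\<phi> \<in> Cc_smooth \<Omega>"
  shows "integrable lborel (\<lambda>x. w x * \<phi> x / u x powr \<alpha>)"
proof -
  have [measurable]: "\<phi> \<in> borel_measurable borel" using Cc_smooth_measurable[OF p \<phi>] by simp
  obtain B where B: "\<And>x. \<bar>\<phi> x\<bar> \<le> B" using Cc_smooth_bounded[OF \<phi>] by blast
  let ?K = "closure {x. \<phi> x \<noteq> 0}"
  obtain C where C: "0 < C" "AE x in lborel. x \<in> ?K \<longrightarrow> C \<le> u x"
    using lower_compact[of ?K] \<phi> by (auto simp: Cc_smooth_def)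
  have B0: "0 \<le> B" using order_trans[OF abs_ge_zero B] .
  show ?thesis
  proof (rule Bochner_Integration.integrable_bound[of lborel "\<lambda>x. B / C powr \<alpha> * w x"])
    show "AE x in lborel. norm (w x * \<phi> x / u x powr \<alpha>) \<le> norm (B / C powr \<alpha> * w x)"
      using C(2)
    proof eventually_elim
      case (elim x)
      show ?case
      proof (cases "\<phi> x = 0")
        case False
        then have "x \<in> ?K" using closure_subset[of "{x. \<phi> x \<noteq> 0}"] by auto
        then have "C powr \<alpha> \<le> u x powr \<alpha>" using elim C \<alpha> by (intro powr_mono2) auto
        moreover have "0 < C powr \<alpha>" using C by simp
        ultimately have "\<bar>\<phi> x\<bar> / u x powr \<alpha> \<le> B / C powr \<alpha>" using B0 B by (intro frac_le) auto
        then have "w x * (\<bar>\<phi> x\<bar> / u x powr \<alpha>) \<le> w x * (B / C powr \<alpha>)" using w_nonneg by (intro mult_left_mono)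
        then show ?thesis using w_nonneg B0 by (simp add: abs_mult mult.commute)
      qed (use B0 w_nonneg in simp)
    qed
  qed (use w_int in auto)
qed

text \<open>The p-th power of the denominator of the quotient is split as p = (p - 2) + 1 + 1 over
  the three factors; on the diagonal everything is 0.\<close>

lemma pairing_diff_quot:
  "pairing s p u v = (\<integral>z. \<bar>diff_quot s p u z\<bar> powr (p - 2) * diff_quot s p u z * diff_quot s p v z \<partial>lborel2)"
  unfolding pairing_def
proof (intro Bochner_Integration.integral_cong refl, clarify)
  fix x y :: 'a
  show "\<bar>u x - u y\<bar> powr (p - 2) * (u x - u y) * (v x - v y) / norm (x - y) powr (real DIM('a) + s * p) =
    \<bar>diff_quot s p u (x, y)\<bar> powr (p - 2) * diff_quot s p u (x, y) * diff_quot s p v (x, y)"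
  proof (cases "x = y")
    case False
    define n where "n = norm (x - y) powr ((real DIM('a) + s * p) / p)"
    have n: "0 < n" using False by (simp add: n_def)
    have "norm (x - y) powr (real DIM('a) + s * p) = n powr p" using p by (simp add: n_def powr_powr)
    also have "\<dots> = n powr (p - 2) * n * n"
      using n by (simp add: powr_diff powr_numeral power2_eq_square)
    finally show ?thesis using n by (simp add: diff_quot_def n_def[symmetric] powr_divide)
  qed (simp add: diff_quot_def)
qed

lemma pairing_bound:
  assumes "v \<in> Wsp s p"
  shows "\<bar>pairing s p u v\<bar> \<le> snorm u powr (p - 1) * snorm v"
  using Lp_pairing(2)[OF p Wsp_diff_quot[OF p uW] Wsp_diff_quot[OF p assms]]
  by (simp add: pairing_diff_quot Wsp_gagliardo[OF p uW] Wsp_gagliardo[OF p assms])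

lemma pairing_diff:
  assumes "v \<in> Wsp s p" "v' \<in> Wsp s p"
  shows "pairing s p u (\<lambda>x. v x - v' x) = pairing s p u v - pairing s p u v'"
  using Lp_pairing(1)[OF p Wsp_diff_quot[OF p uW] Wsp_diff_quot[OF p assms(1)]]
    Lp_pairing(1)[OF p Wsp_diff_quot[OF p uW] Wsp_diff_quot[OF p assms(2)]]
  by (simp add: pairing_diff_quot diff_quot_diff right_diff_distrib)

lemma pairing_self: "pairing s p u u = snorm u powr p"
proof -
  have "\<bar>t\<bar> powr (p - 2) * t * t = \<bar>t\<bar> powr p" for t :: real
  proof (cases "t = 0")
    case False
    then show ?thesis
      by (simp add: powr_diff powr_numeral power2_eq_square)
  qed (use p in simp)
  then show ?thesis by (simp add: pairing_diff_quot gagliardo_powr[OF p uW])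
qed

text \<open>
  Smooth nonnegative test functions approximating \<open>\<bar>v\<bar>\<close> with hardly larger seminorm
  turn the equation into a bound for the singular integral, by Fatou's lemma.
\<close>

lemma singular_bound:
  assumes v: "v \<in> W0"
  shows "integrable lborel (\<lambda>x. w x * \<bar>v x\<bar> / u x powr \<alpha>)"
    and "(\<integral>x. w x * \<bar>v x\<bar> / u x powr \<alpha> \<partial>lborel) \<le> snorm u powr (p - 1) * snorm v"
proof -
  have vW: "v \<in> Wsp s p" using v by (rule W0sp_imp_Wsp)
  have [measurable]: "v \<in> borel_measurable borel" using Wsp_measurable[OF vW] by simp
  obtain \<psi> where \<psi>C: "\<And>n. \<psi> n \<in> Cc_smooth \<Omega>" and \<psi>W: "\<And>n. \<psi> n \<in> Wsp s p"
    and \<psi>0: "\<And>n x. 0 \<le> \<psi> n x" and \<psi>g: "\<And>n. snorm (\<psi> n) \<le> snorm v + (1 / 2) ^ n"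
    and lim: "AE x in lborel. (\<lambda>n. \<psi> n x) \<longlonglongrightarrow> \<bar>v x\<bar>"
    by (rule W0sp_soft_abs_approximation[OF p v]) (rule that; assumption)
  have [measurable]: "\<psi> n \<in> borel_measurable borel" for n using Cc_smooth_measurable[OF p \<psi>C] by simp
  define G where "G = snorm u powr (p - 1)"
  have G: "0 \<le> G" by (simp add: G_def)
  have int: "(\<integral>x. w x * \<psi> n x / u x powr \<alpha> \<partial>lborel) \<le> G * (snorm v + (1 / 2) ^ n)" for n
  proof -
    have "(\<integral>x. w x * \<psi> n x / u x powr \<alpha> \<partial>lborel) \<le> G * snorm (\<psi> n)"
      using pairing_bound[OF \<psi>W[of n]] by (simp add: weak_eq[OF \<psi>C] G_def)
    also note \<psi>g[of n]
    finally show ?thesis using G by (simp add: mult_left_mono)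
  qed
  have "(\<integral>\<^sup>+x. ennreal (w x * \<bar>v x\<bar> / u x powr \<alpha>) \<partial>lborel) \<le> ennreal (G * (snorm v + 0))"
  proof (rule nn_integral_Fatou_le)
    show "AE x in lborel. (\<lambda>n. ennreal (w x * \<psi> n x / u x powr \<alpha>)) \<longlonglongrightarrow> ennreal (w x * \<bar>v x\<bar> / u x powr \<alpha>)"
      using lim unfolding divide_inverse
      by eventually_elim (intro tendsto_ennrealI tendsto_mult_right tendsto_mult_left)
    show "eventually (\<lambda>n. (\<integral>\<^sup>+x. ennreal (w x * \<psi> n x / u x powr \<alpha>) \<partial>lborel) \<le> ennreal (G * (snorm v + (1 / 2) ^ n))) sequentially"
      using int w_nonneg \<psi>0
      by (simp add: nn_integral_eq_integral[OF test_integrable[OF \<psi>C]] ennreal_leI)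
    show "(\<lambda>n. ennreal (G * (snorm v + (1 / 2) ^ n))) \<longlonglongrightarrow> ennreal (G * (snorm v + 0))"
      by (intro tendsto_ennrealI tendsto_intros LIMSEQ_power_zero) auto
  qed simp
  then have *: "(\<integral>\<^sup>+x. ennreal (w x * \<bar>v x\<bar> / u x powr \<alpha>) \<partial>lborel) \<le> ennreal (G * snorm v)"
    by simp
  then show i: "integrable lborel (\<lambda>x. w x * \<bar>v x\<bar> / u x powr \<alpha>)"
    using w_nonneg by (intro integrableI_bounded) (auto intro: le_less_trans)
  show "(\<integral>x. w x * \<bar>v x\<bar> / u x powr \<alpha> \<partial>lborel) \<le> snorm u powr (p - 1) * snorm v"
    using * G w_nonneg gagliardo_nonneg[of s p v] by (simp add: nn_integral_eq_integral[OF i] G_def)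
qed

lemma singular_integrable:
  assumes v: "v \<in> W0"
  shows "integrable lborel (\<lambda>x. w x * v x / u x powr \<alpha>)"
proof -
  have [measurable]: "v \<in> borel_measurable borel" using Wsp_measurable[OF W0sp_imp_Wsp[OF v]] by simp
  show ?thesis
    by (rule Bochner_Integration.integrable_bound[OF singular_bound(1)[OF v]]) (simp_all add: abs_mult)
qed

text \<open>u is not a test function, but both sides of the equation are continuous along its
  approximants: the pairing by Hoelder's inequality, the singular integral by
  \<open>singular_bound\<close> applied to the differences. So the equation may be tested with
  u.\<close>

lemma energy_identity: "moment (1 - \<alpha>) u = snorm u powr p"
  and energy_integrable: "moment_finite (1 - \<alpha>) u"
proof -
  obtain \<phi> where \<phi>: "\<And>n. \<phi> n \<in> Cc_smooth \<Omega>" "\<And>n. \<phi> n \<in> Wsp s p"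
    "\<And>n. snorm (\<lambda>x. u x - \<phi> n x) \<le> (1 / 2) ^ n"
    "\<And>n. Lp_norm p lborel (\<lambda>x. u x - \<phi> n x) \<le> (1 / 2) ^ n"
    "AE x in lborel. (\<lambda>n. \<phi> n x) \<longlonglongrightarrow> u x"
    by (rule W0sp_fast_approximation[OF p u]) (rule that; assumption)
  define G where "G = snorm u powr (p - 1)"
  have G: "0 \<le> G" by (simp add: G_def)
  let ?I = "\<lambda>v. \<integral>x. w x * v x / u x powr \<alpha> \<partial>lborel"
  have "\<bar>pairing s p u u - ?I u\<bar> \<le> 2 * G * (1 / 2) ^ n" for n
  proof -
    have d: "(\<lambda>x. u x - \<phi> n x) \<in> W0"
      using W0sp_diff[OF p u Cc_smooth_W0sp[OF p \<phi>(1,2)]] .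
    have 1: "\<bar>pairing s p u u - pairing s p u (\<phi> n)\<bar> \<le> G * (1 / 2) ^ n"
    proof -
      have "\<bar>pairing s p u u - pairing s p u (\<phi> n)\<bar> \<le> G * snorm (\<lambda>x. u x - \<phi> n x)"
        using pairing_bound[OF W0sp_imp_Wsp[OF d]] by (simp add: pairing_diff[OF uW \<phi>(2)] G_def)
      also have "\<dots> \<le> G * (1 / 2) ^ n" by (intro mult_left_mono \<phi> G)
      finally show ?thesis .
    qed
    have 2: "\<bar>?I u - ?I (\<phi> n)\<bar> \<le> G * (1 / 2) ^ n"
    proof -
      have "?I u - ?I (\<phi> n) = ?I (\<lambda>x. u x - \<phi> n x)"
        using singular_integrable[OF u] test_integrable[OF \<phi>(1)[of n]]
        by (simp add: right_diff_distrib diff_divide_distrib)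
      then have "\<bar>?I u - ?I (\<phi> n)\<bar> \<le> (\<integral>x. norm (w x * (u x - \<phi> n x) / u x powr \<alpha>) \<partial>lborel)"
        using integral_norm_bound[of lborel "\<lambda>x. w x * (u x - \<phi> n x) / u x powr \<alpha>"] by simp
      also have "\<dots> = ?I (\<lambda>x. \<bar>u x - \<phi> n x\<bar>)" using w_nonneg by (simp add: abs_mult)
      also have "\<dots> \<le> G * snorm (\<lambda>x. u x - \<phi> n x)" using singular_bound(2)[OF d] by (simp add: G_def)
      also have "\<dots> \<le> G * (1 / 2) ^ n" by (intro mult_left_mono \<phi> G)
      finally show ?thesis .
    qed
    show ?thesis using 1 2 weak_eq[OF \<phi>(1)[of n]] by linarith
  qed
  moreover have "(\<lambda>n. 2 * G * (1 / 2) ^ n) \<longlonglongrightarrow> 2 * G * 0"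
    by (intro tendsto_intros LIMSEQ_power_zero) simp
  ultimately have "\<bar>pairing s p u u - ?I u\<bar> \<le> 2 * G * 0"
    by (intro LIMSEQ_le_const[of _ _ "\<bar>pairing s p u u - ?I u\<bar>"]) auto
  then have eq: "?I u = snorm u powr p" by (simp add: pairing_self)
  have AE: "AE x in lborel. w x * u x / u x powr \<alpha> = w x * \<bar>u x\<bar> powr (1 - \<alpha>)"
    using u_pos by eventually_elim (use w_outside in \<open>force simp: powr_diff\<close>)
  have "?I u = moment (1 - \<alpha>) u"
    by (rule integral_cong_AE[OF _ _ AE]) auto
  then show "moment (1 - \<alpha>) u = snorm u powr p" using eq by simp
  show "moment_finite (1 - \<alpha>) u"
    by (rule integrable_cong_AE_imp[OF singular_integrable[OF u]]) (use AE in \<open>auto elim: eventually_mono\<close>)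
qed

lemma gagliardo_u_pos: "0 < snorm u"
proof (rule ccontr)
  assume "\<not> 0 < snorm u"
  then have "snorm u = 0" using gagliardo_nonneg[of s p u] by simp
  then have "moment (1 - \<alpha>) u = 0" using energy_identity by simp
  then have "AE x in lborel. w x * \<bar>u x\<bar> powr (1 - \<alpha>) = 0"
    using energy_integrable w_nonneg by (subst (asm) integral_nonneg_eq_0_iff_AE) auto
  then have "AE x in lborel. w x = 0"
    using u_pos by eventually_elim (use w_outside in force)
  with w_nonzero show False by simp
qed

text \<open>
  Hoelder's inequality is applied to the factorization
  \<open>\<bar>v\<bar>\<^bsup>1-\<alpha>\<^esup> = (\<bar>v\<bar> u\<^bsup>-\<alpha>\<^esup>)\<^bsup>1-\<alpha>\<^esup> (u\<^bsup>1-\<alpha>\<^esup>)\<^bsup>\<alpha>\<^esup>\<close>.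
\<close>

lemma sublinear_bound:
  assumes v: "v \<in> W0"
  shows "moment_finite (1 - \<alpha>) v"
    and "moment (1 - \<alpha>) v \<le>
      snorm u powr (p - (1 - \<alpha>)) * snorm v powr (1 - \<alpha>)"
proof -
  have [measurable]: "v \<in> borel_measurable borel" using Wsp_measurable[OF W0sp_imp_Wsp[OF v]] by simp
  define f where "f x = w x * \<bar>v x\<bar> / u x powr \<alpha>" for x
  define g where "g x = w x * \<bar>u x\<bar> powr (1 - \<alpha>)" for x
  have q: "0 < 1 - \<alpha>" "1 - \<alpha> < 1" using \<alpha> by auto
  have fg: "integrable lborel f" "integrable lborel g" "\<And>x. 0 \<le> f x" "\<And>x. 0 \<le> g x"
    unfolding f_def g_def using singular_bound(1)[OF v] energy_integrable w_nonneg by auto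
  have [measurable]: "f \<in> borel_measurable lborel" "g \<in> borel_measurable lborel" using fg by auto
  note H = Holder_geometric[OF q fg(1) fg(3) fg(2) fg(4)]
  have AE: "AE x in lborel. f x powr (1 - \<alpha>) * g x powr (1 - (1 - \<alpha>)) = w x * \<bar>v x\<bar> powr (1 - \<alpha>)"
    using u_pos
  proof eventually_elim
    case (elim x)
    show ?case
    proof (cases "w x = 0")
      case False
      then have pos: "0 < u x" "0 < w x" using elim w_outside w_nonneg[of x] by (auto simp: less_le)
      have "f x powr (1 - \<alpha>) * g x powr (1 - (1 - \<alpha>)) =
        (w x powr (1 - \<alpha>) * w x powr \<alpha>) * \<bar>v x\<bar> powr (1 - \<alpha>) * (u x powr ((1 - \<alpha>) * \<alpha>) / u x powr (\<alpha> * (1 - \<alpha>)))"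
        using pos by (simp add: f_def g_def powr_mult powr_divide powr_powr)
      also have "\<dots> = w x * \<bar>v x\<bar> powr (1 - \<alpha>)"
        using pos by (simp add: powr_add[symmetric] mult.commute)
      finally show ?thesis .
    qed (simp add: f_def g_def)
  qed
  show "moment_finite (1 - \<alpha>) v"
    by (rule integrable_cong_AE_imp[OF H(1)]) (use AE in \<open>auto elim: eventually_mono\<close>)
  have "moment (1 - \<alpha>) v = (\<integral>x. f x powr (1 - \<alpha>) * g x powr (1 - (1 - \<alpha>)) \<partial>lborel)"
    by (rule integral_cong_AE) (use AE in \<open>auto elim: eventually_mono\<close>)
  also note H(2)
  also have "(\<integral>x. f x \<partial>lborel) powr (1 - \<alpha>) * (\<integral>x. g x \<partial>lborel) powr (1 - (1 - \<alpha>)) \<le>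
     (snorm u powr (p - 1) * snorm v) powr (1 - \<alpha>) * (snorm u powr p) powr \<alpha>"
    using q singular_bound(2)[OF v] fg
    by (intro mult_mono powr_mono2) (auto simp: f_def[symmetric] g_def[symmetric] energy_identity[folded g_def])
  also have "\<dots> = snorm u powr ((p - 1) * (1 - \<alpha>) + p * \<alpha>) * snorm v powr (1 - \<alpha>)"
    by (simp add: powr_mult powr_powr powr_add gagliardo_nonneg)
  also have "(p - 1) * (1 - \<alpha>) + p * \<alpha> = p - (1 - \<alpha>)" by (simp add: algebra_simps)
  finally show "moment (1 - \<alpha>) v \<le>
      snorm u powr (p - (1 - \<alpha>)) * snorm v powr (1 - \<alpha>)" .
qed

text \<open>The moment is homogeneous of degree 1 - \<alpha> and equals
  \<open>snorm u powr p\<close> at u, so this factor raises it to \<open>mass\<close>. The function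
  agrees with \<open>V_normalized\<close> once the moment there is rewritten by the energy
  identity.\<close>

definition V :: "'a \<Rightarrow> real" where
  "V x = (mass / snorm u powr p) powr (1 / (1 - \<alpha>)) * u x"

lemma V_W0sp: "V \<in> W0"
  unfolding V_def by (rule W0sp_cmult[OF p u])

lemma V_nonneg: "AE x in lborel. 0 \<le> V x"
  using u_pos W0sp_outside[OF p u] by eventually_elim (auto simp: V_def)

lemma gagliardo_V: "snorm V = (mass / snorm u powr p) powr (1 / (1 - \<alpha>)) * snorm u"
  unfolding V_def by (simp add: gagliardo_cmult[OF p uW])

lemma gagliardo_V_pos: "0 < snorm V"
  using mass_pos gagliardo_u_pos by (simp add: gagliardo_V)

lemma V_constraint: "moment (1 - \<alpha>) V = mass"
proof -
  have "w x * \<bar>V x\<bar> powr (1 - \<alpha>) = (mass / snorm u powr p) * (w x * \<bar>u x\<bar> powr (1 - \<alpha>))" for x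
    using \<alpha> mass_pos by (simp add: V_def abs_mult powr_mult powr_powr)
  then show ?thesis using gagliardo_u_pos by (simp add: energy_identity)
qed

text \<open>The sublinear bound with its constant expressed through V. Being homogeneous in v, it
  needs no constraint on v; applied to differences it later bounds their moments by their seminorms,
  in place of an embedding.\<close>

lemma V_extremal:
  assumes v: "v \<in> W0"
  shows "moment (1 - \<alpha>) v * snorm V powr (1 - \<alpha>) \<le> mass * snorm v powr (1 - \<alpha>)"
proof -
  let ?g = "snorm u"
  have q: "0 < 1 - \<alpha>" using \<alpha> by simp
  have "snorm V powr (1 - \<alpha>) = mass / ?g powr p * ?g powr (1 - \<alpha>)"
    using mass_pos q by (simp add: gagliardo_V powr_mult powr_powr gagliardo_nonneg)
  also have "\<dots> = mass / ?g powr (p - (1 - \<alpha>))"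
    using gagliardo_u_pos by (simp add: powr_diff)
  finally have V: "snorm V powr (1 - \<alpha>) = mass / ?g powr (p - (1 - \<alpha>))" .
  have "moment (1 - \<alpha>) v * snorm V powr (1 - \<alpha>) \<le>
     (?g powr (p - (1 - \<alpha>)) * snorm v powr (1 - \<alpha>)) * (mass / ?g powr (p - (1 - \<alpha>)))"
    unfolding V using mass_pos by (intro mult_right_mono sublinear_bound(2)[OF v]) auto
  also have "\<dots> = mass * snorm v powr (1 - \<alpha>)" using gagliardo_u_pos by simp
  finally show ?thesis .
qed

text \<open>Translates the hypothesis on \<mu> into convergence of the energies of the V's. The
  infimum is attained at U, which is V rescaled to moment 1.\<close>

lemma minimum_value:
  "Inf {snorm v powr p | v. v \<in> W0 \<and> moment (1 - \<alpha>) v = 1} *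
     mass powr (p / (1 - \<alpha>)) = snorm V powr p"
proof -
  have q: "0 < 1 - \<alpha>" using \<alpha> by simp
  define U where "U x = mass powr (- 1 / (1 - \<alpha>)) * V x" for x
  have U: "U \<in> W0" unfolding U_def by (rule W0sp_cmult[OF p V_W0sp])
  have gU: "snorm U powr p = snorm V powr p / mass powr (p / (1 - \<alpha>))"
    unfolding U_def gagliardo_cmult[OF p W0sp_imp_Wsp[OF V_W0sp]] using mass_pos p
    by (simp add: powr_mult powr_powr gagliardo_nonneg powr_minus_divide powr_divide minus_divide_left[symmetric])
  have "w x * \<bar>U x\<bar> powr (1 - \<alpha>) = (w x * \<bar>V x\<bar> powr (1 - \<alpha>)) / mass" for x
    using mass_pos q by (simp add: U_def abs_mult powr_mult powr_powr powr_minus_divide powr_divide)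
  then have cU: "moment (1 - \<alpha>) U = 1"
    using V_constraint mass_pos by simp
  have le: "snorm U powr p \<le> snorm v powr p"
    if "v \<in> W0" "moment (1 - \<alpha>) v = 1" for v
  proof -
    have "snorm V powr (1 - \<alpha>) \<le> mass * snorm v powr (1 - \<alpha>)"
      using V_extremal[OF that(1)] that(2) by simp
    then have "(snorm V powr (1 - \<alpha>)) powr (p / (1 - \<alpha>)) \<le> (mass * snorm v powr (1 - \<alpha>)) powr (p / (1 - \<alpha>))"
      using p q by (intro powr_mono2) auto
    then have "snorm V powr p \<le> mass powr (p / (1 - \<alpha>)) * snorm v powr p"
      using q mass_pos by (simp add: powr_mult powr_powr)
    then show ?thesis unfolding gU using mass_pos by (simp add: field_simps)
  qed
  have "Inf {snorm v powr p | v. v \<in> W0 \<and> moment (1 - \<alpha>) v = 1}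
     = snorm U powr p"
    by (rule cInf_eq_minimum) (use U cU le in auto)
  then show ?thesis using gU mass_pos by simp
qed

end

section \<open>Logarithmic integrals\<close>

lemma ln_le_powr:
  fixes q t :: real
  assumes "0 < q" "0 \<le> t"
  shows "q * ln t \<le> t powr q"
proof (cases "t = 0")
  case False
  then have "ln (t powr q) \<le> t powr q - 1" using assms by (intro ln_le_minus_one) simp
  then show ?thesis using False assms by (simp add: ln_powr)
qed (use assms in simp)

text \<open>For t > 0, the difference quotient at 0 of the map sending q to \<open>t powr q\<close>,
  with limit \<open>ln t\<close>. At t = 0 and q > 0 it is -1/q.\<close>

definition powr_slope :: "real \<Rightarrow> real \<Rightarrow> real" where
  "powr_slope q t = (t powr q - 1) / q"

lemma powr_slope_mono:
  assumes "0 < q" "q \<le> q'" "0 \<le> t"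
  shows "powr_slope q t \<le> powr_slope q' t"
proof -
  \<comment> \<open>Bernoulli's inequality with exponent \<open>q' / q\<close>, at least 1, and base
    \<open>t powr q\<close> compares the two slopes.\<close>
  have "1 + (q' / q) * (t powr q - 1) \<le> (t powr q) powr (q' / q)"
    using assms by (intro powr_Bernoulli) auto
  then have "q' * ((t powr q - 1) / q) \<le> t powr q' - 1" using assms by (simp add: powr_powr)
  then show ?thesis using assms by (simp add: powr_slope_def pos_le_divide_eq mult.commute)
qed

lemma powr_slope_tendsto:
  assumes "q \<longlonglongrightarrow> 0" "\<And>n. 0 < q n" "0 < t"
  shows "(\<lambda>n. powr_slope (q n) t) \<longlonglongrightarrow> ln t"
proof -
  have "((\<lambda>q. t powr q) has_real_derivative ln t * t powr 0) (at 0)"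
    using assms(3) by (auto intro!: derivative_eq_intros)
  then have "((\<lambda>h. (t powr (0 + h) - t powr 0) / h) \<longlongrightarrow> ln t * t powr 0) (at 0)"
    by (simp only: DERIV_def)
  then have lim: "((\<lambda>h. powr_slope h t) \<longlongrightarrow> ln t) (at 0)"
    using assms(3) by (simp add: powr_slope_def[abs_def])
  have "filterlim q (at 0) sequentially"
    using assms by (intro filterlim_atI) (auto simp: less_imp_neq[symmetric])
  from filterlim_compose[OF lim this] show ?thesis .
qed

lemma ln_le_powr_slope: "0 < q \<Longrightarrow> 0 < t \<Longrightarrow> ln t \<le> powr_slope q t"
  using ln_le_minus_one[of "t powr q"] by (simp add: powr_slope_def ln_powr pos_le_divide_eq mult.commute)

context weighted_problem
begin

text \<open>Since \<open>ln 0 = 0\<close>, integrability alone does not notice zeros of v; the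
  second condition excludes them where the weight is positive, because there the extended integrand
  is -\<infinity>.\<close>

definition log_finite :: "('a \<Rightarrow> real) \<Rightarrow> bool" where
  "log_finite v \<longleftrightarrow> integrable lborel (\<lambda>x. w x * ln \<bar>v x\<bar>) \<and> (AE x in lborel. w x \<noteq> 0 \<longrightarrow> v x \<noteq> 0)"

definition log_int :: "('a \<Rightarrow> real) \<Rightarrow> real" where
  "log_int v = (\<integral>x. w x * ln \<bar>v x\<bar> \<partial>lborel)"

text \<open>A finite moment bounds the positive part through q ln t \<le> t^q. Hence -\<infinity> is
  the only value besides the finite ones, and the real-valued \<open>log_int\<close> suffices from
  here on.\<close>

lemma log_integral_eq:
  assumes v [measurable]: "v \<in> borel_measurable borel" and q: "0 < q"
    and int: "moment_finite q v"
  shows "log_integral \<Omega> w v = (if log_finite v then ereal (log_int v) else - \<infinity>)"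
proof -
  define P where "P x = w x * max 0 (ln \<bar>v x\<bar>)" for x
  define N where "N x = w x * max 0 (- ln \<bar>v x\<bar>)" for x
  have [measurable]: "P \<in> borel_measurable borel" "N \<in> borel_measurable borel"
    unfolding P_def N_def by measurable
  have nonneg: "0 \<le> P x" "0 \<le> N x" for x using w_nonneg by (auto simp: P_def N_def)
  have max_mult: "ennreal (w x * t) = ennreal (w x * max 0 t)" for x t
    using w_nonneg[of x] by (cases "0 \<le> t") (auto simp: max_def ennreal_neg mult_nonneg_nonpos)
  have pos: "e2ennreal (ln_ext \<bar>v x\<bar> * ereal (w x)) * indicator \<Omega> x = ennreal (P x)" for x
  proof (cases "w x = 0 \<or> v x = 0")
    case True
    then show ?thesis
      using w_nonneg[of x] by (auto simp: P_def ln_ext_def zero_ereal_def[symmetric] less_le e2ennreal_neg)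
  next
    case False
    then have "x \<in> \<Omega>" using w_outside by blast
    then show ?thesis using False
      by (simp add: ln_ext_def P_def max_mult[symmetric] mult.commute ennreal_def[symmetric] e2ennreal_ereal)
  qed
  have neg: "e2ennreal (- (ln_ext \<bar>v x\<bar> * ereal (w x))) * indicator \<Omega> x =
      (if w x \<noteq> 0 \<and> v x = 0 then \<infinity> else ennreal (N x))" for x
  proof (cases "w x = 0")
    case True
    then show ?thesis by (simp add: N_def zero_ereal_def[symmetric] e2ennreal_neg)
  next
    case False
    then have x: "x \<in> \<Omega>" "0 < w x" using w_outside w_nonneg[of x] by (auto simp: less_le)
    show ?thesis
    proof (cases "v x = 0")
      case True
      then show ?thesis using x by (simp add: ln_ext_def)
    next
      case False
      then show ?thesis using x
        by (simp add: ln_ext_def N_def max_mult[symmetric] e2ennreal_ereal mult.commute)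
    qed
  qed
  have Pint: "integrable lborel P"
  proof (rule Bochner_Integration.integrable_bound[of lborel "\<lambda>x. (w x * \<bar>v x\<bar> powr q) / q"])
    show "AE x in lborel. norm (P x) \<le> norm ((w x * \<bar>v x\<bar> powr q) / q)"
    proof (rule AE_I2)
      fix x
      have "max 0 (ln \<bar>v x\<bar>) \<le> \<bar>v x\<bar> powr q / q"
        using ln_le_powr[OF q, of "\<bar>v x\<bar>"] q by (simp add: pos_le_divide_eq mult.commute)
      then have "P x \<le> w x * (\<bar>v x\<bar> powr q / q)" unfolding P_def using w_nonneg by (intro mult_left_mono)
      then show "norm (P x) \<le> norm ((w x * \<bar>v x\<bar> powr q) / q)" using nonneg(1)[of x] by (simp del: norm_divide norm_mult abs_divide)
    qed
  qed (use int in auto)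
  have L: "log_integral \<Omega> w v = enn2ereal (ennreal (integral\<^sup>L lborel P)) -
      enn2ereal (\<integral>\<^sup>+x. (if w x \<noteq> 0 \<and> v x = 0 then \<infinity> else ennreal (N x)) \<partial>lborel)"
    unfolding log_integral_def pos neg nn_integral_eq_integral[OF Pint AE_I2[OF nonneg(1)]] ..
  have P0: "0 \<le> integral\<^sup>L lborel P" using nonneg by simp
  show ?thesis
  proof (cases "log_finite v")
    case True
    then have i: "integrable lborel (\<lambda>x. w x * ln \<bar>v x\<bar>)" and nz: "AE x in lborel. w x \<noteq> 0 \<longrightarrow> v x \<noteq> 0"
      by (auto simp: log_finite_def)
    have eq: "N x = P x - w x * ln \<bar>v x\<bar>" for x
      using w_nonneg[of x] by (auto simp: P_def N_def max_def)
    have Nint: "integrable lborel N" unfolding eq using i Pint by simp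
    have "(\<integral>\<^sup>+x. (if w x \<noteq> 0 \<and> v x = 0 then \<infinity> else ennreal (N x)) \<partial>lborel) = (\<integral>\<^sup>+x. ennreal (N x) \<partial>lborel)"
      by (rule nn_integral_cong_AE) (use nz in eventually_elim, auto)
    also have "\<dots> = ennreal (integral\<^sup>L lborel N)"
      by (rule nn_integral_eq_integral[OF Nint AE_I2[OF nonneg(2)]])
    finally have "log_integral \<Omega> w v = ereal (integral\<^sup>L lborel P) - ereal (integral\<^sup>L lborel N)"
      using L P0 nonneg by (simp add: enn2ereal_ennreal)
    also have "integral\<^sup>L lborel N = integral\<^sup>L lborel P - log_int v"
      using i Pint by (simp add: eq[abs_def] log_int_def)
    finally show ?thesis using True by simp
  next
    case False
    have "(\<integral>\<^sup>+x. (if w x \<noteq> 0 \<and> v x = 0 then \<infinity> else ennreal (N x)) \<partial>lborel) = \<infinity>"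
    proof (rule ccontr)
      assume fin: "(\<integral>\<^sup>+x. (if w x \<noteq> 0 \<and> v x = 0 then \<infinity> else ennreal (N x)) \<partial>lborel) \<noteq> \<infinity>"
      have "AE x in lborel. (if w x \<noteq> 0 \<and> v x = 0 then \<infinity> else ennreal (N x)) \<noteq> \<infinity>"
        by (rule nn_integral_PInf_AE[OF _ fin]) measurable
      then have nz: "AE x in lborel. w x \<noteq> 0 \<longrightarrow> v x \<noteq> 0" by eventually_elim auto
      have "(\<integral>\<^sup>+x. ennreal (N x) \<partial>lborel) \<le> (\<integral>\<^sup>+x. (if w x \<noteq> 0 \<and> v x = 0 then \<infinity> else ennreal (N x)) \<partial>lborel)"
        by (rule nn_integral_mono) auto
      then have "(\<integral>\<^sup>+x. ennreal (N x) \<partial>lborel) < \<infinity>" using fin by (auto simp: less_top top_unique)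
      then have "integrable lborel N" using nonneg by (intro integrableI_nonneg) auto
      then have "integrable lborel (\<lambda>x. P x - N x)" using Pint by simp
      moreover have "P x - N x = w x * ln \<bar>v x\<bar>" for x
        using w_nonneg[of x] by (auto simp: P_def N_def max_def)
      ultimately show False using nz False by (simp add: log_finite_def)
    qed
    then show ?thesis using L False P0 by (simp add: enn2ereal_ennreal)
  qed
qed

text \<open>Jensen's inequality, obtained from \<open>ln t \<le> t - 1\<close>.\<close>

lemma log_int_le:
  assumes v: "log_finite v" and q: "0 < q" and int: "moment_finite q v"
  shows "exp (q * log_int v / mass) \<le> moment q v / mass"
proof -
  \<comment> \<open>The weighted mean of the q-th powers. With this scaling the integral of
    \<open>\<bar>v x\<bar> powr q / c - 1\<close> against the weight is 0, so only ln c
    survives.\<close>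
  define c where "c = moment q v / mass"
  have nz: "AE x in lborel. w x \<noteq> 0 \<longrightarrow> v x \<noteq> 0" and i: "integrable lborel (\<lambda>x. w x * ln \<bar>v x\<bar>)"
    using v by (auto simp: log_finite_def)
  have I: "moment q v \<noteq> 0"
  proof
    assume "moment q v = 0"
    then have "AE x in lborel. w x * \<bar>v x\<bar> powr q = 0"
      using int w_nonneg by (subst (asm) integral_nonneg_eq_0_iff_AE) auto
    with nz have "AE x in lborel. w x = 0" by eventually_elim auto
    with w_nonzero show False by simp
  qed
  have "0 \<le> moment q v" using w_nonneg by simp
  with I have c: "0 < c" using mass_pos by (simp add: c_def)
  have "(\<integral>x. q * (w x * ln \<bar>v x\<bar>) \<partial>lborel) \<le> (\<integral>x. (w x * \<bar>v x\<bar> powr q) / c + (ln c - 1) * w x \<partial>lborel)"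
  proof (rule integral_mono_AE)
    show "AE x in lborel. q * (w x * ln \<bar>v x\<bar>) \<le> (w x * \<bar>v x\<bar> powr q) / c + (ln c - 1) * w x"
      using nz
    proof eventually_elim
      case (elim x)
      show ?case
      proof (cases "w x = 0")
        case False
        then have "v x \<noteq> 0" using elim by simp
        then have "ln (\<bar>v x\<bar> powr q / c) \<le> \<bar>v x\<bar> powr q / c - 1" using c by (intro ln_le_minus_one) simp
        then have "q * ln \<bar>v x\<bar> \<le> \<bar>v x\<bar> powr q / c + (ln c - 1)"
          using \<open>v x \<noteq> 0\<close> c by (simp add: ln_div ln_powr)
        from mult_left_mono[OF this w_nonneg[of x]] show ?thesis by (simp add: algebra_simps)
      qed simp
    qed
  qed (use i int w_int in auto)
  then have "q * log_int v \<le> moment q v / c + (ln c - 1) * mass"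
    using i int w_int by (simp add: log_int_def mass_def)
  also have "moment q v / c = mass" using I mass_pos by (simp add: c_def)
  finally have "q * log_int v \<le> ln c * mass" by (simp add: algebra_simps)
  then have "q * log_int v / mass \<le> ln c" using mass_pos by (simp add: pos_divide_le_eq)
  then have "exp (q * log_int v / mass) \<le> exp (ln c)" by simp
  also have "exp (ln c) = c" using c by simp
  finally show ?thesis by (simp add: c_def)
qed

text \<open>
  The slopes \<open>(t\<^sup>q - 1) / q\<close> decrease to \<open>ln t\<close> as \<open>q\<close> tends to \<open>0\<close>, also for
  \<open>t = 0\<close>, where the limit is \<open>-\<infinity>\<close>; so Fatou's lemma applies.
\<close>

lemma log_int_nonnegI:
  assumes v [measurable]: "v \<in> borel_measurable borel"
    and q: "q \<longlonglongrightarrow> 0" "\<And>n. 0 < q n" "\<And>n. q n \<le> q0"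
    and int0: "moment_finite q0 v"
    and int: "\<And>n. moment_finite (q n) v"
    and le: "\<And>n. mass \<le> moment (q n) v"
  shows "log_finite v" "0 \<le> log_int v"
proof -
  have q0: "0 < q0" using q(2,3)[of 0] by simp
  have [measurable]: "(\<lambda>x. powr_slope r \<bar>v x\<bar>) \<in> borel_measurable borel" for r
    unfolding powr_slope_def by measurable
  have slope_eq: "w x * powr_slope r \<bar>v x\<bar> = (w x * \<bar>v x\<bar> powr r - w x) / r" for x r
    by (simp add: powr_slope_def right_diff_distrib)
  have i0: "integrable lborel (\<lambda>x. w x * powr_slope q0 \<bar>v x\<bar>)"
    unfolding slope_eq using int0 w_int by simp
  have i: "integrable lborel (\<lambda>x. w x * powr_slope (q n) \<bar>v x\<bar>)" for n
    unfolding slope_eq using int w_int by simp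
  have nn: "0 \<le> (\<integral>x. w x * powr_slope (q n) \<bar>v x\<bar> \<partial>lborel)" for n
    unfolding slope_eq using int[of n] w_int le[of n] q(2)[of n] by (simp add: mass_def)
  \<comment> \<open>Subtracting from the slope at the largest exponent q0 makes the integrands f
    nonnegative. Their integrals are at most A because the slopes at q n have nonnegative integrals,
    which is the hypothesis on the moments.\<close>
  define A where "A = (\<integral>x. w x * powr_slope q0 \<bar>v x\<bar> \<partial>lborel)"
  define f where "f n x = w x * (powr_slope q0 \<bar>v x\<bar> - powr_slope (q n) \<bar>v x\<bar>)" for n x
  define g where "g x = w x * (powr_slope q0 \<bar>v x\<bar> - ln \<bar>v x\<bar>)" for x
  have [measurable]: "f n \<in> borel_measurable borel" "g \<in> borel_measurable borel" for n
    unfolding f_def g_def by measurable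
  have f0: "0 \<le> f n x" for n x
    unfolding f_def using w_nonneg powr_slope_mono[OF q(2) q(3)] by simp
  have fint: "integrable lborel (f n)" for n
    unfolding f_def right_diff_distrib using i0 i by simp
  have f_le: "(\<integral>\<^sup>+x. ennreal (f n x) \<partial>lborel) \<le> ennreal A" for n
  proof -
    have "(\<integral>x. f n x \<partial>lborel) \<le> A"
      unfolding f_def right_diff_distrib using i0 i nn[of n] by (simp add: A_def)
    then show ?thesis using f0 by (simp add: nn_integral_eq_integral[OF fint] ennreal_leI)
  qed
  \<comment> \<open>The true limit is infinite at zeros of v with positive weight, whereas g would
    use \<open>ln 0 = 0\<close>. Finiteness of the integral of this corrected limit shows that such
    zeros form a null set.\<close>
  let ?G = "\<lambda>x. if w x \<noteq> 0 \<and> v x = 0 then \<infinity> else ennreal (g x)"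
  have lim: "(\<lambda>n. ennreal (f n x)) \<longlonglongrightarrow> ?G x" for x
  proof (cases "w x = 0 \<or> v x \<noteq> 0")
    case True
    have "(\<lambda>n. f n x) \<longlonglongrightarrow> g x"
    proof (cases "w x = 0")
      case False
      then have "0 < \<bar>v x\<bar>" using True by simp
      then show ?thesis unfolding f_def g_def by (intro tendsto_intros powr_slope_tendsto q)
    qed (simp add: f_def g_def)
    then show ?thesis using True by (auto intro: tendsto_ennrealI)
  next
    case False
    then have x: "0 < w x" "v x = 0" using w_nonneg[of x] by (auto simp: less_le)
    have "filterlim (\<lambda>n. inverse (q n)) at_top sequentially"
      using q by (intro filterlim_inverse_at_top) auto
    then have "filterlim (\<lambda>n. - w x / q0 + w x * inverse (q n)) at_top sequentially"
      using x by (intro filterlim_tendsto_add_at_top[OF tendsto_const]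
          filterlim_tendsto_pos_mult_at_top[OF tendsto_const])
    moreover have "f n x = - w x / q0 + w x * inverse (q n)" for n
      using x by (simp add: f_def powr_slope_def divide_inverse algebra_simps)
    ultimately have "(\<lambda>n. ennreal (f n x)) \<longlonglongrightarrow> top"
      by (simp add: ennreal_tendsto_top_eq_at_top)
    then show ?thesis using x by simp
  qed
  have G: "(\<integral>\<^sup>+x. ?G x \<partial>lborel) \<le> ennreal A"
    by (rule nn_integral_Fatou_le[OF _ AE_I2[OF lim] _ tendsto_const]) (auto intro: always_eventually f_le)
  then have "(\<integral>\<^sup>+x. ?G x \<partial>lborel) \<noteq> \<infinity>" by (auto simp: top_unique)
  from nn_integral_PInf_AE[OF _ this] have nz: "AE x in lborel. w x \<noteq> 0 \<longrightarrow> v x \<noteq> 0"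
    by (auto elim!: eventually_mono split: if_splits)
  have g0: "AE x in lborel. 0 \<le> g x"
    using nz
  proof eventually_elim
    case (elim x)
    then show ?case using w_nonneg[of x] ln_le_powr_slope[OF q0, of "\<bar>v x\<bar>"]
      by (cases "w x = 0") (auto simp: g_def)
  qed
  have "(\<integral>\<^sup>+x. ennreal (g x) \<partial>lborel) \<le> (\<integral>\<^sup>+x. ?G x \<partial>lborel)"
    by (rule nn_integral_mono) auto
  with G have g_le: "(\<integral>\<^sup>+x. ennreal (g x) \<partial>lborel) \<le> ennreal A" by simp
  then have gint: "integrable lborel g"
    using g0 by (intro integrableI_nonneg) (auto intro: le_less_trans)
  have "integrable lborel (\<lambda>x. w x * powr_slope q0 \<bar>v x\<bar> - g x)" using i0 gint by simp
  then have li: "integrable lborel (\<lambda>x. w x * ln \<bar>v x\<bar>)" by (simp add: g_def right_diff_distrib)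
  then show "log_finite v" using nz by (simp add: log_finite_def)
  have A0: "0 \<le> A"
    using fint[of 0] nn[of 0] i0 i[of 0] Bochner_Integration.integral_nonneg[of lborel "f 0"] f0
    unfolding f_def right_diff_distrib by (simp add: A_def)
  have "(\<integral>x. g x \<partial>lborel) \<le> A"
    using g_le A0 g0 by (simp add: nn_integral_eq_integral[OF gint])
  then show "0 \<le> log_int v"
    using i0 li unfolding g_def right_diff_distrib by (simp add: A_def log_int_def)
qed

text \<open>The inequality of arithmetic and geometric means bounds the logarithm of the midpoint
  from below by an integrable function, and the finite moment bounds it from above.\<close>

lemma log_finite_midpoint:
  assumes a: "log_finite a" "a \<in> borel_measurable borel" "AE x in lborel. 0 \<le> a x"
    and b: "log_finite b" "b \<in> borel_measurable borel" "AE x in lborel. 0 \<le> b x"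
    and q: "0 < q" and int: "moment_finite q (\<lambda>x. (a x + b x) / 2)"
  shows "log_finite (\<lambda>x. (a x + b x) / 2)" "(log_int a + log_int b) / 2 \<le> log_int (\<lambda>x. (a x + b x) / 2)"
proof -
  have [measurable]: "a \<in> borel_measurable borel" "b \<in> borel_measurable borel" by fact+
  have ia: "integrable lborel (\<lambda>x. w x * ln \<bar>a x\<bar>)" and ib: "integrable lborel (\<lambda>x. w x * ln \<bar>b x\<bar>)"
    using a b by (auto simp: log_finite_def)
  have pos: "AE x in lborel. w x \<noteq> 0 \<longrightarrow> 0 < a x \<and> 0 < b x"
    using a(3) b(3) a(1)[unfolded log_finite_def, THEN conjunct2] b(1)[unfolded log_finite_def, THEN conjunct2]
    by eventually_elim auto
  have low: "AE x in lborel. (w x * ln \<bar>a x\<bar> + w x * ln \<bar>b x\<bar>) / 2 \<le> w x * ln \<bar>(a x + b x) / 2\<bar>"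
    using pos
  proof eventually_elim
    case (elim x)
    show ?case
    proof (cases "w x = 0")
      case False
      then have ab: "0 < a x" "0 < b x" using elim by auto
      have "ln (a x) + ln (b x) = ln (a x * b x)" using ab by (simp add: ln_mult)
      also have "\<dots> \<le> ln (((a x + b x) / 2)\<^sup>2)"
      proof (subst ln_le_cancel_iff)
        have "0 \<le> (a x - b x)\<^sup>2" by simp
        then show "a x * b x \<le> ((a x + b x) / 2)\<^sup>2" by (simp add: power2_eq_square field_simps)
      qed (use ab in auto)
      also have "\<dots> = 2 * ln ((a x + b x) / 2)" using ab by (simp add: ln_realpow)
      finally have "(ln \<bar>a x\<bar> + ln \<bar>b x\<bar>) / 2 \<le> ln \<bar>(a x + b x) / 2\<bar>" using ab by simp
      from mult_left_mono[OF this w_nonneg[of x]] show ?thesis by (simp add: distrib_left)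
    qed simp
  qed
  have up: "w x * ln \<bar>(a x + b x) / 2\<bar> \<le> (w x * \<bar>(a x + b x) / 2\<bar> powr q) / q" for x
  proof -
    have "ln \<bar>(a x + b x) / 2\<bar> \<le> \<bar>(a x + b x) / 2\<bar> powr q / q"
      using ln_le_powr[OF q, of "\<bar>(a x + b x) / 2\<bar>"] q by (simp add: pos_le_divide_eq mult.commute)
    from mult_left_mono[OF this w_nonneg[of x]] show ?thesis by simp
  qed
  have i: "integrable lborel (\<lambda>x. w x * ln \<bar>(a x + b x) / 2\<bar>)"
  proof (rule Bochner_Integration.integrable_bound)
    show "integrable lborel (\<lambda>x. \<bar>(w x * ln \<bar>a x\<bar> + w x * ln \<bar>b x\<bar>) / 2\<bar> + \<bar>(w x * \<bar>(a x + b x) / 2\<bar> powr q) / q\<bar>)"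
      using ia ib int by (intro Bochner_Integration.integrable_add integrable_abs integrable_divide) auto
    show "AE x in lborel. norm (w x * ln \<bar>(a x + b x) / 2\<bar>) \<le>
       norm (\<bar>(w x * ln \<bar>a x\<bar> + w x * ln \<bar>b x\<bar>) / 2\<bar> + \<bar>(w x * \<bar>(a x + b x) / 2\<bar> powr q) / q\<bar>)"
      using low
    proof eventually_elim
      case (elim x)
      then show ?case using up[of x] unfolding real_norm_def by linarith
    qed
  qed simp
  have "AE x in lborel. w x \<noteq> 0 \<longrightarrow> (a x + b x) / 2 \<noteq> 0" using pos by eventually_elim auto
  then show "log_finite (\<lambda>x. (a x + b x) / 2)" using i by (simp add: log_finite_def)
  have "(\<integral>x. (w x * ln \<bar>a x\<bar> + w x * ln \<bar>b x\<bar>) / 2 \<partial>lborel) \<le> (\<integral>x. w x * ln \<bar>(a x + b x) / 2\<bar> \<partial>lborel)"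
    using ia ib i low by (intro integral_mono_AE) auto
  then show "(log_int a + log_int b) / 2 \<le> log_int (\<lambda>x. (a x + b x) / 2)"
    using ia ib by (simp add: log_int_def)
qed

lemma log_cmult:
  assumes k: "k \<noteq> 0" and v: "log_finite v" and [measurable]: "v \<in> borel_measurable borel"
  shows "log_finite (\<lambda>x. k * v x)" "log_int (\<lambda>x. k * v x) = mass * ln \<bar>k\<bar> + log_int v"
proof -
  have i: "integrable lborel (\<lambda>x. w x * ln \<bar>v x\<bar>)" and nz: "AE x in lborel. w x \<noteq> 0 \<longrightarrow> v x \<noteq> 0"
    using v by (auto simp: log_finite_def)
  have AE: "AE x in lborel. w x * ln \<bar>v x\<bar> + ln \<bar>k\<bar> * w x = w x * ln \<bar>k * v x\<bar>"
    using nz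
  proof eventually_elim
    case (elim x)
    then show ?case using k by (cases "w x = 0") (auto simp: abs_mult ln_mult algebra_simps)
  qed
  have i': "integrable lborel (\<lambda>x. w x * ln \<bar>v x\<bar> + ln \<bar>k\<bar> * w x)" using i w_int by simp
  have ik: "integrable lborel (\<lambda>x. w x * ln \<bar>k * v x\<bar>)"
    by (rule integrable_cong_AE_imp[OF i']) (use AE in \<open>auto elim: eventually_mono\<close>)
  have "AE x in lborel. w x \<noteq> 0 \<longrightarrow> k * v x \<noteq> 0" using nz by eventually_elim (use k in auto)
  with ik show "log_finite (\<lambda>x. k * v x)" by (simp add: log_finite_def)
  have "log_int (\<lambda>x. k * v x) = (\<integral>x. w x * ln \<bar>v x\<bar> + ln \<bar>k\<bar> * w x \<partial>lborel)"
    unfolding log_int_def by (rule integral_cong_AE[symmetric]) (use AE in auto)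
  then show "log_int (\<lambda>x. k * v x) = mass * ln \<bar>k\<bar> + log_int v"
    using i w_int by (simp add: log_int_def mass_def mult.commute)
qed

lemma log_cong_AE:
  assumes eq: "AE x in lborel. w x \<noteq> 0 \<longrightarrow> \<bar>v x\<bar> = \<bar>v' x\<bar>"
    and [measurable]: "v \<in> borel_measurable borel" "v' \<in> borel_measurable borel"
  shows "log_finite v \<longleftrightarrow> log_finite v'" "log_int v = log_int v'"
proof -
  have AE: "AE x in lborel. w x * ln \<bar>v x\<bar> = w x * ln \<bar>v' x\<bar>"
    using eq by eventually_elim auto
  have "integrable lborel (\<lambda>x. w x * ln \<bar>v x\<bar>) \<longleftrightarrow> integrable lborel (\<lambda>x. w x * ln \<bar>v' x\<bar>)"
    by (rule integrable_cong_AE) (use AE in auto)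
  moreover have "(AE x in lborel. w x \<noteq> 0 \<longrightarrow> v x \<noteq> 0) \<longleftrightarrow> (AE x in lborel. w x \<noteq> 0 \<longrightarrow> v' x \<noteq> 0)"
  proof
    assume "AE x in lborel. w x \<noteq> 0 \<longrightarrow> v x \<noteq> 0"
    with eq show "AE x in lborel. w x \<noteq> 0 \<longrightarrow> v' x \<noteq> 0" by eventually_elim auto
  next
    assume "AE x in lborel. w x \<noteq> 0 \<longrightarrow> v' x \<noteq> 0"
    with eq show "AE x in lborel. w x \<noteq> 0 \<longrightarrow> v x \<noteq> 0" by eventually_elim auto
  qed
  ultimately show "log_finite v \<longleftrightarrow> log_finite v'" by (simp add: log_finite_def)
  show "log_int v = log_int v'" unfolding log_int_def by (rule integral_cong_AE) (use AE in auto)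
qed


end

section \<open>The limit of the extremals\<close>

text \<open>Write z^q as z times z^(q-1), whose second factor is decreasing. The inequality replaces
  the triangle inequality for moments of order at most 1.\<close>

lemma powr_add_le_add_powr:
  fixes x y q :: real
  assumes "0 < q" "q \<le> 1" "0 \<le> x" "0 \<le> y"
  shows "(x + y) powr q \<le> x powr q + y powr q"
proof (cases "x = 0 \<or> y = 0")
  case False
  then have xy: "0 < x" "0 < y" using assms by auto
  have split: "z powr q = z * z powr (q - 1)" if "0 < z" for z :: real
    using that by (simp add: powr_diff)
  have "(x + y) powr q = x * (x + y) powr (q - 1) + y * (x + y) powr (q - 1)"
    using xy by (subst split) (auto simp: distrib_right)
  also have "\<dots> \<le> x * x powr (q - 1) + y * y powr (q - 1)"
    using xy assms by (intro add_mono mult_left_mono powr_mono2') auto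
  finally show ?thesis using xy by (simp add: split[symmetric])
qed (use assms in auto)

text \<open>What the passage to the limit uses of the solutions: no further reference is made to the
  equation, only to extremality, the constraint and convergence of the energies.\<close>

locale extremal_family = weighted_problem +
  fixes \<alpha>\<^sub>0 \<mu> :: real and V :: "real \<Rightarrow> 'a \<Rightarrow> real"
  assumes \<alpha>\<^sub>0: "0 < \<alpha>\<^sub>0" "\<alpha>\<^sub>0 < 1"
    and V_W0sp: "\<alpha>\<^sub>0 \<le> \<alpha> \<Longrightarrow> \<alpha> < 1 \<Longrightarrow> V \<alpha> \<in> W0"
    and V_nonneg: "\<alpha>\<^sub>0 \<le> \<alpha> \<Longrightarrow> \<alpha> < 1 \<Longrightarrow> AE x in lborel. 0 \<le> V \<alpha> x"
    and W0sp_sublinear: "\<alpha>\<^sub>0 \<le> \<alpha> \<Longrightarrow> \<alpha> < 1 \<Longrightarrow> v \<in> W0 \<Longrightarrow>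
      moment_finite (1 - \<alpha>) v"
    and V_constraint: "\<alpha>\<^sub>0 \<le> \<alpha> \<Longrightarrow> \<alpha> < 1 \<Longrightarrow> moment (1 - \<alpha>) (V \<alpha>) = mass"
    and V_extremal: "\<alpha>\<^sub>0 \<le> \<alpha> \<Longrightarrow> \<alpha> < 1 \<Longrightarrow> v \<in> W0 \<Longrightarrow>
      moment (1 - \<alpha>) v * snorm (V \<alpha>) powr (1 - \<alpha>) \<le>
        mass * snorm v powr (1 - \<alpha>)"
    and gagliardo_V_pos: "\<alpha>\<^sub>0 \<le> \<alpha> \<Longrightarrow> \<alpha> < 1 \<Longrightarrow> 0 < snorm (V \<alpha>)"
    and \<mu>: "((\<lambda>\<alpha>. snorm (V \<alpha>) powr p) \<longlongrightarrow> \<mu>) (at_left 1)"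
begin

lemma W0sp_borel: "v \<in> W0 \<Longrightarrow> v \<in> borel_measurable borel"
  using Wsp_measurable[OF W0sp_imp_Wsp] by simp

lemma eventually_range: "eventually (\<lambda>\<alpha>. \<alpha>\<^sub>0 \<le> \<alpha> \<and> \<alpha> < 1) (at_left 1)"
  using eventually_at_left_real[OF \<alpha>\<^sub>0(2)] by eventually_elim auto

lemma gagliardo_V_le:
  assumes \<alpha>: "\<alpha>\<^sub>0 \<le> \<alpha>" "\<alpha> < 1" and v: "v \<in> W0"
    and le: "mass \<le> moment (1 - \<alpha>) v"
  shows "snorm (V \<alpha>) \<le> snorm v"
proof (rule ccontr)
  assume "\<not> ?thesis"
  then have "snorm v powr (1 - \<alpha>) < snorm (V \<alpha>) powr (1 - \<alpha>)"
    using \<alpha> gagliardo_nonneg by (intro powr_less_mono2) auto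
  then have "mass * snorm v powr (1 - \<alpha>) < mass * snorm (V \<alpha>) powr (1 - \<alpha>)"
    using mass_pos by simp
  also have "\<dots> \<le> moment (1 - \<alpha>) v * snorm (V \<alpha>) powr (1 - \<alpha>)"
    using le by (intro mult_right_mono) auto
  finally show False using V_extremal[OF \<alpha> v] by simp
qed

lemma V_mass_le:
  assumes "\<alpha>\<^sub>0 \<le> \<alpha>" "\<alpha> \<le> \<beta>" "\<beta> < 1"
  shows "mass \<le> moment (1 - \<alpha>) (V \<beta>)"
proof -
  \<comment> \<open>The ratio of the two moment orders. Bernoulli's inequality with exponent e plays
    the part of Jensen's: its linear term integrates to 0 because the moment of V \<beta> of order 1
    - \<beta> is \<open>mass\<close>.\<close>
  define e where "e = (1 - \<alpha>) / (1 - \<beta>)"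
  have e: "1 \<le> e" using assms by (simp add: e_def)
  have V: "V \<beta> \<in> W0" using assms by (intro V_W0sp) auto
  have i: "moment_finite (1 - \<alpha>) (V \<beta>)" "moment_finite (1 - \<beta>) (V \<beta>)"
    using assms by (auto intro!: W0sp_sublinear[OF _ _ V])
  have "(\<integral>x. (1 - e) * w x + e * (w x * \<bar>V \<beta> x\<bar> powr (1 - \<beta>)) \<partial>lborel) \<le> moment (1 - \<alpha>) (V \<beta>)"
  proof (rule integral_mono)
    fix x
    have "1 + e * (\<bar>V \<beta> x\<bar> powr (1 - \<beta>) - 1) \<le> (\<bar>V \<beta> x\<bar> powr (1 - \<beta>)) powr e"
      using e by (intro powr_Bernoulli) auto
    also have "\<dots> = \<bar>V \<beta> x\<bar> powr (1 - \<alpha>)" using assms by (simp add: powr_powr e_def)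
    finally have "w x * (1 + e * (\<bar>V \<beta> x\<bar> powr (1 - \<beta>) - 1)) \<le> w x * \<bar>V \<beta> x\<bar> powr (1 - \<alpha>)"
      using w_nonneg by (intro mult_left_mono)
    then show "(1 - e) * w x + e * (w x * \<bar>V \<beta> x\<bar> powr (1 - \<beta>)) \<le> w x * \<bar>V \<beta> x\<bar> powr (1 - \<alpha>)"
      by (simp add: algebra_simps)
  qed (use i w_int in auto)
  moreover have "(\<integral>x. (1 - e) * w x + e * (w x * \<bar>V \<beta> x\<bar> powr (1 - \<beta>)) \<partial>lborel) = mass"
    using i w_int assms V_constraint[of \<beta>] by (simp add: mass_def[symmetric] algebra_simps)
  ultimately show ?thesis by simp
qed

lemma gagliardo_V_mono:
  "\<alpha>\<^sub>0 \<le> \<alpha> \<Longrightarrow> \<alpha> \<le> \<beta> \<Longrightarrow> \<beta> < 1 \<Longrightarrow> snorm (V \<alpha>) \<le> snorm (V \<beta>)"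
  by (intro gagliardo_V_le V_W0sp V_mass_le) auto

lemma gagliardo_V_le_\<mu>:
  assumes "\<alpha>\<^sub>0 \<le> \<alpha>" "\<alpha> < 1"
  shows "snorm (V \<alpha>) powr p \<le> \<mu>"
proof (rule tendsto_lowerbound[OF \<mu>])
  show "eventually (\<lambda>\<beta>. snorm (V \<alpha>) powr p \<le> snorm (V \<beta>) powr p) (at_left 1)"
    using eventually_at_left_real[OF assms(2)]
    by eventually_elim (use assms p gagliardo_nonneg in \<open>auto intro!: powr_mono2 gagliardo_V_mono\<close>)
qed simp

lemma \<mu>_pos: "0 < \<mu>"
proof -
  have "0 < snorm (V \<alpha>\<^sub>0) powr p" using gagliardo_V_pos[of \<alpha>\<^sub>0] \<alpha>\<^sub>0 by simp
  also have "\<dots> \<le> \<mu>" using gagliardo_V_le_\<mu>[of \<alpha>\<^sub>0] \<alpha>\<^sub>0 by simp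
  finally show ?thesis .
qed

text \<open>Concavity of \<open>t\<^bsup>1-\<alpha>\<^esup>\<close> makes the midpoint admissible for the smaller exponent.\<close>

lemma gagliardo_V_midpoint:
  assumes "\<alpha>\<^sub>0 \<le> \<alpha>" "\<alpha> \<le> \<beta>" "\<beta> < 1"
  shows "snorm (V \<alpha>) \<le> snorm (\<lambda>x. (V \<alpha> x + V \<beta> x) / 2)"
proof (rule gagliardo_V_le)
  have W: "V \<alpha> \<in> W0" "V \<beta> \<in> W0" using assms by (auto intro!: V_W0sp)
  show m: "(\<lambda>x. (V \<alpha> x + V \<beta> x) / 2) \<in> W0"
    using W0sp_cmult[OF p W0sp_add[OF p W], of "1 / 2"] by simp
  have \<alpha>1: "\<alpha> < 1" using assms by simp
  note i = W0sp_sublinear[OF assms(1) \<alpha>1 W(1)] W0sp_sublinear[OF assms(1) \<alpha>1 W(2)]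
  have "mass \<le> (\<integral>x. (w x * \<bar>V \<alpha> x\<bar> powr (1 - \<alpha>) + w x * \<bar>V \<beta> x\<bar> powr (1 - \<alpha>)) / 2 \<partial>lborel)"
    using i V_constraint[OF assms(1) \<alpha>1] V_mass_le[OF assms] by simp
  also have "\<dots> \<le> moment (1 - \<alpha>) (\<lambda>x. (V \<alpha> x + V \<beta> x) / 2)"
  proof (rule integral_mono_AE)
    show "AE x in lborel. (w x * \<bar>V \<alpha> x\<bar> powr (1 - \<alpha>) + w x * \<bar>V \<beta> x\<bar> powr (1 - \<alpha>)) / 2 \<le> w x * \<bar>(V \<alpha> x + V \<beta> x) / 2\<bar> powr (1 - \<alpha>)"
      using V_nonneg[OF assms(1) \<alpha>1] V_nonneg[of \<beta>, OF order_trans[OF assms(1,2)] assms(3)]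
    proof eventually_elim
      case (elim x)
      let ?a = "V \<alpha> x powr (1 - \<alpha>)" and ?b = "V \<beta> x powr (1 - \<alpha>)"
      have q: "0 < 1 - \<alpha>" "1 \<le> 1 / (1 - \<alpha>)" using assms \<alpha>\<^sub>0 by (auto simp: pos_le_divide_eq)
      \<comment> \<open>Concavity of the power 1 - \<alpha> is read off from convexity of the
        inverse power 1/(1 - \<alpha>), applied to the powers ?a and ?b.\<close>
      have "\<bar>(1/2) * ?a + (1/2) * ?b\<bar> powr (1 / (1 - \<alpha>)) \<le> (1/2) * \<bar>?a\<bar> powr (1 / (1 - \<alpha>)) + (1/2) * \<bar>?b\<bar> powr (1 / (1 - \<alpha>))"
        using q by (intro abs_powr_convex) auto
      also have "\<dots> = (V \<alpha> x + V \<beta> x) / 2" using q elim by (simp add: powr_powr)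
      finally have "(\<bar>(1/2) * ?a + (1/2) * ?b\<bar> powr (1 / (1 - \<alpha>))) powr (1 - \<alpha>) \<le> ((V \<alpha> x + V \<beta> x) / 2) powr (1 - \<alpha>)"
        using q by (intro powr_mono2) auto
      then have "(?a + ?b) / 2 \<le> ((V \<alpha> x + V \<beta> x) / 2) powr (1 - \<alpha>)"
        using q by (simp add: powr_powr abs_of_nonneg)
      from mult_left_mono[OF this w_nonneg[of x]] show ?case using elim by (simp add: distrib_left)
    qed
  qed (use i W0sp_sublinear[OF assms(1) \<alpha>1 m] in auto)
  finally show "mass \<le> moment (1 - \<alpha>) (\<lambda>x. (V \<alpha> x + V \<beta> x) / 2)" .
qed (use assms in auto)

lemma V_Cauchy:
  assumes e: "0 < e"
  obtains a where "\<alpha>\<^sub>0 \<le> a" "a < 1"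
    "\<And>\<alpha> \<beta>. a < \<alpha> \<Longrightarrow> \<alpha> < 1 \<Longrightarrow> a < \<beta> \<Longrightarrow> \<beta> < 1 \<Longrightarrow> snorm (\<lambda>x. V \<alpha> x - V \<beta> x) \<le> e"
proof -
  \<comment> \<open>Uniform convexity asks for membership at every index of the filter, while the
    family is controlled only on \<open>[\<alpha>\<^sub>0, 1)\<close>. Parameters outside this range
    are sent to \<open>\<alpha>\<^sub>0\<close>, which changes nothing near 1.\<close>
  define c where "c \<alpha> = (if \<alpha>\<^sub>0 \<le> \<alpha> \<and> \<alpha> < 1 then \<alpha> else \<alpha>\<^sub>0)" for \<alpha>
  have c: "\<alpha>\<^sub>0 \<le> c \<alpha>" "c \<alpha> < 1" for \<alpha> using \<alpha>\<^sub>0 by (auto simp: c_def)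
  have W: "V (c \<alpha>) \<in> Wsp s p" for \<alpha> using V_W0sp[OF c] by (rule W0sp_imp_Wsp)
  let ?P = "lborel2 :: ('a \<times> 'a) measure"
  let ?mid = "\<lambda>\<alpha> \<beta>. powr_integral p ?P (\<lambda>z. (diff_quot s p (V \<alpha>) z + diff_quot s p (V \<beta>) z) / 2)"
  let ?F = "at_left (1::real) \<times>\<^sub>F at_left 1"
  have mid: "eventually (\<lambda>i. \<mu> - e' \<le> ?mid (c (fst i)) (c (snd i))) ?F"
    if "0 < e'" for e'
    unfolding eventually_prod_same
  proof (intro exI[of _ "\<lambda>\<alpha>. (\<alpha>\<^sub>0 \<le> \<alpha> \<and> \<alpha> < 1) \<and> \<mu> - e' < snorm (V \<alpha>) powr p"] conjI allI impI)
    have "eventually (\<lambda>\<alpha>. (\<alpha>\<^sub>0 \<le> \<alpha> \<and> \<alpha> < 1) \<and> \<mu> - e' < snorm (V \<alpha>) powr p) (at_left 1)"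
      using that by (intro eventually_conj eventually_range order_tendstoD(1)[OF \<mu>]) simp
    then show "eventually (\<lambda>\<alpha>. (\<alpha>\<^sub>0 \<le> \<alpha> \<and> \<alpha> < 1) \<and> \<mu> - e' < snorm (V \<alpha>) powr p) (at_left 1)" .
    \<comment> \<open>The midpoint has at least the energy belonging to the smaller exponent, which
      on this neighbourhood is already within e' of \<mu>. The midpoint is symmetric, so the order
      of the two exponents does not matter later.\<close>
    have *: "\<mu> - e' \<le> ?mid \<alpha> \<beta>"
      if "\<alpha>\<^sub>0 \<le> \<alpha>" "\<alpha> \<le> \<beta>" "\<beta> < 1" "\<mu> - e' < snorm (V \<alpha>) powr p" for \<alpha> \<beta>
    proof -
      have m: "(\<lambda>x. (V \<alpha> x + V \<beta> x) / 2) \<in> Wsp s p"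
        using Wsp_cmult[OF p Wsp_add[OF p W0sp_imp_Wsp W0sp_imp_Wsp], of "V \<alpha>" \<Omega> s "V \<beta>" \<Omega> "1 / 2"] V_W0sp that by simp
      have "(\<lambda>x. (V \<alpha> x + V \<beta> x) / 2) = (\<lambda>x. (1 / 2) * (V \<alpha> x + V \<beta> x))" by simp
      then have "diff_quot s p (\<lambda>x. (V \<alpha> x + V \<beta> x) / 2) = (\<lambda>z. (diff_quot s p (V \<alpha>) z + diff_quot s p (V \<beta>) z) / 2)"
        by (simp only: diff_quot_cmult diff_quot_add) simp
      then have "?mid \<alpha> \<beta> = snorm (\<lambda>x. (V \<alpha> x + V \<beta> x) / 2) powr p"
        using gagliardo_powr[OF p m] by simp
      also have "\<dots> \<ge> snorm (V \<alpha>) powr p"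
        using p gagliardo_V_midpoint[OF that(1-3)] by (intro powr_mono2) (auto simp: gagliardo_nonneg)
      finally show ?thesis using that by simp
    qed
    fix \<alpha> \<beta>
    assume 1: "(\<alpha>\<^sub>0 \<le> \<alpha> \<and> \<alpha> < 1) \<and> \<mu> - e' < snorm (V \<alpha>) powr p"
      and 2: "(\<alpha>\<^sub>0 \<le> \<beta> \<and> \<beta> < 1) \<and> \<mu> - e' < snorm (V \<beta>) powr p"
    then have "c \<alpha> = \<alpha>" "c \<beta> = \<beta>" by (auto simp: c_def)
    moreover have "\<mu> - e' \<le> ?mid \<alpha> \<beta>"
      using 1 2 *[of \<alpha> \<beta>] *[of \<beta> \<alpha>] by (cases "\<alpha> \<le> \<beta>") (auto simp: add.commute)
    ultimately show "\<mu> - e' \<le> ?mid (c (fst (\<alpha>, \<beta>))) (c (snd (\<alpha>, \<beta>)))"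
      by simp
  qed
  have "((\<lambda>i. Lp_norm p ?P (\<lambda>z. diff_quot s p (V (c (fst i))) z - diff_quot s p (V (c (snd i))) z)) \<longlongrightarrow> 0) ?F"
    by (rule Lp_uniformly_convex[OF p Wsp_diff_quot[OF p W] Wsp_diff_quot[OF p W] _ _ mid])
      (auto simp: gagliardo_powr[OF p W, symmetric] intro: gagliardo_V_le_\<mu> c)
  from order_tendstoD(2)[OF this e]
  have "eventually (\<lambda>i. snorm (\<lambda>x. V (c (fst i)) x - V (c (snd i)) x) < e) ?F"
    by (simp add: Wsp_gagliardo[OF p Wsp_diff[OF p W W]] diff_quot_diff)
  then obtain Q where Q: "eventually Q (at_left (1::real))"
    "\<And>\<alpha> \<beta>. Q \<alpha> \<Longrightarrow> Q \<beta> \<Longrightarrow> snorm (\<lambda>x. V (c \<alpha>) x - V (c \<beta>) x) < e"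
    unfolding eventually_prod_same by auto
  from Q(1) obtain b where b: "b < 1" "\<And>\<alpha>. b < \<alpha> \<Longrightarrow> \<alpha> < 1 \<Longrightarrow> Q \<alpha>"
    unfolding eventually_at_left_field by auto
  show thesis
  proof (rule that[of "max b \<alpha>\<^sub>0"])
    fix \<alpha> \<beta> assume "max b \<alpha>\<^sub>0 < \<alpha>" "\<alpha> < 1" "max b \<alpha>\<^sub>0 < \<beta>" "\<beta> < 1"
    then show "snorm (\<lambda>x. V \<alpha> x - V \<beta> x) \<le> e"
      using Q(2)[OF b(2) b(2), of \<alpha> \<beta>] by (simp add: c_def less_imp_le)
  qed (use b \<alpha>\<^sub>0 in auto)
qed

text \<open>The logarithmic inequality is the limit of the sublinear ones, by Jensen's inequality.\<close>

lemma log_inequality: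
  assumes v: "v \<in> W0" and log: "log_finite v"
  shows "\<mu> * exp (p * log_int v / mass) \<le> snorm v powr p"
proof (rule tendsto_upperbound)
  show "((\<lambda>\<alpha>. snorm (V \<alpha>) powr p * exp (p * log_int v / mass)) \<longlongrightarrow> \<mu> * exp (p * log_int v / mass)) (at_left 1)"
    by (intro tendsto_mult_right \<mu>)
  show "eventually (\<lambda>\<alpha>. snorm (V \<alpha>) powr p * exp (p * log_int v / mass) \<le> snorm v powr p) (at_left 1)"
    using eventually_range
  proof eventually_elim
    case (elim \<alpha>)
    define q where "q = 1 - \<alpha>"
    have q: "0 < q" using elim by (simp add: q_def)
    have "exp (q * log_int v / mass) * snorm (V \<alpha>) powr q \<le>
        moment q v / mass * snorm (V \<alpha>) powr q"
      using elim q W0sp_sublinear[of \<alpha>, OF _ _ v] by (intro mult_right_mono log_int_le log) (auto simp: q_def)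
    also have "\<dots> \<le> snorm v powr q"
      using V_extremal[of \<alpha> v] v elim mass_pos by (simp add: q_def pos_divide_le_eq mult.commute)
    \<comment> \<open>Raising to the power p / q removes q from the exponential and from the
      seminorm of v, so that only the energy of V \<alpha> still depends on \<alpha>.\<close>
    finally have "(exp (q * log_int v / mass) * snorm (V \<alpha>) powr q) powr (p / q) \<le> (snorm v powr q) powr (p / q)"
      using p q by (intro powr_mono2) auto
    then show ?case using q by (simp add: powr_mult powr_powr exp_powr_real mult.commute)
  qed
qed simp

text \<open>A sequence of exponents serves only to produce the limit through completeness; the
  Cauchy property then gives convergence for the continuous parameter. A subsequence converging
  almost everywhere transfers nonnegativity.\<close>

theorem exists_log_minimizer:
  obtains V1 where "V1 \<in> W0" "AE x in lborel. 0 \<le> V1 x"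
    "((\<lambda>\<alpha>. snorm (\<lambda>x. V \<alpha> x - V1 x)) \<longlongrightarrow> 0) (at_left 1)"
    "snorm V1 powr p = \<mu>" "log_finite V1" "log_int V1 = 0"
proof -
  \<comment> \<open>The factor \<open>1 - \<alpha>\<^sub>0\<close> keeps the whole sequence in
    \<open>[\<alpha>\<^sub>0, 1)\<close>, so that \<open>1 - \<alpha>\<^sub>0\<close> can serve as
    the largest exponent in \<open>log_int_nonnegI\<close>.\<close>
  define a where "a n = 1 - (1 - \<alpha>\<^sub>0) * inverse (real (Suc n))" for n
  have a: "\<alpha>\<^sub>0 \<le> a n" "a n < 1" for n
  proof -
    have "inverse (real (Suc n)) \<le> 1" by (simp add: inverse_le_1_iff)
    then have "(1 - \<alpha>\<^sub>0) * inverse (real (Suc n)) \<le> (1 - \<alpha>\<^sub>0) * 1" using \<alpha>\<^sub>0 by (intro mult_left_mono) auto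
    moreover have "\<alpha>\<^sub>0 \<le> 1 - t" if "t \<le> (1 - \<alpha>\<^sub>0) * 1" for t using that by simp
    ultimately show "\<alpha>\<^sub>0 \<le> a n" unfolding a_def by blast
    show "a n < 1" using \<alpha>\<^sub>0 by (simp add: a_def)
  qed
  have "a \<longlonglongrightarrow> 1 - (1 - \<alpha>\<^sub>0) * 0"
    unfolding a_def by (intro tendsto_intros LIMSEQ_inverse_real_of_nat)
  then have a1: "a \<longlonglongrightarrow> 1" by simp
  then have a_left: "filterlim a (at_left 1) sequentially"
    using a by (intro tendsto_imp_filterlim_at_left) auto
  have a_large: "eventually (\<lambda>n. b < a n) sequentially" if "b < 1" for b
    using order_tendstoD(1)[OF a1 that] .
  have VW: "V (a n) \<in> W0" for n using a by (intro V_W0sp)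
  have Cauchy: "\<exists>N. \<forall>m\<ge>N. \<forall>n\<ge>N. snorm (\<lambda>x. V (a m) x - V (a n) x) \<le> e" if e: "0 < e" for e
  proof -
    obtain b where b: "b < 1" "\<And>\<alpha> \<beta>. b < \<alpha> \<Longrightarrow> \<alpha> < 1 \<Longrightarrow> b < \<beta> \<Longrightarrow> \<beta> < 1 \<Longrightarrow> snorm (\<lambda>x. V \<alpha> x - V \<beta> x) \<le> e"
      by (rule V_Cauchy[OF e]) (rule that; assumption)
    from a_large[OF b(1)] obtain N where "\<And>n. N \<le> n \<Longrightarrow> b < a n" by (auto simp: eventually_sequentially)
    then show ?thesis using b(2) a by blast
  qed
  obtain V1 r where V1: "V1 \<in> W0" "strict_mono r" "AE x in lborel. (\<lambda>n. V (a (r n)) x) \<longlonglongrightarrow> V1 x"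
    "(\<lambda>n. snorm (\<lambda>x. V (a n) x - V1 x)) \<longlonglongrightarrow> 0"
    by (rule W0sp_complete[of p s \<Omega> "\<lambda>n. V (a n)", OF p s \<Omega>_bounded VW Cauchy]) (assumption, (rule that; assumption))
  have V1W: "V1 \<in> Wsp s p" using V1(1) by (rule W0sp_imp_Wsp)
  have nonneg: "AE x in lborel. 0 \<le> V1 x"
  proof -
    have "AE x in lborel. \<forall>n. 0 \<le> V (a (r n)) x"
      unfolding AE_all_countable using V_nonneg[OF a] by blast
    with V1(3) show ?thesis
      by eventually_elim (auto intro: LIMSEQ_le_const)
  qed
  have conv: "((\<lambda>\<alpha>. snorm (\<lambda>x. V \<alpha> x - V1 x)) \<longlongrightarrow> 0) (at_left 1)"
  proof (rule order_tendstoI)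
    fix e :: real assume e: "0 < e"
    obtain b where b: "\<alpha>\<^sub>0 \<le> b" "b < 1" "\<And>\<alpha> \<beta>. b < \<alpha> \<Longrightarrow> \<alpha> < 1 \<Longrightarrow> b < \<beta> \<Longrightarrow> \<beta> < 1 \<Longrightarrow> snorm (\<lambda>x. V \<alpha> x - V \<beta> x) \<le> e / 2"
      by (rule V_Cauchy[OF half_gt_zero[OF e]]) (rule that; assumption)
    from eventually_conj[OF a_large[OF b(2)] order_tendstoD(2)[OF V1(4), of "e / 2"]] e
    obtain n where n: "b < a n" "snorm (\<lambda>x. V (a n) x - V1 x) < e / 2" by (auto simp: eventually_sequentially)
    show "eventually (\<lambda>\<alpha>. snorm (\<lambda>x. V \<alpha> x - V1 x) < e) (at_left 1)"
      using eventually_at_left_real[OF b(2)]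
    proof eventually_elim
      case (elim \<alpha>)
      then have W: "V \<alpha> \<in> Wsp s p" using b by (intro W0sp_imp_Wsp[OF V_W0sp]) auto
      have "snorm (\<lambda>x. V \<alpha> x - V1 x) \<le> snorm (\<lambda>x. V \<alpha> x - V (a n) x) + snorm (\<lambda>x. V (a n) x - V1 x)"
        using gagliardo_triangle[OF p Wsp_diff[OF p W W0sp_imp_Wsp[OF VW]] Wsp_diff[OF p W0sp_imp_Wsp[OF VW] V1W], of n n] by simp
      also have "snorm (\<lambda>x. V \<alpha> x - V (a n) x) \<le> e / 2" using elim n a by (intro b) auto
      finally show ?case using n by simp
    qed
  next
    fix e :: real assume "e < 0"
    then show "eventually (\<lambda>\<alpha>. e < snorm (\<lambda>x. V \<alpha> x - V1 x)) (at_left 1)"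
      using gagliardo_nonneg by (intro always_eventually allI) (rule order.strict_trans2)
  qed
  have energy: "snorm V1 powr p = \<mu>"
  proof (rule LIMSEQ_unique)
    have "(\<lambda>n. snorm (V (a n)) - snorm V1) \<longlonglongrightarrow> 0"
      by (rule tendsto_rabs_zero_cancel, rule tendsto_sandwich[OF _ _ tendsto_const V1(4)])
        (auto intro!: always_eventually gagliardo_triangle_diff[OF p W0sp_imp_Wsp[OF VW] V1W])
    then have "(\<lambda>n. snorm (V (a n))) \<longlonglongrightarrow> snorm V1" by (simp add: LIM_zero_iff)
    then show "(\<lambda>n. snorm (V (a n)) powr p) \<longlonglongrightarrow> snorm V1 powr p"
      using p by (intro tendsto_powr' tendsto_intros) (auto simp: gagliardo_nonneg)
    show "(\<lambda>n. snorm (V (a n)) powr p) \<longlonglongrightarrow> \<mu>"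
      by (rule filterlim_compose[OF \<mu> a_left])
  qed
  have mass_le: "mass \<le> moment (1 - \<alpha>) V1" if \<alpha>: "\<alpha>\<^sub>0 \<le> \<alpha>" "\<alpha> < 1" for \<alpha>
  proof -
    define q where "q = 1 - \<alpha>"
    have q: "0 < q" "q \<le> 1" using \<alpha> \<alpha>\<^sub>0 by (auto simp: q_def)
    \<comment> \<open>By extremality of V \<alpha> at the fixed exponent, ?K times the q-th power of
      the seminorm bounds the q-moment of every admissible function. The error
      \<open>V (a n) - V1\<close> therefore has vanishing q-moment, and subadditivity carries the
      lower bound over to V1.\<close>
    let ?K = "mass / snorm (V \<alpha>) powr q"
    have D: "(\<lambda>x. V (a n) x - V1 x) \<in> W0" for n by (rule W0sp_diff[OF p VW V1(1)])
    note i = W0sp_sublinear[OF \<alpha> VW, folded q_def] W0sp_sublinear[OF \<alpha> V1(1), folded q_def] W0sp_sublinear[OF \<alpha> D, folded q_def]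
    have "eventually (\<lambda>n. mass \<le> moment q V1 + ?K * snorm (\<lambda>x. V (a n) x - V1 x) powr q) sequentially"
      using a_large[OF \<alpha>(2)]
    proof eventually_elim
      case (elim n)
      have "mass \<le> moment q (V (a n))"
        unfolding q_def using elim \<alpha> a by (intro V_mass_le) auto
      also have "\<dots> \<le> (\<integral>x. w x * \<bar>V1 x\<bar> powr q + w x * \<bar>V (a n) x - V1 x\<bar> powr q \<partial>lborel)"
      proof (rule integral_mono)
        fix x
        have "\<bar>V (a n) x\<bar> powr q \<le> (\<bar>V1 x\<bar> + \<bar>V (a n) x - V1 x\<bar>) powr q"
          using q by (intro powr_mono2) auto
        also have "\<dots> \<le> \<bar>V1 x\<bar> powr q + \<bar>V (a n) x - V1 x\<bar> powr q"
          using q by (intro powr_add_le_add_powr) auto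
        finally have "w x * \<bar>V (a n) x\<bar> powr q \<le> w x * (\<bar>V1 x\<bar> powr q + \<bar>V (a n) x - V1 x\<bar> powr q)"
          using w_nonneg by (intro mult_left_mono)
        then show "w x * \<bar>V (a n) x\<bar> powr q \<le> w x * \<bar>V1 x\<bar> powr q + w x * \<bar>V (a n) x - V1 x\<bar> powr q"
          by (simp add: distrib_left)
      qed (use i in auto)
      also have "\<dots> = moment q V1 + moment q (\<lambda>x. V (a n) x - V1 x)"
        using i by simp
      also have "moment q (\<lambda>x. V (a n) x - V1 x) \<le> ?K * snorm (\<lambda>x. V (a n) x - V1 x) powr q"
        using V_extremal[OF \<alpha> D[of n], folded q_def] gagliardo_V_pos[OF \<alpha>] by (simp add: pos_le_divide_eq)
      finally show ?case by simp
    qed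
    moreover have "(\<lambda>n. moment q V1 + ?K * snorm (\<lambda>x. V (a n) x - V1 x) powr q) \<longlonglongrightarrow>
       moment q V1 + ?K * 0 powr q"
      using q by (intro tendsto_add tendsto_const tendsto_mult tendsto_powr' V1(4)) (auto simp: gagliardo_nonneg)
    ultimately have "mass \<le> moment q V1 + ?K * 0 powr q"
      by (intro tendsto_lowerbound) auto
    then show ?thesis by (simp add: q_def)
  qed
  have "(\<lambda>n. 1 - a n) \<longlonglongrightarrow> 1 - 1" by (intro tendsto_intros a1)
  then have log: "log_finite V1 \<and> 0 \<le> log_int V1"
    using log_int_nonnegI[OF W0sp_borel[OF V1(1)], of "\<lambda>n. 1 - a n" "1 - \<alpha>\<^sub>0"]
      a \<alpha>\<^sub>0 mass_le[OF a] W0sp_sublinear[OF a V1(1)] W0sp_sublinear[OF order_refl \<alpha>\<^sub>0(2) V1(1)] by auto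
  have "\<mu> * exp (p * log_int V1 / mass) \<le> \<mu>" using log_inequality[OF V1(1)] log energy by simp
  then have "exp (p * log_int V1 / mass) \<le> 1" using \<mu>_pos by simp
  then have "p * log_int V1 / mass \<le> 0" by simp
  then have "log_int V1 \<le> 0" using p mass_pos by (simp add: divide_le_0_iff mult_le_0_iff)
  then have "log_int V1 = 0" using log by simp
  with V1(1) nonneg conv energy log show thesis using that by blast
qed

text \<open>The midpoint argument needs nonnegative functions, so it is run on
  \<open>\<bar>v\<bar>\<close>, which has the same logarithmic integral and no larger seminorm and
  hence is minimal too. The resulting equality of the seminorms of v and
  \<open>\<bar>v\<bar>\<close> gives v a constant sign.\<close>

lemma log_minimizer_unique:
  assumes V1: "V1 \<in> W0" "AE x in lborel. 0 \<le> V1 x" "snorm V1 powr p = \<mu>" "log_finite V1" "log_int V1 = 0"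
    and v: "v \<in> W0" "snorm v powr p = \<mu>" "log_finite v" "log_int v = 0"
  shows "(AE x in lborel. v x = V1 x) \<or> (AE x in lborel. v x = - V1 x)"
proof -
  let ?a = "\<lambda>x. \<bar>v x\<bar>"
  have aW: "?a \<in> W0" by (rule W0sp_abs[OF p v(1)])
  note W = W0sp_imp_Wsp[OF aW] W0sp_imp_Wsp[OF V1(1)] W0sp_imp_Wsp[OF v(1)]
  have loga: "log_finite ?a" "log_int ?a = 0" using v by (auto simp: log_finite_def log_int_def)
  have root: "a = b" if "a powr p = b powr p" "0 \<le> a" "0 \<le> b" for a b :: real
    using that p powr_less_mono2[of p a b] powr_less_mono2[of p b a] by (cases a b rule: linorder_cases) auto
  have ge: "\<mu> \<le> snorm ?a powr p" using log_inequality[OF aW loga(1)] loga(2) by simp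
  have "snorm ?a powr p \<le> snorm v powr p"
    using p gagliardo_abs_le[OF p W(3)] by (intro powr_mono2) (auto simp: gagliardo_nonneg)
  with ge v(2) have ga: "snorm ?a powr p = \<mu>" by simp
  have "snorm ?a = snorm v" by (rule root) (simp_all add: ga v(2) gagliardo_nonneg)
  from gagliardo_abs_eq_imp_sign[OF p W(3) this]
  have sign: "(AE x in lborel. 0 \<le> v x) \<or> (AE x in lborel. v x \<le> 0)" .
  let ?m = "\<lambda>x. (\<bar>v x\<bar> + V1 x) / 2"
  have mW: "?m \<in> W0" using W0sp_cmult[OF p W0sp_add[OF p aW V1(1)], of "1 / 2"] by simp
  have q: "0 < 1 - \<alpha>\<^sub>0" using \<alpha>\<^sub>0 by simp
  note mid = log_finite_midpoint[OF loga(1) W0sp_borel[OF aW] _ V1(4) W0sp_borel[OF V1(1)] V1(2) q W0sp_sublinear[OF order_refl \<alpha>\<^sub>0(2) mW]]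
  have "1 \<le> exp (p * log_int ?m / mass)" using mid(2) loga V1(5) p mass_pos by simp
  then have "\<mu> * 1 \<le> \<mu> * exp (p * log_int ?m / mass)" using \<mu>_pos by (intro mult_left_mono) auto
  also have "\<dots> \<le> snorm ?m powr p" by (rule log_inequality[OF mW]) (rule mid(1), simp)
  finally have gm: "\<mu> \<le> snorm ?m powr p" by simp
  let ?P = "lborel2 :: ('a \<times> 'a) measure"
  have "(\<lambda>x. (\<bar>v x\<bar> + V1 x) / 2) = (\<lambda>x. (1 / 2) * (\<bar>v x\<bar> + V1 x))" by simp
  then have dm: "diff_quot s p ?m = (\<lambda>z. (diff_quot s p ?a z + diff_quot s p V1 z) / 2)"
    by (simp only: diff_quot_cmult diff_quot_add) simp
  have "((\<lambda>i::nat. Lp_norm p ?P (\<lambda>z. diff_quot s p ?a z - diff_quot s p V1 z)) \<longlongrightarrow> 0) sequentially"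
  proof (rule Lp_uniformly_convex[OF p Wsp_diff_quot[OF p W(1)] Wsp_diff_quot[OF p W(2)]])
    show "powr_integral p ?P (diff_quot s p ?a) \<le> \<mu>" using ga gagliardo_powr[OF p W(1)] by simp
    show "powr_integral p ?P (diff_quot s p V1) \<le> \<mu>" using V1 gagliardo_powr[OF p W(2)] by simp
    show "\<forall>\<^sub>F i in sequentially. \<mu> - e \<le> powr_integral p ?P (\<lambda>z. (diff_quot s p ?a z + diff_quot s p V1 z) / 2)" if "0 < e" for e
      using gm gagliardo_powr[OF p W0sp_imp_Wsp[OF mW]] that by (simp add: dm)
  qed
  then have "Lp_norm p ?P (\<lambda>z. diff_quot s p ?a z - diff_quot s p V1 z) = 0"
    by (simp only: LIMSEQ_const_iff)
  then have "snorm (\<lambda>x. \<bar>v x\<bar> - V1 x) = 0"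
    by (simp only: Wsp_gagliardo[OF p Wsp_diff[OF p W(1,2)]] diff_quot_diff)
  then have "AE x in lborel. \<bar>v x\<bar> - V1 x = 0"
    by (intro W0sp_gagliardo_eq_0[OF p s \<Omega>_bounded W0sp_diff[OF p aW V1(1)]])
  then have eq: "AE x in lborel. \<bar>v x\<bar> = V1 x" by eventually_elim simp
  from sign show ?thesis
  proof
    assume "AE x in lborel. 0 \<le> v x"
    with eq have "AE x in lborel. v x = V1 x" by eventually_elim simp
    then show ?thesis ..
  next
    assume "AE x in lborel. v x \<le> 0"
    with eq have "AE x in lborel. v x = - V1 x" by eventually_elim simp
    then show ?thesis ..
  qed
qed

lemma log_integral_W0sp:
  "v \<in> W0 \<Longrightarrow> log_integral \<Omega> w v = (if log_finite v then ereal (log_int v) else - \<infinity>)"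
  using log_integral_eq[OF W0sp_borel, of v "1 - \<alpha>\<^sub>0"] W0sp_sublinear[of \<alpha>\<^sub>0 v] \<alpha>\<^sub>0 by simp

lemma log_manifold_iff:
  "v \<in> log_manifold \<Omega> s p w \<longleftrightarrow> v \<in> W0 \<and> log_finite v \<and> log_int v = 0"
  by (auto simp: log_manifold_def log_integral_W0sp zero_ereal_def split: if_splits)

text \<open>Both sides are homogeneous of degree p, so a v with finite logarithmic integral may be
  scaled onto the manifold, where equality means minimality. If the logarithmic integral is
  -\<infinity>, the left-hand side is 0, and equality forces v = 0, that is k = 0.\<close>

lemma log_equality_iff:
  assumes V1: "V1 \<in> W0" "AE x in lborel. 0 \<le> V1 x" "snorm V1 powr p = \<mu>" "log_finite V1" "log_int V1 = 0"
    and v: "v \<in> W0"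
  shows "ereal \<mu> * exp_ext (ereal (p / mass) * log_integral \<Omega> w v) = ereal (snorm v powr p) \<longleftrightarrow>
     (\<exists>k. AE x in lborel. v x = k * V1 x)"
proof -
  note W = W0sp_imp_Wsp[OF V1(1)] W0sp_imp_Wsp[OF v]
  have exp: "exp_ext (ereal (p / mass) * log_integral \<Omega> w v) = (if log_finite v then ereal (exp (p * log_int v / mass)) else 0)"
    using log_integral_W0sp[OF v] p mass_pos by (simp add: exp_ext_def)
  have lhs: "ereal \<mu> * exp_ext (ereal (p / mass) * log_integral \<Omega> w v) = ereal (snorm v powr p) \<longleftrightarrow>
     (if log_finite v then \<mu> * exp (p * log_int v / mass) else 0) = snorm v powr p"
    unfolding exp by (simp add: zero_ereal_def)
  show ?thesis unfolding lhs
  proof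
    assume eq: "(if log_finite v then \<mu> * exp (p * log_int v / mass) else 0) = snorm v powr p"
    show "\<exists>k. AE x in lborel. v x = k * V1 x"
    proof (cases "log_finite v")
      case False
      then have "snorm v = 0" using eq by simp
      then have "AE x in lborel. v x = 0" by (intro W0sp_gagliardo_eq_0[OF p s \<Omega>_bounded v])
      then show ?thesis by (intro exI[of _ 0]) simp
    next
      case True
      \<comment> \<open>Multiplication by c adds \<open>mass * ln c\<close> to the logarithmic
        integral; this value brings it to 0.\<close>
      define c where "c = exp (- log_int v / mass)"
      have c: "c \<noteq> 0" "0 < c" by (auto simp: c_def)
      have cW: "(\<lambda>x. c * v x) \<in> W0" by (rule W0sp_cmult[OF p v])
      have "snorm (\<lambda>x. c * v x) powr p = c powr p * snorm v powr p"
        using c by (simp add: gagliardo_cmult[OF p W(2)] powr_mult gagliardo_nonneg)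
      also have "\<dots> = \<mu> * (exp (- (p * log_int v / mass)) * exp (p * log_int v / mass))"
        using eq True by (simp add: c_def exp_powr_real mult_ac)
      also have "\<dots> = \<mu>" by (simp add: exp_add[symmetric])
      finally have g: "snorm (\<lambda>x. c * v x) powr p = \<mu>" .
      note L = log_cmult[OF c(1) True W0sp_borel[OF v]]
      have "log_int (\<lambda>x. c * v x) = 0" using L(2) mass_pos by (simp add: c_def)
      from log_minimizer_unique[OF V1 cW g L(1) this]
      show ?thesis
      proof
        assume "AE x in lborel. c * v x = V1 x"
        then have "AE x in lborel. v x = (1 / c) * V1 x" by eventually_elim (use c in \<open>simp add: field_simps\<close>)
        then show ?thesis ..
      next
        assume "AE x in lborel. c * v x = - V1 x"
        then have "AE x in lborel. v x = (- 1 / c) * V1 x" by eventually_elim (use c in \<open>simp add: field_simps\<close>)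
        then show ?thesis ..
      qed
    qed
  next
    assume "\<exists>k. AE x in lborel. v x = k * V1 x"
    then obtain k where k: "AE x in lborel. v x = k * V1 x" ..
    have "snorm v = snorm (\<lambda>x. k * V1 x)"
      by (rule gagliardo_cong_AE[OF p k W(2) Wsp_cmult[OF p W(1)]])
    then have g: "snorm v powr p = \<bar>k\<bar> powr p * \<mu>"
      using V1(3) by (simp add: gagliardo_cmult[OF p W(1)] powr_mult gagliardo_nonneg)
    have kW: "(\<lambda>x. k * V1 x) \<in> borel_measurable borel" using W0sp_borel[OF W0sp_cmult[OF p V1(1)]] .
    have "AE x in lborel. w x \<noteq> 0 \<longrightarrow> \<bar>v x\<bar> = \<bar>k * V1 x\<bar>" using k by eventually_elim simp
    note L = log_cong_AE[OF this W0sp_borel[OF v] kW]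
    show "(if log_finite v then \<mu> * exp (p * log_int v / mass) else 0) = snorm v powr p"
    proof (cases "k = 0")
      \<comment> \<open>For k = 0 the function v vanishes almost everywhere: its logarithmic
        integral is -\<infinity>, so both sides are 0.\<close>
      case True
      have "\<not> log_finite v"
      proof
        assume "log_finite v"
        then have "AE x in lborel. w x \<noteq> 0 \<longrightarrow> v x \<noteq> 0" by (simp add: log_finite_def)
        with k have "AE x in lborel. w x = 0" by eventually_elim (use True in auto)
        with w_nonzero show False by simp
      qed
      then show ?thesis using g True p by simp
    next
      case False
      note C = log_cmult[OF False V1(4) W0sp_borel[OF V1(1)]]
      have "p * log_int v / mass = p * ln \<bar>k\<bar>" using L C V1(5) mass_pos by simp
      moreover have "\<bar>k\<bar> powr p = exp (p * ln \<bar>k\<bar>)" using False by (simp add: powr_def)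
      ultimately show ?thesis using g L C by (simp add: mult.commute)
    qed
  qed
qed

end

section \<open>From the data of the theorem to the weighted problem\<close>

lemma set_integral_eq_weighted:
  fixes f \<omega> w :: "'a::euclidean_space \<Rightarrow> real"
  assumes "set_borel_measurable lborel \<Omega> \<omega>" and [measurable]: "w \<in> borel_measurable borel" "f \<in> borel_measurable borel"
    and eq: "AE x in lborel. indicator \<Omega> x * \<omega> x = w x"
  shows "(LINT x:\<Omega>|lborel. \<omega> x * f x) = (\<integral>x. w x * f x \<partial>lborel)"
  unfolding set_lebesgue_integral_def
proof (rule integral_cong_AE)
  have [measurable]: "(\<lambda>x. indicator \<Omega> x * \<omega> x) \<in> borel_measurable lborel"
    using assms(1) by (simp add: set_borel_measurable_def)
  have "(\<lambda>x. (indicator \<Omega> x * \<omega> x) * f x) \<in> borel_measurable lborel" by measurable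
  then show "(\<lambda>x. indicator \<Omega> x *\<^sub>R (\<omega> x * f x)) \<in> borel_measurable lborel" by (simp add: mult.assoc)
  show "AE x in lborel. indicator \<Omega> x *\<^sub>R (\<omega> x * f x) = w x * f x"
    using eq by eventually_elim (simp add: mult.assoc[symmetric])
qed simp

lemma log_integral_cong:
  assumes "AE x in lborel. x \<in> \<Omega> \<longrightarrow> \<omega> x = w x"
  shows "log_integral \<Omega> \<omega> v = log_integral \<Omega> w v"
proof -
  have "(\<integral>\<^sup>+ x\<in>\<Omega>. e2ennreal (ln_ext \<bar>v x\<bar> * ereal (\<omega> x)) \<partial>lborel) = (\<integral>\<^sup>+ x\<in>\<Omega>. e2ennreal (ln_ext \<bar>v x\<bar> * ereal (w x)) \<partial>lborel)"
    by (rule nn_integral_cong_AE) (use assms in eventually_elim, auto simp: indicator_def)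
  moreover have "(\<integral>\<^sup>+ x\<in>\<Omega>. e2ennreal (- (ln_ext \<bar>v x\<bar> * ereal (\<omega> x))) \<partial>lborel) = (\<integral>\<^sup>+ x\<in>\<Omega>. e2ennreal (- (ln_ext \<bar>v x\<bar> * ereal (w x))) \<partial>lborel)"
    by (rule nn_integral_cong_AE) (use assms in eventually_elim, auto simp: indicator_def)
  ultimately show ?thesis by (simp add: log_integral_def)
qed

theorem theorem4p0p5:
  fixes \<Omega> :: "'a::euclidean_space set"
    and s p r \<alpha>\<^sub>0 \<mu> :: real
    and \<omega> :: "'a \<Rightarrow> real"
    and u :: "real \<Rightarrow> 'a \<Rightarrow> real"
  assumes dim: "DIM('a) \<ge> 2"
    and dom: "bounded_smooth_domain \<Omega>"
    and s: "0 < s" "s < 1"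
    and p: "1 < p"
    and r: "1 < r"
    and \<omega>_meas: "set_borel_measurable lborel \<Omega> \<omega>"
    and \<omega>_Lr: "set_integrable lborel \<Omega> (\<lambda>x. \<bar>\<omega> x\<bar> powr r)"
    and \<omega>_nonneg: "AE x in lborel. x \<in> \<Omega> \<longrightarrow> 0 \<le> \<omega> x"
    and \<omega>_nonzero: "\<not> (AE x in lborel. x \<in> \<Omega> \<longrightarrow> \<omega> x = 0)"
    and \<alpha>\<^sub>0: "0 < \<alpha>\<^sub>0" "\<alpha>\<^sub>0 < 1"
    and r_ge: "\<And>\<alpha>. \<alpha>\<^sub>0 \<le> \<alpha> \<Longrightarrow> \<alpha> < 1 \<Longrightarrow> r_exp DIM('a) s p \<alpha> \<le> r"
    and u_sol: "\<And>\<alpha>. \<alpha>\<^sub>0 \<le> \<alpha> \<Longrightarrow> \<alpha> < 1 \<Longrightarrow> weak_solution \<Omega> s p \<omega> \<alpha> (u \<alpha>)"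
    and \<mu>: "((\<lambda>\<alpha>. lambda_min \<Omega> s p \<omega> \<alpha> * L1_norm \<Omega> \<omega> powr (p / (1 - \<alpha>))) \<longlongrightarrow> \<mu>) (at_left 1)"
  shows "\<exists>V. V \<in> log_manifold \<Omega> s p \<omega> \<and> (AE x in lborel. 0 \<le> V x) \<and>
    ((\<lambda>\<alpha>. gagliardo s p (\<lambda>x. V_normalized \<Omega> \<omega> \<alpha> (u \<alpha>) x - V x)) \<longlongrightarrow> 0) (at_left 1) \<and>
    log_minimizer \<Omega> s p \<omega> V \<and>
    (\<forall>v\<in>W0sp \<Omega> s p. log_minimizer \<Omega> s p \<omega> v \<longleftrightarrow>
       (AE x in lborel. v x = V x) \<or> (AE x in lborel. v x = - V x)) \<and>
    (\<forall>v\<in>W0sp \<Omega> s p.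
       ereal \<mu> * exp_ext (ereal (p / L1_norm \<Omega> \<omega>) * log_integral \<Omega> \<omega> v) = ereal (gagliardo s p v powr p) \<longleftrightarrow>
       (\<exists>k. AE x in lborel. v x = k * V x))"
proof -
  \<comment> \<open>The given \<omega> is measurable only on \<Omega> and nonnegative only almost
    everywhere there. Cutting off outside \<Omega> and below 0 gives a weight with these properties
    everywhere, equal to \<omega> almost everywhere on \<Omega>.\<close>
  define w where "w x = max 0 (indicator \<Omega> x * \<omega> x)" for x
  have \<Omega>: "open \<Omega>" "bounded \<Omega>" using dom by (auto simp: bounded_smooth_domain_def)
  have [measurable]: "(\<lambda>x. indicator \<Omega> x * \<omega> x) \<in> borel_measurable borel"
    using \<omega>_meas by (simp add: set_borel_measurable_def)
  have w_meas [measurable]: "w \<in> borel_measurable borel" unfolding w_def by measurable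
  have w_eq: "AE x in lborel. indicator \<Omega> x * \<omega> x = w x"
    using \<omega>_nonneg by eventually_elim (auto simp: w_def indicator_def)
  have w_eq': "AE x in lborel. x \<in> \<Omega> \<longrightarrow> \<omega> x = w x"
    using w_eq by eventually_elim auto
  have w_int: "integrable lborel w"
  proof (rule Bochner_Integration.integrable_bound)
    have "emeasure lborel \<Omega> < \<infinity>" using \<Omega> by (intro emeasure_bounded_finite)
    then show "integrable lborel (\<lambda>x. indicator \<Omega> x + indicator \<Omega> x *\<^sub>R \<bar>\<omega> x\<bar> powr r)"
      using \<omega>_Lr \<Omega> unfolding set_integrable_def
      by (intro Bochner_Integration.integrable_add integrable_real_indicator) auto
    show "AE x in lborel. norm (w x) \<le> norm (indicator \<Omega> x + indicator \<Omega> x *\<^sub>R \<bar>\<omega> x\<bar> powr r :: real)"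
    proof (rule AE_I2)
      fix x
      \<comment> \<open>On the bounded set \<Omega> constants are integrable, so this bound turns
        r-integrability into integrability.\<close>
      have "\<bar>\<omega> x\<bar> \<le> 1 + \<bar>\<omega> x\<bar> powr r"
      proof (cases "\<bar>\<omega> x\<bar> \<le> 1")
        case False
        then have "\<bar>\<omega> x\<bar> powr 1 \<le> \<bar>\<omega> x\<bar> powr r" using r by (intro powr_mono) auto
        then show ?thesis by simp
      qed (simp add: add_increasing2)
      then show "norm (w x) \<le> norm (indicator \<Omega> x + indicator \<Omega> x *\<^sub>R \<bar>\<omega> x\<bar> powr r :: real)"
        by (cases "x \<in> \<Omega>") (auto simp: w_def)
    qed
  qed simp
  have w_nonzero: "\<not> (AE x in lborel. w x = 0)"
  proof
    assume "AE x in lborel. w x = 0"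
    with w_eq' have "AE x in lborel. x \<in> \<Omega> \<longrightarrow> \<omega> x = 0" by eventually_elim auto
    with \<omega>_nonzero show False by simp
  qed
  interpret weighted_problem \<Omega> s p w
    using \<Omega> s p w_int w_nonzero by unfold_locales (auto simp: w_def)
  note weighted = set_integral_eq_weighted[OF \<omega>_meas w_meas _ w_eq]
  have L1: "L1_norm \<Omega> \<omega> = mass"
    unfolding L1_norm_def set_lebesgue_integral_def mass_def
  proof (rule integral_cong_AE)
    have "(\<lambda>x. \<bar>indicator \<Omega> x * \<omega> x\<bar>) \<in> borel_measurable lborel" by simp
    then show "(\<lambda>x. indicator \<Omega> x *\<^sub>R \<bar>\<omega> x\<bar>) \<in> borel_measurable lborel" by (simp add: abs_mult)
    show "AE x in lborel. indicator \<Omega> x *\<^sub>R \<bar>\<omega> x\<bar> = w x"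
      using \<omega>_nonneg by eventually_elim (auto simp: w_def indicator_def)
  qed simp
  have sublinear: "(LINT x:\<Omega>|lborel. \<bar>v x\<bar> powr q * \<omega> x) = (\<integral>x. w x * \<bar>v x\<bar> powr q \<partial>lborel)"
    if "v \<in> W0sp \<Omega> s p" for v q
  proof -
    have [measurable]: "v \<in> borel_measurable borel" using Wsp_measurable[OF W0sp_imp_Wsp[OF that]] by simp
    show ?thesis using weighted[of "\<lambda>x. \<bar>v x\<bar> powr q"] by (simp add: mult.commute)
  qed
  let ?V = "\<lambda>\<alpha>. V_normalized \<Omega> \<omega> \<alpha> (u \<alpha>)"
  have sol: "singular_solution \<Omega> s p w \<alpha> (u \<alpha>)" if \<alpha>: "\<alpha>\<^sub>0 \<le> \<alpha>" "\<alpha> < 1" for \<alpha>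
  proof unfold_locales
    note ws = u_sol[OF \<alpha>, unfolded weak_solution_def]
    show uW: "u \<alpha> \<in> W0sp \<Omega> s p" using ws by blast
    show "\<exists>C>0. AE x in lborel. x \<in> \<Omega>' \<longrightarrow> C \<le> u \<alpha> x"
      if "open \<Omega>'" "connected \<Omega>'" "compact (closure \<Omega>')" "closure \<Omega>' \<subseteq> \<Omega>" for \<Omega>'
      using ws that by blast
    have [measurable]: "u \<alpha> \<in> borel_measurable borel" using Wsp_measurable[OF W0sp_imp_Wsp[OF uW]] by simp
    fix \<phi> :: "'a \<Rightarrow> real" assume \<phi>: "\<phi> \<in> Cc_smooth \<Omega>"
    have [measurable]: "\<phi> \<in> borel_measurable borel" using Cc_smooth_measurable[OF p(1) \<phi>] by simp
    have "pairing s p (u \<alpha>) \<phi> = (LINT x:\<Omega>|lborel. \<omega> x * (\<phi> x / u \<alpha> x powr \<alpha>))" using ws \<phi> by simp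
    also have "\<dots> = (\<integral>x. w x * (\<phi> x / u \<alpha> x powr \<alpha>) \<partial>lborel)" by (rule weighted) measurable
    finally show "pairing s p (u \<alpha>) \<phi> = (\<integral>x. w x * \<phi> x / u \<alpha> x powr \<alpha> \<partial>lborel)" by simp
  qed (use \<alpha> \<alpha>\<^sub>0 in auto)
  \<comment> \<open>The integral in \<open>U_normalized\<close> is the p-th power of the seminorm of
    u, by the energy identity, so the two normalizing factors combine to the one in
    \<open>singular_solution.V\<close>.\<close>
  have V_eq: "?V \<alpha> = singular_solution.V s p w \<alpha> (u \<alpha>)" if \<alpha>: "\<alpha>\<^sub>0 \<le> \<alpha>" "\<alpha> < 1" for \<alpha>
  proof -
    interpret S: singular_solution \<Omega> s p w \<alpha> "u \<alpha>" by (rule sol[OF \<alpha>])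
    show ?thesis
      unfolding fun_eq_iff V_normalized_def U_normalized_def S.V_def L1 sublinear[OF S.u] S.energy_identity
      using mass_pos S.gagliardo_u_pos by (simp add: powr_divide powr_minus_divide minus_divide_left[symmetric])
  qed
  \<comment> \<open>With this identity the hypothesis on \<mu> becomes the convergence of energies
    required by \<open>extremal_family\<close>.\<close>
  have lambda: "lambda_min \<Omega> s p \<omega> \<alpha> * L1_norm \<Omega> \<omega> powr (p / (1 - \<alpha>)) = gagliardo s p (?V \<alpha>) powr p"
    if \<alpha>: "\<alpha>\<^sub>0 \<le> \<alpha>" "\<alpha> < 1" for \<alpha>
  proof -
    interpret S: singular_solution \<Omega> s p w \<alpha> "u \<alpha>" by (rule sol[OF \<alpha>])
    have "{gagliardo s p v powr p | v. v \<in> W0sp \<Omega> s p \<and> (LINT x:\<Omega>|lborel. \<bar>v x\<bar> powr (1 - \<alpha>) * \<omega> x) = 1} =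
        {gagliardo s p v powr p | v. v \<in> W0sp \<Omega> s p \<and> (\<integral>x. w x * \<bar>v x\<bar> powr (1 - \<alpha>) \<partial>lborel) = 1}"
      using sublinear by auto
    then show ?thesis using S.minimum_value by (simp add: lambda_min_def L1 V_eq[OF \<alpha>])
  qed
  have range: "eventually (\<lambda>\<alpha>. \<alpha>\<^sub>0 \<le> \<alpha> \<and> \<alpha> < 1) (at_left 1)"
    using eventually_at_left_real[OF \<alpha>\<^sub>0(2)] by eventually_elim auto
  interpret extremal_family \<Omega> s p w \<alpha>\<^sub>0 \<mu> ?V
  proof unfold_locales
    show "((\<lambda>\<alpha>. gagliardo s p (?V \<alpha>) powr p) \<longlongrightarrow> \<mu>) (at_left 1)"
      by (rule Lim_transform_eventually[OF \<mu>]) (use range in eventually_elim, simp add: lambda)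
    fix \<alpha> assume \<alpha>: "\<alpha>\<^sub>0 \<le> \<alpha>" "\<alpha> < 1"
    interpret S: singular_solution \<Omega> s p w \<alpha> "u \<alpha>" by (rule sol[OF \<alpha>])
    note V = V_eq[OF \<alpha>]
    show "?V \<alpha> \<in> W0sp \<Omega> s p" "AE x in lborel. 0 \<le> ?V \<alpha> x"
      "(\<integral>x. w x * \<bar>?V \<alpha> x\<bar> powr (1 - \<alpha>) \<partial>lborel) = mass" "0 < gagliardo s p (?V \<alpha>)"
      unfolding V by (rule S.V_W0sp S.V_nonneg S.V_constraint S.gagliardo_V_pos)+
    fix v assume v: "v \<in> W0sp \<Omega> s p"
    show "integrable lborel (\<lambda>x. w x * \<bar>v x\<bar> powr (1 - \<alpha>))" by (rule S.sublinear_bound(1)[OF v])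
    show "(\<integral>x. w x * \<bar>v x\<bar> powr (1 - \<alpha>) \<partial>lborel) * gagliardo s p (?V \<alpha>) powr (1 - \<alpha>) \<le> mass * gagliardo s p v powr (1 - \<alpha>)"
      unfolding V by (rule S.V_extremal[OF v])
  qed (use \<alpha>\<^sub>0 in auto)
  have log_w: "log_integral \<Omega> \<omega> v = log_integral \<Omega> w v" for v by (rule log_integral_cong[OF w_eq'])
  have manifold: "v \<in> log_manifold \<Omega> s p \<omega> \<longleftrightarrow> v \<in> W0sp \<Omega> s p \<and> log_finite v \<and> log_int v = 0" for v
    using log_manifold_iff[of v] by (simp add: log_manifold_def log_w)
  obtain V1 where V1: "V1 \<in> W0sp \<Omega> s p" "AE x in lborel. 0 \<le> V1 x"
    "((\<lambda>\<alpha>. gagliardo s p (\<lambda>x. ?V \<alpha> x - V1 x)) \<longlongrightarrow> 0) (at_left 1)"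
    "gagliardo s p V1 powr p = \<mu>" "log_finite V1" "log_int V1 = 0"
    by (rule exists_log_minimizer)
  have lower: "\<mu> \<le> gagliardo s p v powr p" if "v \<in> log_manifold \<Omega> s p \<omega>" for v
    using that log_inequality[of v] by (simp add: manifold)
  have V1M: "V1 \<in> log_manifold \<Omega> s p \<omega>" using V1 by (simp add: manifold)
  have minimizer: "log_minimizer \<Omega> s p \<omega> v \<longleftrightarrow> v \<in> log_manifold \<Omega> s p \<omega> \<and> gagliardo s p v powr p = \<mu>" for v
    unfolding log_minimizer_def using lower V1M V1(4) by (metis order_antisym)
  have unique: "log_minimizer \<Omega> s p \<omega> v \<longleftrightarrow> (AE x in lborel. v x = V1 x) \<or> (AE x in lborel. v x = - V1 x)"
    if v: "v \<in> W0sp \<Omega> s p" for v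
  proof
    assume "log_minimizer \<Omega> s p \<omega> v"
    then show "(AE x in lborel. v x = V1 x) \<or> (AE x in lborel. v x = - V1 x)"
      using log_minimizer_unique[OF V1(1,2,4-6) v] by (simp add: minimizer manifold)
  next
    note W = W0sp_imp_Wsp[OF v] W0sp_imp_Wsp[OF V1(1)]
    assume "(AE x in lborel. v x = V1 x) \<or> (AE x in lborel. v x = - V1 x)"
    then have "gagliardo s p v = gagliardo s p V1 \<and> (AE x in lborel. w x \<noteq> 0 \<longrightarrow> \<bar>v x\<bar> = \<bar>V1 x\<bar>)"
    proof
      assume eq: "AE x in lborel. v x = V1 x"
      then have "AE x in lborel. w x \<noteq> 0 \<longrightarrow> \<bar>v x\<bar> = \<bar>V1 x\<bar>" by eventually_elim simp
      then show ?thesis using gagliardo_cong_AE[OF p(1) eq W] by simp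
    next
      assume eq: "AE x in lborel. v x = - V1 x"
      then have "AE x in lborel. w x \<noteq> 0 \<longrightarrow> \<bar>v x\<bar> = \<bar>V1 x\<bar>" by eventually_elim simp
      moreover have "AE x in lborel. v x = (- 1) * V1 x" using eq by eventually_elim simp
      note gagliardo_cong_AE[OF p(1) this W(1) Wsp_cmult[OF p(1) W(2)]]
      ultimately show ?thesis by (simp only: gagliardo_cmult[OF p(1) W(2)]) simp
    qed
    then show "log_minimizer \<Omega> s p \<omega> v"
      using log_cong_AE[OF _ W0sp_borel[OF v] W0sp_borel[OF V1(1)]] V1 v by (simp add: minimizer manifold)
  qed
  show ?thesis
    using V1 V1M minimizer unique log_equality_iff[OF V1(1,2,4-6)] by (intro exI[of _ V1]) (simp add: L1 log_w)
qed

end
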